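(* Let $I$ be a measurable subset of $[-1,1]$. Then the following are equivalent. (i) $I$ is a Heisenberg wavelet set. (ii) $I$ is translation congruent with a subset of the unit interval $[0,1]$ and $I$ is dilation congruent with the Shannon set $[-1,-1/2)\cup[1/2,1)$.
   Context: All sets and functions are Lebesgue measurable, and subsets of $\mathbb{R}$ whose symmetric difference has Lebesgue measure zero are identified. Put $\Lambda=\mathbb{R}\setminus\{0\}$. For $I\subseteq\Lambda$, $L^2(I\times\mathbb{R})$ is taken with respect to the measure $|\lambda|\,d\lambda\,dt$ and is regarded as the subspace of $L^2(\Lambda\times\mathbb{R})$ of functions supported on $I\times\mathbb{R}$. A system $\{\psi_j\}_{j\in J}$ in a separable Hilbert space $\mathcal{H}$ is a Parseval frame for $\mathcal{H}$ if $\|f\|^2=\sum_{j\in J}|\langle f,\psi_j\rangle|^2$ for all $f\in\mathcal{H}$. For $k,l,m\in\mathbb{Z}$ and $g\in L^2(\Lambda\times\mathbb{R})$ put $\hat T_{k,l,m}g(\lambda,t)=e^{2\pi i\lambda m}e^{-2\pi i\lambda l t}g(\lambda,t-k)$. For $j\in\mathbb{Z}$ put $\hat D_jg(\lambda,t)=2^{3j/4}g(2^j\lambda,2^{-j/2}t)$. Gabor field over $I$ (lattice parameters $1,1$): a function $g\in L^2(I\times\mathbb{R})$ such that for a.e. $\lambda\in I$ the system $\{t\mapsto |\lambda|^{1/2}e^{-2\pi i\lambda l t}g(\lambda,t-k): k,l\in\mathbb{Z}\}$ is a Parseval frame for $L^2(\mathbb{R})$. $I$-wavelet: a function $g\in L^2(I\times\mathbb{R})$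 such that $\{\hat D_j\hat T_{k,l,m}g: j,k,l,m\in\mathbb{Z}\}$ is a Parseval frame for $L^2(\Lambda\times\mathbb{R})$. $I\subseteq[-1,1]$ is a Heisenberg wavelet set if every Gabor field over $I$ is an $I$-wavelet. Subsets $I,J$ of $\mathbb{R}$ are translation congruent if there is a bijection $\tau:I\to J$ and an integer-valued (measurable) function $k$ on $I$ with $\tau(\lambda)=\lambda+k(\lambda)$; they are dilation congruent if there is a bijection $\delta:I\to J$ and an integer-valued (measurable) function $j$ on $I$ with $\delta(\lambda)=2^{j(\lambda)}\lambda$. (Modulo null sets, $I$ is translation congruent with a subset of $[0,1]$ iff the integer translates of $I$ are disjoint, and dilation congruent with the Shannon set iff $\mathbb{R}$ is the disjoint union of the sets $2^jI$, $j\in\mathbb{Z}$.) *)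

theory Defs
  imports "HOL-Analysis.Analysis"
begin

text \<open>
  \<open>L2 M\<close> consists of representatives, not of classes modulo almost-everywhere equality.  The inner
  product and the norm below do not depend on the representative.
\<close>

definition L2 :: "'a measure \<Rightarrow> ('a \<Rightarrow> complex) set" where
  "L2 M = {f \<in> borel_measurable M. integrable M (\<lambda>x. (cmod (f x))\<^sup>2)}"

definition L2_inner :: "'a measure \<Rightarrow> ('a \<Rightarrow> complex) \<Rightarrow> ('a \<Rightarrow> complex) \<Rightarrow> complex" where
  "L2_inner M f g = (\<integral>x. f x * cnj (g x) \<partial>M)"

definition L2_norm :: "'a measure \<Rightarrow> ('a \<Rightarrow> complex) \<Rightarrow> real" where
  "L2_norm M f = sqrt (\<integral>x. (cmod (f x))\<^sup>2 \<partial>M)"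

definition L2_parseval_frame :: "'a measure \<Rightarrow> 'j set \<Rightarrow> ('j \<Rightarrow> 'a \<Rightarrow> complex) \<Rightarrow> bool" where
  "L2_parseval_frame M J \<psi> \<longleftrightarrow>
     (\<forall>j\<in>J. \<psi> j \<in> L2 M) \<and>
     (\<forall>f\<in>L2 M. ((\<lambda>j. (cmod (L2_inner M f (\<psi> j)))\<^sup>2) has_sum (L2_norm M f)\<^sup>2) J)"

text \<open>
  The frequency variable \<open>\<lambda>\<close> of the mathematical text is written \<open>w\<close>.  The measure is
  \<open>\<bar>w\<bar> dw dt\<close> on \<open>\<Lambda> \<times> \<real>\<close>; the values of a function on \<open>{0} \<times> \<real>\<close> play no role.
\<close>

definition Lam :: "real set" where
  "Lam = UNIV - {0}"

definition heis_measure :: "(real \<times> real) measure" where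
  "heis_measure = density (lebesgue_on (Lam \<times> UNIV)) (\<lambda>(w, t). ennreal \<bar>w\<bar>)"

text \<open>
  \<open>L\<^sup>2(I \<times> \<real>)\<close> as the subspace of \<open>L\<^sup>2(\<Lambda> \<times> \<real>)\<close> of the functions supported on \<open>I \<times> \<real>\<close>,
  the support being understood up to null sets.
\<close>

definition L2_over :: "real set \<Rightarrow> (real \<times> real \<Rightarrow> complex) set" where
  "L2_over I = {g \<in> L2 heis_measure. AE (w, t) in heis_measure. w \<notin> I \<longrightarrow> g (w, t) = 0}"

definition hatT :: "int \<Rightarrow> int \<Rightarrow> int \<Rightarrow> (real \<times> real \<Rightarrow> complex) \<Rightarrow> real \<times> real \<Rightarrow> complex" where
  "hatT k l m g = (\<lambda>(w, t).
     exp (2 * of_real pi * \<i> * of_real w * of_int m) *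
     exp (- 2 * of_real pi * \<i> * of_real w * of_int l * of_real t) *
     g (w, t - of_int k))"

definition hatD :: "int \<Rightarrow> (real \<times> real \<Rightarrow> complex) \<Rightarrow> real \<times> real \<Rightarrow> complex" where
  "hatD j g = (\<lambda>(w, t).
     of_real (2 powr (3 * of_int j / 4)) *
     g (2 powr of_int j * w, 2 powr (- of_int j / 2) * t))"

definition gabor_field :: "real set \<Rightarrow> (real \<times> real \<Rightarrow> complex) \<Rightarrow> bool" where
  "gabor_field I g \<longleftrightarrow>
     g \<in> L2_over I \<and>
     (AE w in lebesgue. w \<in> I \<longrightarrow>
        L2_parseval_frame (lebesgue :: real measure) (UNIV :: (int \<times> int) set)
          (\<lambda>(k, l) t. of_real (\<bar>w\<bar> powr (1 / 2)) *
             exp (- 2 * of_real pi * \<i> * of_real w * of_int l * of_real t) *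
             g (w, t - of_int k)))"

definition heis_wavelet :: "real set \<Rightarrow> (real \<times> real \<Rightarrow> complex) \<Rightarrow> bool" where
  "heis_wavelet I g \<longleftrightarrow>
     g \<in> L2_over I \<and>
     L2_parseval_frame heis_measure (UNIV :: (int \<times> int \<times> int \<times> int) set)
       (\<lambda>(j, k, l, m). hatD j (hatT k l m g))"

definition heisenberg_wavelet_set :: "real set \<Rightarrow> bool" where
  "heisenberg_wavelet_set I \<longleftrightarrow>
     I \<in> sets lebesgue \<and> I \<subseteq> {-1..1} \<and> (\<forall>g. gabor_field I g \<longrightarrow> heis_wavelet I g)"

text \<open>
  Subsets of the line are identified when they differ by a null set, so the congruences below only
  require the bijection between suitable representatives of the two sets.
\<close>

definition null_equal :: "real set \<Rightarrow> real set \<Rightarrow> bool" where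
  "null_equal A B \<longleftrightarrow> A \<in> sets lebesgue \<and> B \<in> sets lebesgue \<and> (A - B) \<union> (B - A) \<in> null_sets lebesgue"

definition translation_congruent :: "real set \<Rightarrow> real set \<Rightarrow> bool" where
  "translation_congruent I J \<longleftrightarrow>
     (\<exists>I' J' \<tau>. null_equal I I' \<and> null_equal J J' \<and> bij_betw \<tau> I' J' \<and>
        (\<exists>k :: real \<Rightarrow> int. k \<in> measurable (lebesgue_on I') (count_space UNIV) \<and>
           (\<forall>x\<in>I'. \<tau> x = x + of_int (k x))))"

definition dilation_congruent :: "real set \<Rightarrow> real set \<Rightarrow> bool" where
  "dilation_congruent I J \<longleftrightarrow>
     (\<exists>I' J' \<delta>. null_equal I I' \<and> null_equal J J' \<and> bij_betw \<delta> I' J' \<and>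
        (\<exists>j :: real \<Rightarrow> int. j \<in> measurable (lebesgue_on I') (count_space UNIV) \<and>
           (\<forall>x\<in>I'. \<delta> x = 2 powr of_int (j x) * x)))"

definition shannon_set :: "real set" where
  "shannon_set = {-1..<-1/2} \<union> {1/2..<1}"

end

theory Submission
  imports Defs
begin

text \<open>
  Two geometric conditions on \<open>I\<close>, both modulo null sets, are the real content of the two
  congruences: \<open>I\<close> and \<open>I - 1\<close> do not overlap (for a subset of \<open>[-1, 1]\<close> this makes all integer
  translates disjoint), and almost every point lies in exactly one dilate \<open>2\<^sup>j I\<close>.  A
  congruence gives these conditions because two points of \<open>I\<close> in the same orbit of translations
  (dilations) would be mapped to the same point of the unit interval (Shannon set); conversely a
  set meeting almost every orbit at most (exactly) once can be moved orbit by orbit.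

  Sufficiency.  Fix \<open>k\<close>, \<open>l\<close> and write \<open>c(w)\<close> for the product of \<open>\<bar>w\<bar>\<close> with the inner product in \<open>t\<close> of
  \<open>f(w, \<sqdot>)\<close> and the modulated translate of \<open>g(w, \<sqdot>)\<close>.  The inner products of \<open>f\<close> with the functions
  \<open>hatT k l m g\<close>, \<open>m \<in> \<int>\<close>, are the Fourier coefficients of \<open>c\<close>, a function supported on
  \<open>I\<close>.  As the translates of \<open>I\<close> are disjoint, Parseval's identity on the circle gives
  \<open>\<integral> \<bar>c\<bar>\<^sup>2\<close>; summing over \<open>k\<close>, \<open>l\<close> inside the integral and using the Gabor frame property at each
  \<open>w\<close> gives the squared norm of the restriction of \<open>f\<close> to \<open>I \<times> \<real>\<close>
  (\<open>parseval_time_frequency\<close>).  Dilations are unitary, so the sum over \<open>j\<close> adds up the squared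
  norms of the restrictions to the dilates of \<open>I\<close>, which tile (\<open>wavelet_sum\<close>).

  Necessity.  Gabor fields over \<open>I\<close> exist: the indicator of a unit interval in \<open>t\<close> is one, because
  \<open>\<bar>w\<bar> \<le> 1\<close> on \<open>I\<close> (\<open>window_frame\<close>).  Multiplying a field by a function of \<open>w\<close> of modulus one
  gives another.  Changing the sign of the window for \<open>w < 0\<close>, and adding the two frame
  identities, removes the interaction between the positive and the negative part of \<open>I\<close>; each part
  lies in an interval of length one, so its translates are disjoint and the computation above
  applies to it.  The outcome is that the dilates of \<open>I\<close> tile
  (\<open>wavelet_set_dilates_tile\<close>).  If \<open>K = I \<inter> (I - 1)\<close> had positive measure, a function that
  looks the same over \<open>K\<close> and over \<open>K + 1\<close> in the variable \<open>w * t\<close> would be orthogonal to the whole system of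
  the field with the sign change, which contradicts the frame identity
  (\<open>wavelet_set_translates_disjoint\<close>).

  Parseval's identity on the circle is proved from scratch: continuous functions are dense, and by
  the Stone-Weierstrass theorem they are approximated by trigonometric polynomials.
\<close>

section \<open>Sums as integrals, and square-integrable functions\<close>

text \<open>
  Sums of squares are interchanged with integrals in \<open>w\<close> and \<open>t\<close> throughout.  As integrals of
  nonnegative functions over a counting measure they obey Tonelli's theorem, so no summability
  needs to be checked along the way.
\<close>

lemma has_sum_iff_nn_integral_count_space:
  fixes f :: "'a \<Rightarrow> real"
  assumes "\<And>x. x \<in> A \<Longrightarrow> 0 \<le> f x" and "0 \<le> s"
  shows "(f has_sum s) A \<longleftrightarrow> (\<integral>\<^sup>+x. ennreal (f x) \<partial>count_space A) = ennreal s"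
proof
  assume s: "(f has_sum s) A"
  then have "Infinite_Sum.abs_summable_on f A"
    using summable_on_iff_abs_summable_on_real has_sum_imp_summable by blast
  then have *: "Infinite_Set_Sum.abs_summable_on f A"
    using abs_summable_equivalent by blast
  then have "(\<integral>\<^sup>+x. ennreal (f x) \<partial>count_space A) = ennreal (infsetsum f A)"
    by (rule nn_integral_conv_infsetsum) (use assms in auto)
  also have "infsetsum f A = s"
    using infsetsum_infsum[OF *] infsumI[OF s] by simp
  finally show "(\<integral>\<^sup>+x. ennreal (f x) \<partial>count_space A) = ennreal s" .
next
  assume s: "(\<integral>\<^sup>+x. ennreal (f x) \<partial>count_space A) = ennreal s"
  have "(\<integral>\<^sup>+x. ennreal (norm (f x)) \<partial>count_space A) = (\<integral>\<^sup>+x. ennreal (f x) \<partial>count_space A)"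
    by (rule nn_integral_cong) (use assms in auto)
  with s have *: "Infinite_Set_Sum.abs_summable_on f A"
    unfolding Infinite_Set_Sum.abs_summable_on_def integrable_iff_bounded by simp
  then have "(\<integral>\<^sup>+x. ennreal (f x) \<partial>count_space A) = ennreal (infsetsum f A)"
    by (rule nn_integral_conv_infsetsum) (use assms in auto)
  moreover have "0 \<le> infsetsum f A" by (rule infsetsum_nonneg) (use assms in auto)
  ultimately have "infsetsum f A = s" using s assms(2) by simp
  then have "infsum f A = s" using infsetsum_infsum[OF *] by simp
  moreover have "f summable_on A"
    using * abs_summable_equivalent summable_on_iff_abs_summable_on_real by blast
  ultimately show "(f has_sum s) A" by auto
qed

lemma L2_measurable [measurable_dest]: "f \<in> L2 M \<Longrightarrow> f \<in> borel_measurable M"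
  by (simp add: L2_def)

lemma L2_integrable: "f \<in> L2 M \<Longrightarrow> integrable M (\<lambda>x. (cmod (f x))\<^sup>2)"
  by (simp add: L2_def)

lemma borel_measurable_cnj [measurable (raw)]:
  "f \<in> borel_measurable M \<Longrightarrow> (\<lambda>x. cnj (f x)) \<in> borel_measurable M"
  by (rule borel_measurable_continuous_on[OF continuous_on_cnj[OF continuous_on_id]])

lemma cmod_sum_le: "(cmod (a + b))\<^sup>2 \<le> 2 * (cmod a)\<^sup>2 + 2 * (cmod b)\<^sup>2"
proof -
  have "(cmod (a + b))\<^sup>2 \<le> (cmod a + cmod b)\<^sup>2"
    by (intro power_mono norm_triangle_ineq norm_ge_zero)
  also have "\<dots> \<le> 2 * (cmod a)\<^sup>2 + 2 * (cmod b)\<^sup>2"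
    using sum_squares_bound[of "cmod a" "cmod b"] by (simp add: power2_sum)
  finally show ?thesis .
qed

lemma L2_iff_nn_integral:
  assumes "f \<in> borel_measurable M"
  shows "f \<in> L2 M \<longleftrightarrow> (\<integral>\<^sup>+x. ennreal ((cmod (f x))\<^sup>2) \<partial>M) < \<infinity>"
  using assms by (simp add: L2_def integrable_iff_bounded)

lemma L2_norm_sq: "(L2_norm M f)\<^sup>2 = (\<integral>x. (cmod (f x))\<^sup>2 \<partial>M)"
  by (simp add: L2_norm_def)

lemma L2_nn_integral:
  assumes "f \<in> L2 M"
  shows "(\<integral>\<^sup>+x. ennreal ((cmod (f x))\<^sup>2) \<partial>M) = ennreal ((L2_norm M f)\<^sup>2)"
  using assms by (simp add: L2_def nn_integral_eq_integral L2_norm_def)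

lemma L2_add:
  assumes [measurable]: "f \<in> L2 M" "g \<in> L2 M"
  shows "(\<lambda>x. f x + g x) \<in> L2 M"
proof -
  have "integrable M (\<lambda>x. 2 * (cmod (f x))\<^sup>2 + 2 * (cmod (g x))\<^sup>2)"
    using assms by (intro Bochner_Integration.integrable_add integrable_mult_right L2_integrable)
  then have "integrable M (\<lambda>x. (cmod (f x + g x))\<^sup>2)"
    by (rule Bochner_Integration.integrable_bound) (auto intro!: AE_I2 cmod_sum_le)
  then show ?thesis by (simp add: L2_def)
qed

lemma L2_scale:
  assumes [measurable]: "f \<in> L2 M"
  shows "(\<lambda>x. c * f x) \<in> L2 M"
  using L2_integrable[OF assms] by (simp add: L2_def norm_mult power_mult_distrib)

lemma L2_diff: "f \<in> L2 M \<Longrightarrow> g \<in> L2 M \<Longrightarrow> (\<lambda>x. f x - g x) \<in> L2 M"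
  using L2_add[of f M "\<lambda>x. -1 * g x"] L2_scale[of g M "-1"] by simp

lemma integrable_L2_mult:
  assumes [measurable]: "f \<in> L2 M" "g \<in> L2 M"
  shows "integrable M (\<lambda>x. f x * cnj (g x))"
proof (rule Bochner_Integration.integrable_bound)
  show "integrable M (\<lambda>x. (cmod (f x))\<^sup>2 + (cmod (g x))\<^sup>2)"
    using assms by (intro Bochner_Integration.integrable_add L2_integrable)
  have "cmod a * cmod b \<le> (cmod a)\<^sup>2 + (cmod b)\<^sup>2" for a b
    using sum_squares_bound[of "cmod a" "cmod b"] mult_nonneg_nonneg[OF norm_ge_zero[of a] norm_ge_zero[of b]]
    by linarith
  then show "AE x in M. norm (f x * cnj (g x)) \<le> norm ((cmod (f x))\<^sup>2 + (cmod (g x))\<^sup>2)"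
    by (auto simp: norm_mult intro!: AE_I2)
qed measurable

lemma L2_inner_diff_left:
  assumes "f \<in> L2 M" "g \<in> L2 M" "h \<in> L2 M"
  shows "L2_inner M (\<lambda>x. f x - g x) h = L2_inner M f h - L2_inner M g h"
  using assms by (simp add: L2_inner_def left_diff_distrib integrable_L2_mult)

lemma L2_inner_add_right:
  assumes "f \<in> L2 M" "g \<in> L2 M" "h \<in> L2 M"
  shows "L2_inner M f (\<lambda>x. g x + h x) = L2_inner M f g + L2_inner M f h"
  using assms by (simp add: L2_inner_def distrib_left integrable_L2_mult)

lemma L2_inner_scale_left: "L2_inner M (\<lambda>x. c * f x) g = c * L2_inner M f g"
  by (simp add: L2_inner_def mult.assoc)

lemma L2_inner_scale_right: "L2_inner M f (\<lambda>x. c * g x) = cnj c * L2_inner M f g"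
  by (simp add: L2_inner_def mult.left_commute)

lemma L2_inner_self: "L2_inner M f f = of_real ((L2_norm M f)\<^sup>2)"
  by (simp add: L2_inner_def L2_norm_def complex_norm_square[symmetric] del: of_real_power)

lemma L2_norm_diff_scale:
  assumes [measurable]: "h \<in> L2 M" "e \<in> L2 M"
  shows "(L2_norm M (\<lambda>x. h x - c * e x))\<^sup>2 =
    (L2_norm M h)\<^sup>2 - 2 * Re (cnj c * L2_inner M h e) + (cmod c)\<^sup>2 * (L2_norm M e)\<^sup>2"
proof -
  have eq: "(cmod (h x - c * e x))\<^sup>2 =
      (cmod (h x))\<^sup>2 - 2 * Re (cnj c * (h x * cnj (e x))) + (cmod c)\<^sup>2 * (cmod (e x))\<^sup>2" for x
    unfolding cmod_power2 by (simp add: power2_eq_square algebra_simps)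
  have i: "integrable M (\<lambda>x. cnj c * (h x * cnj (e x)))"
    using integrable_L2_mult[OF assms] by simp
  define r where "r x = Re (cnj c * (h x * cnj (e x)))" for x
  have r: "integrable M r" "integral\<^sup>L M r = Re (cnj c * L2_inner M h e)"
    unfolding r_def using integrable_Re[OF i] integral_Re[OF i]
    by (simp_all add: L2_inner_def del: Re_complex_of_real)
  have "(\<integral>x. (cmod (h x - c * e x))\<^sup>2 \<partial>M) =
      (\<integral>x. (cmod (h x))\<^sup>2 \<partial>M) - 2 * (\<integral>x. r x \<partial>M) + (cmod c)\<^sup>2 * (\<integral>x. (cmod (e x))\<^sup>2 \<partial>M)"
    unfolding eq r_def[symmetric]
    using L2_integrable[OF assms(1)] L2_integrable[OF assms(2)] r(1) by simp
  then show ?thesis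
    unfolding L2_norm_sq r(2) .
qed

definition orthonormal_L2 :: "'a measure \<Rightarrow> ('i \<Rightarrow> 'a \<Rightarrow> complex) \<Rightarrow> bool" where
  "orthonormal_L2 M e \<longleftrightarrow> (\<forall>i. e i \<in> L2 M) \<and>
     (\<forall>i j. L2_inner M (e i) (e j) = (if i = j then 1 else 0))"

text \<open>
  Subtracting \<open>c i * e i\<close> does not change the coefficients of \<open>h\<close> with respect to the other \<open>e j\<close>, so
  it suffices to complete the square for one index at a time.
\<close>

lemma L2_norm_best_approximation:
  assumes "orthonormal_L2 M e" and "finite F" and "h \<in> L2 M"
  shows "(L2_norm M (\<lambda>x. h x - (\<Sum>i\<in>F. c i * e i x)))\<^sup>2 =
    (L2_norm M h)\<^sup>2 - (\<Sum>i\<in>F. (cmod (L2_inner M h (e i)))\<^sup>2)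
      + (\<Sum>i\<in>F. (cmod (L2_inner M h (e i) - c i))\<^sup>2)"
  using assms(2,3)
proof (induction F arbitrary: h)
  case (insert i F)
  have e: "e j \<in> L2 M" "L2_inner M (e i) (e j) = (if i = j then 1 else 0)" for i j
    using assms(1) by (auto simp: orthonormal_L2_def)
  have ei: "(L2_norm M (e i))\<^sup>2 = 1"
    using L2_inner_self[of M "e i"] e(2)[of i i] by (simp flip: of_real_power)
  let ?h = "\<lambda>x. h x - c i * e i x"
  have h: "?h \<in> L2 M" using insert e by (intro L2_diff L2_scale)
  have in_j: "L2_inner M ?h (e j) = L2_inner M h (e j)" if "j \<in> F" for j
    using that insert.hyps insert.prems e L2_scale[OF e(1)]
    by (subst L2_inner_diff_left) (auto simp: L2_inner_scale_left)
  have "(L2_norm M (\<lambda>x. h x - (\<Sum>j\<in>insert i F. c j * e j x)))\<^sup>2 =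
        (L2_norm M (\<lambda>x. ?h x - (\<Sum>j\<in>F. c j * e j x)))\<^sup>2"
    using insert.hyps by (simp add: algebra_simps)
  also have "\<dots> = (L2_norm M ?h)\<^sup>2 - (\<Sum>j\<in>F. (cmod (L2_inner M h (e j)))\<^sup>2)
      + (\<Sum>j\<in>F. (cmod (L2_inner M h (e j) - c j))\<^sup>2)"
    using insert.IH[OF h] in_j by (simp cong: sum.cong)
  also have "(L2_norm M ?h)\<^sup>2 = (L2_norm M h)\<^sup>2 - (cmod (L2_inner M h (e i)))\<^sup>2
      + (cmod (L2_inner M h (e i) - c i))\<^sup>2"
    using L2_norm_diff_scale[OF insert.prems e(1)[of i], of "c i"] ei
    by (simp add: cmod_power2) (simp add: power2_eq_square algebra_simps)
  finally show ?case using insert.hyps by simp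
qed simp

text \<open>
  The partial sums are bounded by the squared norm (Bessel), and they come arbitrarily close to it
  because no combination of the \<open>e i\<close>, \<open>i \<in> F\<close>, approximates \<open>h\<close> better than the one formed with
  the inner products.
\<close>

lemma parseval_of_total:
  assumes on: "orthonormal_L2 M e" and h: "h \<in> L2 M"
    and total: "\<And>\<epsilon>. 0 < \<epsilon> \<Longrightarrow>
      \<exists>F c. finite F \<and> (L2_norm M (\<lambda>x. h x - (\<Sum>i\<in>F. c i * e i x)))\<^sup>2 < \<epsilon>"
  shows "((\<lambda>i. (cmod (L2_inner M h (e i)))\<^sup>2) has_sum (L2_norm M h)\<^sup>2) UNIV"
proof -
  let ?a = "\<lambda>i. (cmod (L2_inner M h (e i)))\<^sup>2" and ?N = "(L2_norm M h)\<^sup>2"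
  have bessel: "sum ?a F \<le> ?N" if "finite F" for F
    using L2_norm_best_approximation[OF on that h, of "\<lambda>i. L2_inner M h (e i)"]
      zero_le_power2[of "L2_norm M (\<lambda>x. h x - (\<Sum>i\<in>F. L2_inner M h (e i) * e i x))"]
    by simp
  (* The nonnegative last sum of L2_norm_best_approximation measures how far c is from optimal. *)
  have big: "\<exists>F. finite F \<and> ?N - \<epsilon> < sum ?a F" if \<epsilon>: "0 < \<epsilon>" for \<epsilon>
  proof -
    obtain F c where F: "finite F" "(L2_norm M (\<lambda>x. h x - (\<Sum>i\<in>F. c i * e i x)))\<^sup>2 < \<epsilon>"
      using total[OF \<epsilon>] by blast
    have "0 \<le> (\<Sum>i\<in>F. (cmod (L2_inner M h (e i) - c i))\<^sup>2)" by (intro sum_nonneg) simp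
    then show ?thesis
      using F L2_norm_best_approximation[OF on F(1) h, of c] by (intro exI[of _ F]) simp
  qed
  show ?thesis
    unfolding has_sum_def
  proof (rule tendstoI)
    fix \<epsilon> :: real assume "0 < \<epsilon>"
    then obtain F where F: "finite F" "?N - \<epsilon> < sum ?a F" using big by blast
    have "dist (sum ?a G) ?N < \<epsilon>" if "finite G" "F \<subseteq> G" for G
    proof -
      have "sum ?a F \<le> sum ?a G" using that by (intro sum_mono2) auto
      then show ?thesis using bessel[OF that(1)] F(2) by (simp add: dist_real_def)
    qed
    then show "\<forall>\<^sub>F G in finite_subsets_at_top UNIV. dist (sum ?a G) ?N < \<epsilon>"
      unfolding eventually_finite_subsets_at_top using F(1) by blast
  qed
qed

section \<open>Completeness of the exponentials on the unit interval\<close>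

definition e2pi :: "real \<Rightarrow> complex" where
  "e2pi x = cis (2 * pi * x)"

lemma e2pi_add: "e2pi (x + y) = e2pi x * e2pi y"
  by (simp add: e2pi_def cis_mult distrib_left)

lemma cnj_e2pi: "cnj (e2pi x) = e2pi (- x)"
  by (simp add: e2pi_def cis_cnj)

lemma norm_e2pi [simp]: "cmod (e2pi x) = 1"
  by (simp add: e2pi_def)

lemma e2pi_of_int [simp]: "e2pi (of_int n) = 1"
  by (simp add: e2pi_def cis_multiple_2pi)

lemma e2pi_add_of_int: "e2pi (x + of_int n) = e2pi x"
  by (simp add: e2pi_add)

lemma e2pi_zero [simp]: "e2pi 0 = 1"
  by (simp add: e2pi_def)

lemma continuous_on_e2pi: "continuous_on A f \<Longrightarrow> continuous_on A (\<lambda>x. e2pi (f x))"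
  unfolding e2pi_def by (intro continuous_intros)

lemma measurable_e2pi [measurable]: "e2pi \<in> borel_measurable borel"
  using continuous_on_e2pi[OF continuous_on_id] by (rule borel_measurable_continuous_onI)

definition trig_poly :: "(real \<Rightarrow> complex) \<Rightarrow> bool" where
  "trig_poly q \<longleftrightarrow> (\<exists>F c. finite F \<and> q = (\<lambda>x. \<Sum>m\<in>F. c m * e2pi (of_int m * x)))"

lemma trig_poly_monomial: "trig_poly (\<lambda>x. c * e2pi (of_int m * x))"
  unfolding trig_poly_def by (intro exI[of _ "{m}"] exI[of _ "\<lambda>_. c"]) simp

lemma trig_poly_add:
  assumes "trig_poly p" "trig_poly q"
  shows "trig_poly (\<lambda>x. p x + q x)"
proof -
  obtain F c G d where F: "finite F" "finite G"
    and p: "p = (\<lambda>x. \<Sum>m\<in>F. c m * e2pi (of_int m * x))"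
    and q: "q = (\<lambda>x. \<Sum>m\<in>G. d m * e2pi (of_int m * x))"
    using assms unfolding trig_poly_def by blast
  define c' d' where "c' m = (if m \<in> F then c m else 0)" and "d' m = (if m \<in> G then d m else 0)" for m
  have "p x = (\<Sum>m\<in>F \<union> G. c' m * e2pi (of_int m * x))" for x
    unfolding p using F by (intro sum.mono_neutral_cong_left) (auto simp: c'_def)
  moreover have "q x = (\<Sum>m\<in>F \<union> G. d' m * e2pi (of_int m * x))" for x
    unfolding q using F by (intro sum.mono_neutral_cong_left) (auto simp: d'_def)
  ultimately have "p x + q x = (\<Sum>m\<in>F \<union> G. (c' m + d' m) * e2pi (of_int m * x))" for x
    by (simp add: sum.distrib distrib_right)
  then show ?thesis
    unfolding trig_poly_def using F by (intro exI[of _ "F \<union> G"] exI[of _ "\<lambda>m. c' m + d' m"]) auto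
qed

lemma trig_poly_sum: "finite F \<Longrightarrow> (\<And>i. i \<in> F \<Longrightarrow> trig_poly (p i)) \<Longrightarrow> trig_poly (\<lambda>x. \<Sum>i\<in>F. p i x)"
proof (induction F rule: finite_induct)
  case empty
  show ?case using trig_poly_monomial[of 0 0] by simp
qed (simp add: trig_poly_add)

lemma trig_poly_mult:
  assumes "trig_poly p" "trig_poly q"
  shows "trig_poly (\<lambda>x. p x * q x)"
proof -
  obtain F c G d where F: "finite F" "finite G"
    and p: "p = (\<lambda>x. \<Sum>m\<in>F. c m * e2pi (of_int m * x))"
    and q: "q = (\<lambda>x. \<Sum>m\<in>G. d m * e2pi (of_int m * x))"
    using assms unfolding trig_poly_def by blast
  have "p x * q x = (\<Sum>m\<in>F. \<Sum>n\<in>G. (c m * d n) * e2pi (of_int (m + n) * x))" for x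
    unfolding p q sum_product of_int_add distrib_right e2pi_add by (simp add: mult_ac)
  then show ?thesis
    using F by (simp only:) (intro trig_poly_sum trig_poly_monomial; simp)
qed

lemma trig_poly_const: "trig_poly (\<lambda>x. c)"
  using trig_poly_monomial[of c 0] by simp

text \<open>
  On the unit circle the coordinates \<open>Re z\<close> and \<open>Im z\<close> are combinations of \<open>z\<close> and \<open>cnj z\<close>, that is of
  the exponentials with frequencies \<open>1\<close> and \<open>-1\<close>.
\<close>

lemma trig_poly_real_polynomial:
  fixes p :: "complex \<Rightarrow> real"
  assumes "real_polynomial_function p"
  shows "trig_poly (\<lambda>x. of_real (p (e2pi x)))"
  using assms
proof (induction rule: real_polynomial_function.induct)
  case (linear f)
  have f: "f z = Re z * f 1 + Im z * f \<i>" for z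
  proof -
    interpret bounded_linear f by fact
    have "f z = f (Re z *\<^sub>R 1 + Im z *\<^sub>R \<i>)"
      by (rule arg_cong[where f = f]) (simp add: complex_eq_iff)
    also have "\<dots> = Re z *\<^sub>R f 1 + Im z *\<^sub>R f \<i>" by (simp only: add scale)
    finally show ?thesis by simp
  qed
  have re: "of_real (Re z) = (z + cnj z) / 2" and im: "of_real (Im z) = (z - cnj z) / (2 * \<i>)" for z
    by (simp_all add: complex_eq_iff Re_divide Im_divide)
  have "of_real (f (e2pi x)) =
      (of_real (f 1) / 2 + of_real (f \<i>) / (2 * \<i>)) * e2pi (of_int 1 * x)
      + (of_real (f 1) / 2 - of_real (f \<i>) / (2 * \<i>)) * e2pi (of_int (- 1) * x)" for x
    unfolding f[of "e2pi x"] of_real_add of_real_mult re im by (simp add: cnj_e2pi field_simps)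
  then show ?case
    by (simp only:) (intro trig_poly_add trig_poly_monomial)
qed (simp_all add: trig_poly_const trig_poly_add trig_poly_mult)

lemma trig_poly_polynomial_function:
  fixes p :: "complex \<Rightarrow> complex"
  assumes "polynomial_function p"
  shows "trig_poly (\<lambda>x. p (e2pi x))"
proof -
  have "trig_poly (\<lambda>x. of_real (Re (p (e2pi x))))" "trig_poly (\<lambda>x. of_real (Im (p (e2pi x))))"
    using trig_poly_real_polynomial[of "Re \<circ> p"] trig_poly_real_polynomial[of "Im \<circ> p"] assms
    by (auto simp: polynomial_function_def bounded_linear_Re bounded_linear_Im)
  then have "trig_poly (\<lambda>x. of_real (Re (p (e2pi x))) + \<i> * of_real (Im (p (e2pi x))))"
    by (intro trig_poly_add trig_poly_mult trig_poly_const)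
  then show ?thesis by (simp add: complex_eq[symmetric])
qed

abbreviation unit_interval :: "real measure" where
  "unit_interval \<equiv> restrict_space lborel {0..1}"

lemma finite_measure_unit_interval: "finite_measure unit_interval"
  by (rule finite_measureI) (simp add: space_restrict_space emeasure_restrict_space)

lemma L2_bounded:
  assumes "finite_measure M" "f \<in> borel_measurable M" "\<And>x. x \<in> space M \<Longrightarrow> cmod (f x) \<le> C"
  shows "f \<in> L2 M"
proof -
  have "integrable M (\<lambda>x. (cmod (f x))\<^sup>2)"
    by (rule finite_measure.integrable_const_bound[where B = "C\<^sup>2"])
      (use assms in \<open>auto intro!: power_mono\<close>)
  then show ?thesis using assms by (simp add: L2_def)
qed

lemma measurable_unit_interval: "f \<in> borel_measurable borel \<Longrightarrow> f \<in> borel_measurable unit_interval"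
  by (rule measurable_restrict_space1) simp

lemma e2pi_L2: "(\<lambda>x. e2pi (y * x)) \<in> L2 unit_interval"
  by (rule L2_bounded[OF finite_measure_unit_interval, where C = 1]) (auto intro: measurable_unit_interval)

lemma orthonormal_e2pi: "orthonormal_L2 unit_interval (\<lambda>m x. e2pi (of_int m * x))"
  unfolding orthonormal_L2_def
proof (intro conjI allI e2pi_L2)
  fix m n :: int
  have eq: "e2pi (of_int m * x) * cnj (e2pi (of_int n * x)) = e2pi (of_int (m - n) * x)" for x
    by (simp add: cnj_e2pi left_diff_distrib flip: e2pi_add)
  have "L2_inner unit_interval (\<lambda>x. e2pi (of_int m * x)) (\<lambda>x. e2pi (of_int n * x)) =
      (\<integral>x. indicator {0..1} x *\<^sub>R e2pi (of_int (m - n) * x) \<partial>lborel)"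
    unfolding L2_inner_def eq by (rule integral_restrict_space) simp
  also have "\<dots> = (if m = n then 1 else 0)"
  proof (cases "m = n")
    case True
    then show ?thesis by simp
  next
    case False
    define k where "k = m - n"
    have k: "complex_of_int k \<noteq> 0" using False by (simp add: k_def)
    let ?G = "\<lambda>x. e2pi (of_int k * x) / (2 * pi * \<i> * of_int k)"
    have "(?G has_vector_derivative e2pi (of_int k * x)) (at x within {0..1})" for x
    proof -
      have "((\<lambda>x. exp (2 * pi * \<i> * of_int k * of_real x)) has_vector_derivative
          (2 * pi * \<i> * of_int k) * exp (2 * pi * \<i> * of_int k * of_real x)) (at x within {0..1})"
        by (rule has_vector_derivative_real_field) (auto intro!: derivative_eq_intros)
      then have "((\<lambda>x. exp (2 * pi * \<i> * of_int k * of_real x) / (2 * pi * \<i> * of_int k))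
         has_vector_derivative ((2 * pi * \<i> * of_int k) * exp (2 * pi * \<i> * of_int k * of_real x)) / (2 * pi * \<i> * of_int k))
         (at x within {0..1})"
        by (rule has_vector_derivative_divide)
      then show ?thesis
        using k by (simp add: e2pi_def cis_conv_exp mult_ac)
    qed
    then have "has_bochner_integral lborel (\<lambda>x. indicator {0..1} x *\<^sub>R e2pi (of_int k * x)) (?G 1 - ?G 0)"
      by (intro has_bochner_integral_FTC_Icc continuous_on_e2pi continuous_intros) auto
    then have "(\<integral>x. indicator {0..1} x *\<^sub>R e2pi (of_int k * x) \<partial>lborel) = ?G 1 - ?G 0"
      by (rule has_bochner_integral_integral_eq)
    also have "\<dots> = 0" by simp
    finally show ?thesis
      using False by (simp add: k_def)
  qed
  finally show "L2_inner unit_interval (\<lambda>x. e2pi (of_int m * x)) (\<lambda>x. e2pi (of_int n * x)) =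
      (if m = n then 1 else 0)" .
qed

lemma Arg2pi_e2pi: "0 \<le> x \<Longrightarrow> x < 1 \<Longrightarrow> Arg2pi (e2pi x) = 2 * pi * x"
  by (rule Arg2pi_unique[of 1]) (auto simp: e2pi_def cis_conv_exp)

lemma e2pi_neq_1: "0 < x \<Longrightarrow> x < 1 \<Longrightarrow> e2pi x \<noteq> 1"
  using Arg2pi_e2pi[of x] Arg2pi_of_real[of 1] by auto

text \<open>
  Wrapping a function on the interval around the circle creates a jump at the point \<open>1\<close>, where
  the ends meet.  The factor vanishing there restores continuity, at the price of a change near one
  point that is negligible in square mean for large \<open>r\<close>.
\<close>

lemma continuous_on_circle_of_interval:
  fixes g :: "real \<Rightarrow> complex"
  assumes g: "continuous_on UNIV g" and C: "\<And>x. cmod (g x) \<le> C"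
  shows "continuous_on (sphere 0 1)
    (\<lambda>z. of_real (min 1 (r * cmod (z - 1))) * g (Arg2pi z / (2 * pi)))"
    (is "continuous_on _ ?F")
  unfolding continuous_on_eq_continuous_within
proof
  fix z :: complex assume z: "z \<in> sphere 0 1"
  show "continuous (at z within sphere 0 1) ?F"
  proof (cases "z = 1")
    case False
    have "z \<notin> \<real>\<^sub>\<ge>\<^sub>0"
      using z False by (auto simp: complex_nonneg_Reals_iff complex_eq_iff cmod_def power2_eq_1_iff)
    then have "isCont Arg2pi z" by (rule continuous_at_Arg2pi)
    moreover have "isCont g x" for x using g by (simp add: continuous_on_eq_continuous_at)
    ultimately have "isCont (\<lambda>z. g (Arg2pi z / (2 * pi))) z"
      by (intro continuous_intros isCont_o2[where g = g and f = "\<lambda>z. Arg2pi z / (2 * pi)"]) auto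
    then have "isCont ?F z" by (intro continuous_intros)
    then show ?thesis by (rule continuous_at_imp_continuous_within)
  next
    case True
    have "isCont ?F 1"
      unfolding isCont_def
    proof (rule tendsto_norm_zero_cancel[THEN tendsto_eq_rhs], rule Lim_null_comparison)
      show "\<forall>\<^sub>F w in at 1. norm (norm (?F w)) \<le> \<bar>min 1 (r * cmod (w - 1))\<bar> * C"
        using C by (auto simp: norm_mult intro!: always_eventually mult_left_mono)
      have "((\<lambda>w. \<bar>min 1 (r * cmod (w - 1))\<bar> * C) \<longlongrightarrow> \<bar>min 1 (r * cmod (1 - 1))\<bar> * C) (at 1)"
        by (intro tendsto_intros)
      then show "((\<lambda>w. \<bar>min 1 (r * cmod (w - 1))\<bar> * C) \<longlongrightarrow> 0) (at 1)" by simp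
    qed simp
    then show ?thesis using True continuous_at_imp_continuous_within by blast
  qed
qed

lemma L2_norm_sq_triangle:
  assumes "f \<in> L2 M" "g \<in> L2 M" "h \<in> L2 M"
  shows "(L2_norm M (\<lambda>x. f x - h x))\<^sup>2 \<le>
    2 * (L2_norm M (\<lambda>x. f x - g x))\<^sup>2 + 2 * (L2_norm M (\<lambda>x. g x - h x))\<^sup>2"
proof -
  note i = L2_integrable[OF L2_diff[OF assms(1,2)]] L2_integrable[OF L2_diff[OF assms(2,3)]]
    L2_integrable[OF L2_diff[OF assms(1,3)]]
  have "(\<integral>x. (cmod (f x - h x))\<^sup>2 \<partial>M) \<le> (\<integral>x. 2 * (cmod (f x - g x))\<^sup>2 + 2 * (cmod (g x - h x))\<^sup>2 \<partial>M)"
  proof (rule integral_mono)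
    show "(cmod (f x - h x))\<^sup>2 \<le> 2 * (cmod (f x - g x))\<^sup>2 + 2 * (cmod (g x - h x))\<^sup>2" for x
      using cmod_sum_le[of "f x - g x" "g x - h x"] by simp
  qed (use i in auto)
  also have "\<dots> = 2 * (\<integral>x. (cmod (f x - g x))\<^sup>2 \<partial>M) + 2 * (\<integral>x. (cmod (g x - h x))\<^sup>2 \<partial>M)"
    using i by simp
  finally show ?thesis unfolding L2_norm_sq .
qed

text \<open>
  A measurable function is almost everywhere a limit of continuous functions.  Projecting these to
  the ball of radius \<open>C\<close> keeps the limit and makes dominated convergence available.
\<close>

lemma bounded_approx_circle:
  fixes f :: "real \<Rightarrow> complex"
  assumes [measurable]: "f \<in> borel_measurable borel" and C: "\<And>x. cmod (f x) \<le> C" and "0 < \<epsilon>"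
  shows "\<exists>F. continuous_on (sphere 0 1) F \<and> (\<lambda>x. F (e2pi x)) \<in> L2 unit_interval \<and>
    (L2_norm unit_interval (\<lambda>x. f x - F (e2pi x)))\<^sup>2 < \<epsilon>"
proof -
  have "f \<in> borel_measurable lebesgue" by (rule measurable_completion) simp
  then have "f measurable_on UNIV" by (rule lebesgue_measurable_imp_measurable_on) simp
  then obtain N g where N: "negligible N" and g: "\<And>n. continuous_on UNIV (g n)"
    and lim: "\<And>x. x \<notin> N \<Longrightarrow> (\<lambda>n. g n x) \<longlonglongrightarrow> f x"
    unfolding measurable_on_def by auto
  have C0: "0 \<le> C" using C norm_ge_zero order_trans by blast
  let ?B = "cball 0 C :: complex set"
  (* The projection is continuous and fixes the values of f, so the limit is unchanged. *)
  define h where "h n x = closest_point ?B (g n x)" for n x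
  have B: "convex ?B" "closed ?B" "?B \<noteq> {}" using C0 by auto
  have h_cont: "continuous_on UNIV (h n)" for n
    unfolding h_def by (rule continuous_on_compose2[OF continuous_on_closest_point[OF B] g]) auto
  have h_bd: "cmod (h n x) \<le> C" for n x
    using closest_point_in_set[OF B(2,3), of "g n x"] by (simp add: h_def)
  have h_lim: "(\<lambda>n. h n x) \<longlonglongrightarrow> f x" if "x \<notin> N" for x
  proof -
    have "(\<lambda>n. closest_point ?B (g n x)) \<longlonglongrightarrow> closest_point ?B (f x)"
      using lim[OF that] continuous_at_closest_point[OF B] by (rule isCont_tendsto_compose[rotated])
    then show ?thesis using C[of x] by (simp add: h_def closest_point_self)
  qed
  define F where "F n z = of_real (min 1 (real n * cmod (z - 1))) * h n (Arg2pi z / (2 * pi))" for n z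
  have F_cont: "continuous_on (sphere 0 1) (F n)" for n
    unfolding F_def by (rule continuous_on_circle_of_interval[OF h_cont h_bd])
  have F_bd: "cmod (F n z) \<le> C" for n z
    unfolding F_def norm_mult norm_of_real
    using mult_mono[OF _ h_bd, of "\<bar>min 1 (real n * cmod (z - 1))\<bar>" 1 n "Arg2pi z / (2 * pi)"] by auto
  have "continuous_on {0..1} (\<lambda>x. F n (e2pi x))" for n
    by (rule continuous_on_compose2[OF F_cont continuous_on_e2pi[OF continuous_on_id]]) auto
  then have F_meas [measurable]: "(\<lambda>x. F n (e2pi x)) \<in> borel_measurable unit_interval" for n
    using borel_measurable_continuous_on_restrict measurable_cong_sets[OF sets_restrict_space_cong[OF sets_lborel] refl]
    by blast
  have f_meas [measurable]: "f \<in> borel_measurable unit_interval" by (rule measurable_unit_interval) simp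
  have F_L2: "(\<lambda>x. F n (e2pi x)) \<in> L2 unit_interval" for n
    by (rule L2_bounded[OF finite_measure_unit_interval F_meas]) (rule F_bd)
  have F_lim: "(\<lambda>n. F n (e2pi x)) \<longlonglongrightarrow> f x" if x: "0 < x" "x < 1" "x \<notin> N" for x
  proof -
    have pos: "cmod (e2pi x - 1) > 0" using e2pi_neq_1[OF x(1,2)] by simp
    then have "filterlim (\<lambda>n. real n * cmod (e2pi x - 1)) at_top sequentially"
      by (rule filterlim_at_top_mult_tendsto_pos[OF tendsto_const _ filterlim_real_sequentially])
    then have "\<forall>\<^sub>F n in sequentially. 1 \<le> real n * cmod (e2pi x - 1)"
      unfolding filterlim_at_top by blast
    then have "\<forall>\<^sub>F n in sequentially. min 1 (real n * cmod (e2pi x - 1)) = 1"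
      by (rule eventually_mono) (simp add: min_def)
    then have "\<forall>\<^sub>F n in sequentially. h n x = F n (e2pi x)"
      by (rule eventually_mono) (use x in \<open>simp add: F_def Arg2pi_e2pi\<close>)
    then show ?thesis using h_lim[OF x(3)] by (rule Lim_transform_eventually[rotated])
  qed
  have "(\<lambda>n. \<integral>x. (cmod (f x - F n (e2pi x)))\<^sup>2 \<partial>unit_interval) \<longlonglongrightarrow> (\<integral>x. 0 \<partial>unit_interval)"
  proof (rule integral_dominated_convergence[where w = "\<lambda>_. (2 * C)\<^sup>2"])
    show "integrable unit_interval (\<lambda>_. (2 * C)\<^sup>2)"
      by (rule finite_measure.integrable_const[OF finite_measure_unit_interval])
    have "AE x in lebesgue. x \<notin> N"
      using N by (metis AE_not_in negligible_iff_null_sets)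
    then have "AE x in lborel. x \<notin> N" by (simp add: AE_completion_iff)
    then have ae: "AE x in lborel. x \<notin> N \<and> x \<noteq> 0 \<and> x \<noteq> 1"
      using AE_lborel_singleton[of 0] AE_lborel_singleton[of 1] by eventually_elim auto
    have "AE x in unit_interval. x \<notin> N \<and> x \<noteq> 0 \<and> x \<noteq> 1 \<and> x \<in> {0..1}"
      by (subst AE_restrict_space_iff) (use ae in auto)
    then show "AE x in unit_interval. (\<lambda>n. (cmod (f x - F n (e2pi x)))\<^sup>2) \<longlonglongrightarrow> 0"
    proof eventually_elim
      case (elim x)
      then have "(\<lambda>n. F n (e2pi x)) \<longlonglongrightarrow> f x" by (intro F_lim) auto
      then have "(\<lambda>n. (cmod (f x - F n (e2pi x)))\<^sup>2) \<longlonglongrightarrow> (cmod (f x - f x))\<^sup>2"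
        by (intro tendsto_intros)
      then show ?case by simp
    qed
    show "AE x in unit_interval. norm ((cmod (f x - F n (e2pi x)))\<^sup>2) \<le> (2 * C)\<^sup>2" for n
    proof (rule AE_I2)
      fix x
      have "cmod (f x - F n (e2pi x)) \<le> 2 * C"
        using norm_triangle_ineq4[of "f x" "F n (e2pi x)"] C[of x] F_bd[of n "e2pi x"] by linarith
      then show "norm ((cmod (f x - F n (e2pi x)))\<^sup>2) \<le> (2 * C)\<^sup>2"
        using power_mono[of _ "2 * C" 2] by simp
    qed
  qed simp_all
  then have "\<forall>\<^sub>F n in sequentially. (\<integral>x. (cmod (f x - F n (e2pi x)))\<^sup>2 \<partial>unit_interval) < \<epsilon>"
    using \<open>0 < \<epsilon>\<close> by (simp add: order_tendsto_iff)
  then obtain n where "(\<integral>x. (cmod (f x - F n (e2pi x)))\<^sup>2 \<partial>unit_interval) < \<epsilon>"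
    by (meson eventually_sequentially order_refl)
  then show ?thesis
    using F_cont F_L2 by (intro exI[of _ "F n"]) (simp add: L2_norm_sq)
qed

lemma L2_truncate:
  assumes f: "f \<in> L2 M" and "0 < \<epsilon>"
  shows "\<exists>n::nat. (L2_norm M (\<lambda>x. f x - (if cmod (f x) \<le> n then f x else 0)))\<^sup>2 < \<epsilon>"
proof -
  note [measurable] = L2_measurable[OF f]
  have "(\<lambda>n. \<integral>x. (cmod (f x - (if cmod (f x) \<le> real n then f x else 0)))\<^sup>2 \<partial>M) \<longlonglongrightarrow> (\<integral>x. 0 \<partial>M)"
  proof (rule integral_dominated_convergence[where w = "\<lambda>x. (cmod (f x))\<^sup>2"])
    show "AE x in M. (\<lambda>n. (cmod (f x - (if cmod (f x) \<le> real n then f x else 0)))\<^sup>2) \<longlonglongrightarrow> 0"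
    proof (rule AE_I2)
      fix x
      have "\<forall>\<^sub>F n in sequentially. (cmod (f x - (if cmod (f x) \<le> real n then f x else 0)))\<^sup>2 = 0"
        using eventually_ge_at_top[of "nat \<lceil>cmod (f x)\<rceil>"]
        by eventually_elim (auto simp: nat_le_iff ceiling_le_iff)
      then show "(\<lambda>n. (cmod (f x - (if cmod (f x) \<le> real n then f x else 0)))\<^sup>2) \<longlonglongrightarrow> 0"
        by (rule tendsto_eventually)
    qed
  qed (use L2_integrable[OF f] in auto)
  then have "\<forall>\<^sub>F n in sequentially. (\<integral>x. (cmod (f x - (if cmod (f x) \<le> real n then f x else 0)))\<^sup>2 \<partial>M) < \<epsilon>"
    using \<open>0 < \<epsilon>\<close> by (simp add: order_tendsto_iff)
  then show ?thesis
    unfolding L2_norm_sq by (meson eventually_sequentially order_refl)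
qed

text \<open>
  Three successive approximations: by a bounded function, by a continuous function on the circle,
  and by a polynomial in \<open>Re z\<close> and \<open>Im z\<close>.
\<close>

lemma trig_poly_dense:
  assumes [measurable]: "f \<in> borel_measurable borel" and f: "f \<in> L2 unit_interval" and \<epsilon>: "0 < \<epsilon>"
  shows "\<exists>q. trig_poly q \<and> (L2_norm unit_interval (\<lambda>x. f x - q x))\<^sup>2 < \<epsilon>"
proof -
  let ?U = unit_interval
  obtain n :: nat where n: "(L2_norm ?U (\<lambda>x. f x - (if cmod (f x) \<le> n then f x else 0)))\<^sup>2 < \<epsilon> / 8"
    using L2_truncate[OF f, of "\<epsilon> / 8"] \<epsilon> by auto
  define g where "g x = (if cmod (f x) \<le> n then f x else 0)" for x
  have [measurable]: "g \<in> borel_measurable borel" unfolding g_def by measurable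
  have g_bd: "cmod (g x) \<le> n" for x by (simp add: g_def)
  have g_L2: "g \<in> L2 ?U"
    by (rule L2_bounded[OF finite_measure_unit_interval _ g_bd]) (simp add: measurable_unit_interval)
  obtain F where F: "continuous_on (sphere 0 1) F" "(\<lambda>x. F (e2pi x)) \<in> L2 ?U"
      "(L2_norm ?U (\<lambda>x. g x - F (e2pi x)))\<^sup>2 < \<epsilon> / 16"
    using bounded_approx_circle[of g n "\<epsilon> / 16"] g_bd \<epsilon> by auto
  (* On a probability space a uniform error \<delta> contributes at most \<delta>\<^sup>2. *)
  define \<delta> where "\<delta> = sqrt (\<epsilon> / 16)"
  have \<delta>: "0 < \<delta>" "\<delta>\<^sup>2 = \<epsilon> / 16" using \<epsilon> by (auto simp: \<delta>_def)
  obtain p where p: "polynomial_function p" "\<And>z. z \<in> sphere 0 1 \<Longrightarrow> cmod (F z - p z) < \<delta>"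
    using Stone_Weierstrass_polynomial_function[OF compact_sphere F(1) \<delta>(1)] by blast
  have q: "trig_poly (\<lambda>x. p (e2pi x))" by (rule trig_poly_polynomial_function) fact
  have q_meas: "(\<lambda>x. p (e2pi x)) \<in> borel_measurable borel"
    by (intro borel_measurable_continuous_onI continuous_on_compose2[OF continuous_on_polymonial_function[OF p(1)]]
        continuous_on_e2pi continuous_on_id) auto
  have d_bd: "cmod (F (e2pi x) - p (e2pi x)) \<le> \<delta>" for x
    using p(2)[of "e2pi x"] by simp
  have d_L2: "(\<lambda>x. F (e2pi x) - p (e2pi x)) \<in> L2 ?U"
    by (rule L2_bounded[OF finite_measure_unit_interval _ d_bd])
      (use L2_measurable[OF F(2)] measurable_unit_interval[OF q_meas] in measurable)
  have q_L2: "(\<lambda>x. p (e2pi x)) \<in> L2 ?U"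
    using L2_diff[OF F(2) d_L2] by simp
  have "(\<integral>x. (cmod (F (e2pi x) - p (e2pi x)))\<^sup>2 \<partial>?U) \<le> (\<integral>x. \<delta>\<^sup>2 \<partial>?U)"
    using L2_integrable[OF d_L2] finite_measure.integrable_const[OF finite_measure_unit_interval]
    by (intro integral_mono) (auto intro: power_mono d_bd)
  also have "\<dots> = \<epsilon> / 16" by (simp add: \<delta>(2) measure_restrict_space space_restrict_space)
  finally have Fp: "(L2_norm ?U (\<lambda>x. F (e2pi x) - p (e2pi x)))\<^sup>2 \<le> \<epsilon> / 16" by (simp add: L2_norm_sq)
  have "(L2_norm ?U (\<lambda>x. g x - p (e2pi x)))\<^sup>2 < \<epsilon> / 4"
    using L2_norm_sq_triangle[OF g_L2 F(2) q_L2] F(3) Fp by linarith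
  then have "(L2_norm ?U (\<lambda>x. f x - p (e2pi x)))\<^sup>2 < \<epsilon>"
    using L2_norm_sq_triangle[OF f g_L2 q_L2] n \<epsilon> unfolding g_def[symmetric] by linarith
  then show ?thesis using q by blast
qed

lemma parseval_unit_interval:
  assumes "f \<in> borel_measurable borel" and f: "f \<in> L2 unit_interval"
  shows "((\<lambda>m::int. (cmod (L2_inner unit_interval f (\<lambda>x. e2pi (of_int m * x))))\<^sup>2)
    has_sum (L2_norm unit_interval f)\<^sup>2) UNIV"
proof (rule parseval_of_total[OF orthonormal_e2pi f])
  fix \<epsilon> :: real assume "0 < \<epsilon>"
  then obtain q where "trig_poly q" "(L2_norm unit_interval (\<lambda>x. f x - q x))\<^sup>2 < \<epsilon>"
    using trig_poly_dense[OF assms] by blast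
  then show "\<exists>F c. finite F \<and>
      (L2_norm unit_interval (\<lambda>x. f x - (\<Sum>m\<in>F. c m * e2pi (of_int m * x))))\<^sup>2 < \<epsilon>"
    unfolding trig_poly_def by blast
qed

section \<open>Parseval identity for functions with disjoint integer translates\<close>

lemma AE_unit_interval: "(AE x in lborel. P x) \<Longrightarrow> AE x in unit_interval. P x"
  by (subst AE_restrict_space_iff) (auto elim: eventually_mono)

text \<open>
  A function on an interval of length two is folded onto the unit interval.  The two halves
  share end points, which are null.
\<close>

lemma nn_integral_periodise:
  fixes k :: "real \<Rightarrow> ennreal"
  assumes [measurable]: "k \<in> borel_measurable borel" and supp: "\<And>x. x \<notin> {0..<2} \<Longrightarrow> k x = 0"
  shows "(\<integral>\<^sup>+x. k x \<partial>lborel) = (\<integral>\<^sup>+x. k x + k (x + 1) \<partial>unit_interval)"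
proof -
  let ?i = "indicator {0..1} :: real \<Rightarrow> ennreal"
  have "AE x in lborel. x \<noteq> 1 \<and> x \<noteq> 2"
    using AE_lborel_singleton[of 1] AE_lborel_singleton[of 2] by eventually_elim auto
  then have "AE x in lborel. k x = ?i x * k x + ?i (x - 1) * k x"
  proof eventually_elim
    case (elim x)
    then show ?case using supp[of x] by (auto simp: indicator_def)
  qed
  then have "(\<integral>\<^sup>+x. k x \<partial>lborel) = (\<integral>\<^sup>+x. ?i x * k x + ?i (x - 1) * k x \<partial>lborel)"
    by (rule nn_integral_cong_AE)
  also have "\<dots> = (\<integral>\<^sup>+x. ?i x * k x \<partial>lborel) + (\<integral>\<^sup>+x. ?i (x - 1) * k x \<partial>lborel)"
    by (rule nn_integral_add) auto
  also have "(\<integral>\<^sup>+x. ?i (x - 1) * k x \<partial>lborel) = (\<integral>\<^sup>+x. ?i x * k (x + 1) \<partial>lborel)"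
    by (subst nn_integral_real_affine[where c = 1 and t = 1]) (simp_all add: add.commute)
  also have "(\<integral>\<^sup>+x. ?i x * k x \<partial>lborel) + (\<integral>\<^sup>+x. ?i x * k (x + 1) \<partial>lborel) =
      (\<integral>\<^sup>+x. (k x + k (x + 1)) * ?i x \<partial>lborel)"
    by (subst nn_integral_add[symmetric]) (auto simp: algebra_simps)
  finally show ?thesis by (simp add: nn_integral_restrict_space)
qed

lemma integral_periodise:
  fixes k :: "real \<Rightarrow> complex"
  assumes k: "integrable lborel k" and supp: "\<And>x. x \<notin> {0..<2} \<Longrightarrow> k x = 0"
  shows "(\<integral>x. k x \<partial>lborel) = (\<integral>x. k x + k (x + 1) \<partial>unit_interval)"
proof -
  let ?i = "indicator {0..1} :: real \<Rightarrow> real"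
  have [measurable]: "k \<in> borel_measurable borel" using k by auto
  have k1: "integrable lborel (\<lambda>x. k (x + 1))"
    using lborel_integrable_real_affine[OF k, of 1 1] by (simp add: add.commute)
  have i: "integrable lborel (\<lambda>x. ?i x *\<^sub>R k x)" "integrable lborel (\<lambda>x. ?i (x - 1) *\<^sub>R k x)"
    "integrable lborel (\<lambda>x. ?i x *\<^sub>R k (x + 1))"
    by (rule Bochner_Integration.integrable_bound[OF k], auto simp: indicator_def)
      (rule Bochner_Integration.integrable_bound[OF k] Bochner_Integration.integrable_bound[OF k1], auto simp: indicator_def)+
  have "AE x in lborel. x \<noteq> 1 \<and> x \<noteq> 2"
    using AE_lborel_singleton[of 1] AE_lborel_singleton[of 2] by eventually_elim auto
  then have "AE x in lborel. k x = ?i x *\<^sub>R k x + ?i (x - 1) *\<^sub>R k x"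
  proof eventually_elim
    case (elim x)
    then show ?case using supp[of x] by (auto simp: indicator_def)
  qed
  then have "(\<integral>x. k x \<partial>lborel) = (\<integral>x. ?i x *\<^sub>R k x + ?i (x - 1) *\<^sub>R k x \<partial>lborel)"
    by (intro integral_cong_AE) auto
  also have "\<dots> = (\<integral>x. ?i x *\<^sub>R k x \<partial>lborel) + (\<integral>x. ?i (x - 1) *\<^sub>R k x \<partial>lborel)"
    using i by simp
  also have "(\<integral>x. ?i (x - 1) *\<^sub>R k x \<partial>lborel) = (\<integral>x. ?i x *\<^sub>R k (x + 1) \<partial>lborel)"
    by (subst lborel_integral_real_affine[where c = 1 and t = 1]) (simp_all add: add.commute)
  also have "(\<integral>x. ?i x *\<^sub>R k x \<partial>lborel) + (\<integral>x. ?i x *\<^sub>R k (x + 1) \<partial>lborel) =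
      (\<integral>x. ?i x *\<^sub>R (k x + k (x + 1)) \<partial>lborel)"
    using i by (simp add: scaleR_add_right)
  finally show ?thesis by (simp add: integral_restrict_space)
qed

text \<open>
  The exponentials have period one, so \<open>h\<close> and its periodisation \<open>h x + h (x + 1)\<close> have the same Fourier
  coefficients.  They also have the same norm, since at most one of the two summands is nonzero.
\<close>

lemma parseval_disjoint_translates_from_0:
  fixes h :: "real \<Rightarrow> complex"
  assumes [measurable]: "h \<in> borel_measurable borel"
    and supp: "\<And>x. x \<notin> {0..<2} \<Longrightarrow> h x = 0"
    and disj: "AE x in lborel. h x = 0 \<or> h (x + 1) = 0"
    and fin: "(\<integral>\<^sup>+x. ennreal ((cmod (h x))\<^sup>2) \<partial>lborel) < \<infinity>"
  shows "(\<integral>\<^sup>+m. ennreal ((cmod (\<integral>x. h x * e2pi (- (of_int m * x)) \<partial>lborel))\<^sup>2) \<partial>count_space UNIV) =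
    (\<integral>\<^sup>+x. ennreal ((cmod (h x))\<^sup>2) \<partial>lborel)"
proof -
  have "integrable lborel h"
  proof (rule Bochner_Integration.integrable_bound)
    show "integrable lborel (\<lambda>x. indicator {0..2} x + (cmod (h x))\<^sup>2)"
      using fin by (intro Bochner_Integration.integrable_add) (auto simp: integrable_iff_bounded ennreal_indicator)
    (* Square-integrability on a set of finite measure gives integrability. *)
    have "cmod z \<le> 1 + (cmod z)\<^sup>2" for z :: complex
    proof -
      have "2 * cmod z \<le> 1 + (cmod z)\<^sup>2" using sum_squares_bound[of 1 "cmod z"] by simp
      then show ?thesis using norm_ge_zero[of z] by linarith
    qed
    then show "AE x in lborel. norm (h x) \<le> norm (indicator {0..2} x + (cmod (h x))\<^sup>2)"
      using supp by (intro AE_I2) (auto simp: indicator_def)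
  qed simp
  then have int: "integrable lborel (\<lambda>x. h x * e2pi (- (of_int m * x)))" for m
    by (rule Bochner_Integration.integrable_bound) (auto simp: norm_mult)
  define H where "H x = h x + h (x + 1)" for x
  have [measurable]: "H \<in> borel_measurable borel" unfolding H_def by measurable
  have "AE x in unit_interval. ennreal ((cmod (H x))\<^sup>2) =
      ennreal ((cmod (h x))\<^sup>2) + ennreal ((cmod (h (x + 1)))\<^sup>2)"
    by (rule AE_unit_interval[OF eventually_mono[OF disj]]) (auto simp: H_def)
  then have H: "(\<integral>\<^sup>+x. ennreal ((cmod (H x))\<^sup>2) \<partial>unit_interval) = (\<integral>\<^sup>+x. ennreal ((cmod (h x))\<^sup>2) \<partial>lborel)"
    by (subst nn_integral_periodise) (use supp in \<open>auto intro: nn_integral_cong_AE\<close>)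
  have H_L2: "H \<in> L2 unit_interval"
    using fin H by (subst L2_iff_nn_integral) (auto intro: measurable_unit_interval)
  have coeff: "(\<integral>x. h x * e2pi (- (of_int m * x)) \<partial>lborel) =
      L2_inner unit_interval H (\<lambda>x. e2pi (of_int m * x))" for m :: int
  proof -
    have "e2pi (- (of_int m * (x + 1))) = e2pi (- (of_int m * x))" for x
      using e2pi_add_of_int[of "- (of_int m * x)" "- m"] by (simp add: distrib_left)
    then show ?thesis
      unfolding L2_inner_def H_def cnj_e2pi
      by (subst integral_periodise[OF int]) (use supp in \<open>auto simp: distrib_right\<close>)
  qed
  have "((\<lambda>m::int. (cmod (L2_inner unit_interval H (\<lambda>x. e2pi (of_int m * x))))\<^sup>2)
    has_sum (L2_norm unit_interval H)\<^sup>2) UNIV"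
    by (rule parseval_unit_interval[OF _ H_L2]) simp
  then show ?thesis
    by (subst (asm) has_sum_iff_nn_integral_count_space)
      (simp_all add: coeff H flip: L2_nn_integral[OF H_L2])
qed

text \<open>
  Shifting \<open>h\<close> by \<open>a\<close> multiplies its Fourier coefficients by numbers of modulus one.
\<close>

lemma parseval_disjoint_translates:
  fixes h :: "real \<Rightarrow> complex"
  assumes h [measurable]: "h \<in> borel_measurable borel"
    and supp: "\<And>x. x \<notin> {a..<a+2} \<Longrightarrow> h x = 0"
    and disj: "AE x in lborel. h x = 0 \<or> h (x + 1) = 0"
    and fin: "(\<integral>\<^sup>+x. ennreal ((cmod (h x))\<^sup>2) \<partial>lborel) < \<infinity>"
  shows "(\<integral>\<^sup>+m. ennreal ((cmod (\<integral>x. h x * e2pi (- (of_int m * x)) \<partial>lborel))\<^sup>2) \<partial>count_space UNIV) =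
    (\<integral>\<^sup>+x. ennreal ((cmod (h x))\<^sup>2) \<partial>lborel)"
proof -
  have eq: "(\<integral>\<^sup>+x. ennreal ((cmod (h x))\<^sup>2) \<partial>lborel) = (\<integral>\<^sup>+x. ennreal ((cmod (h (a + x)))\<^sup>2) \<partial>lborel)"
    by (subst nn_integral_real_affine[where c = 1 and t = a]) simp_all
  have "(\<integral>x. h x * e2pi (- (of_int m * x)) \<partial>lborel) =
      e2pi (- (of_int m * a)) * (\<integral>x. h (a + x) * e2pi (- (of_int m * x)) \<partial>lborel)" for m :: int
    by (subst lborel_integral_real_affine[where c = 1 and t = a])
      (simp_all add: distrib_left e2pi_add[of "- _" "- _", simplified] mult.left_commute
        flip: integral_mult_right_zero)
  then have "cmod (\<integral>x. h x * e2pi (- (of_int m * x)) \<partial>lborel) =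
      cmod (\<integral>x. h (a + x) * e2pi (- (of_int m * x)) \<partial>lborel)" for m :: int
    by (simp add: norm_mult)
  moreover have "AE x in lborel. h (a + x) = 0 \<or> h (a + (x + 1)) = 0"
    using AE_borel_affine[of 1 "\<lambda>x. h x = 0 \<or> h (x + 1) = 0" a] disj by (simp add: add.assoc)
  ultimately show ?thesis
    using parseval_disjoint_translates_from_0[of "\<lambda>x. h (a + x)"] supp fin unfolding eq by simp
qed

section \<open>A Gabor system with a rectangular window\<close>

definition gabor_atom :: "real \<Rightarrow> (real \<Rightarrow> complex) \<Rightarrow> int \<times> int \<Rightarrow> real \<Rightarrow> complex" where
  "gabor_atom w u = (\<lambda>(k, l) t.
     of_real (\<bar>w\<bar> powr (1 / 2)) * e2pi (- (w * of_int l * t)) * u (t - of_int k))"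

text \<open>
  The interval is symmetric about \<open>0\<close>, so that a function concentrated near \<open>t = 0\<close> meets only the
  translate with \<open>k = 0\<close>, for negative as well as for positive \<open>w\<close>.
\<close>

definition window :: "real \<Rightarrow> complex" where
  "window = indicator {-1/2..<1/2}"

lemma measurable_window [measurable]: "window \<in> borel_measurable borel"
  unfolding window_def by measurable

lemma window_shift_sum: "(\<integral>\<^sup>+k. ennreal ((cmod (window (t - of_int k)))\<^sup>2) \<partial>count_space UNIV) = 1"
proof -
  have "t - of_int k \<in> {-1/2..<1/2} \<longleftrightarrow> \<lfloor>t + 1/2\<rfloor> = k" for k
    by (auto simp: floor_eq_iff)
  then have "ennreal ((cmod (window (t - of_int k)))\<^sup>2) = indicator {\<lfloor>t + 1/2\<rfloor>} k" for k
    by (auto simp: window_def indicator_def)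
  then show ?thesis by simp
qed

text \<open>
  For fixed \<open>k\<close> the substitution \<open>t = - s / w\<close> turns the modulations into exponentials of integer
  frequency and the support of the window into an interval of length \<open>\<bar>w\<bar> \<le> 1\<close>, whose integer
  translates do not overlap.  Parseval's identity then gives the energy of \<open>f\<close> under the translated
  window, and the translates of the window tile the line.
\<close>

lemma window_frame:
  fixes f :: "real \<Rightarrow> complex"
  assumes w: "w \<noteq> 0" "\<bar>w\<bar> \<le> 1" and [measurable]: "f \<in> borel_measurable borel"
    and fin: "(\<integral>\<^sup>+t. ennreal ((cmod (f t))\<^sup>2) \<partial>lborel) < \<infinity>"
  shows "(\<integral>\<^sup>+i. ennreal ((cmod (\<integral>t. f t * cnj (gabor_atom w window i t) \<partial>lborel))\<^sup>2) \<partial>count_space UNIV) =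
    (\<integral>\<^sup>+t. ennreal ((cmod (f t))\<^sup>2) \<partial>lborel)"
proof -
  have inner: "(\<integral>\<^sup>+l. ennreal ((cmod (\<integral>t. f t * cnj (gabor_atom w window (k, l) t) \<partial>lborel))\<^sup>2) \<partial>count_space UNIV) =
    (\<integral>\<^sup>+t. ennreal ((cmod (f t))\<^sup>2) * ennreal ((cmod (window (t - of_int k)))\<^sup>2) \<partial>lborel)" for k
  proof -
    define h where "h s = f (- (s / w)) * window (- (s / w) - of_int k)" for s
    have [measurable]: "h \<in> borel_measurable borel" unfolding h_def by measurable
    have norm_h: "(\<integral>\<^sup>+t. ennreal ((cmod (f t))\<^sup>2) * ennreal ((cmod (window (t - of_int k)))\<^sup>2) \<partial>lborel) =
        ennreal (1 / \<bar>w\<bar>) * (\<integral>\<^sup>+s. ennreal ((cmod (h s))\<^sup>2) \<partial>lborel)"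
      by (subst nn_integral_real_affine[where c = "- 1 / w" and t = 0])
        (use w in \<open>simp_all add: h_def norm_mult power_mult_distrib ennreal_mult' abs_divide\<close>)
    have h_fin: "(\<integral>\<^sup>+s. ennreal ((cmod (h s))\<^sup>2) \<partial>lborel) < \<infinity>"
    proof -
      have "ennreal (1 / \<bar>w\<bar>) * (\<integral>\<^sup>+s. ennreal ((cmod (h s))\<^sup>2) \<partial>lborel)
          \<le> (\<integral>\<^sup>+t. ennreal ((cmod (f t))\<^sup>2) \<partial>lborel)"
        unfolding norm_h[symmetric]
        by (rule nn_integral_mono) (auto simp: window_def indicator_def)
      then have "ennreal (1 / \<bar>w\<bar>) * (\<integral>\<^sup>+s. ennreal ((cmod (h s))\<^sup>2) \<partial>lborel) < top"
        using fin by (simp add: le_less_trans)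
      then show ?thesis using w by (auto simp: ennreal_mult_less_top)
    qed
    have supp: "\<bar>s + w * of_int k\<bar> \<le> 1/2" if "h s \<noteq> 0" for s
    proof -
      have "- (s / w) - of_int k \<in> {-1/2..<1/2}"
        using that by (auto simp: h_def window_def indicator_def split: if_splits)
      then have "\<bar>- (s / w) - of_int k\<bar> \<le> 1/2"
        unfolding abs_le_iff atLeastLessThan_iff by linarith
      then have "\<bar>w\<bar> * \<bar>- (s / w) - of_int k\<bar> \<le> 1 * (1/2)"
        using w by (intro mult_mono) auto
      moreover have "\<bar>w\<bar> * \<bar>- (s / w) - of_int k\<bar> = \<bar>s + w * of_int k\<bar>"
        using w by (simp add: abs_mult[symmetric] field_simps)
      ultimately show ?thesis by simp
    qed
    (* The interval is closed when \<bar>w\<bar> = 1; its two end points then differ by 1, which affects only s = a. *)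
    define a where "a = - (w * of_int k) - 1/2"
    have p1: "h s = 0" if "s \<notin> {a..<a + 2}" for s
      using supp[of s] that by (force simp: a_def abs_le_iff)
    have "AE s in lborel. s \<noteq> a" by (rule AE_lborel_singleton)
    then have p2: "AE s in lborel. h s = 0 \<or> h (s + 1) = 0"
    proof eventually_elim
      case (elim s)
      show ?case
      proof (rule ccontr)
        assume "\<not> (h s = 0 \<or> h (s + 1) = 0)"
        then have "\<bar>s + w * of_int k\<bar> \<le> 1/2" "\<bar>s + 1 + w * of_int k\<bar> \<le> 1/2"
          using supp by auto
        then show False using elim by (simp only: a_def abs_le_iff) linarith
      qed
    qed
    have "(\<integral>t. f t * cnj (gabor_atom w window (k, l) t) \<partial>lborel) =
        of_real (\<bar>w\<bar> powr (1/2) / \<bar>w\<bar>) * (\<integral>s. h s * e2pi (- (of_int l * s)) \<partial>lborel)" for l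
    proof -
      have ptw: "f (- (s / w)) * cnj (gabor_atom w window (k, l) (- (s / w))) =
          of_real (\<bar>w\<bar> powr (1/2)) * (h s * e2pi (- (of_int l * s)))" for s
        using w by (simp add: gabor_atom_def h_def cnj_e2pi window_def indicator_def)
      have "(\<integral>t. f t * cnj (gabor_atom w window (k, l) t) \<partial>lborel) =
        (1 / \<bar>w\<bar>) *\<^sub>R (\<integral>s. f (- (s / w)) * cnj (gabor_atom w window (k, l) (- (s / w))) \<partial>lborel)"
        by (subst lborel_integral_real_affine[where c = "- 1 / w" and t = 0]) (use w in simp_all)
      also have "\<dots> = of_real (\<bar>w\<bar> powr (1/2) / \<bar>w\<bar>) * (\<integral>s. h s * e2pi (- (of_int l * s)) \<partial>lborel)"
        unfolding ptw by (simp add: scaleR_conv_of_real)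
      finally show ?thesis .
    qed
    moreover have "(\<bar>w\<bar> powr (1/2) / \<bar>w\<bar>)\<^sup>2 = 1 / \<bar>w\<bar>"
    proof -
      have "(\<bar>w\<bar> powr (1/2) / \<bar>w\<bar>)\<^sup>2 = \<bar>w\<bar> / (\<bar>w\<bar> * \<bar>w\<bar>)"
        by (simp add: power_divide powr_half_sqrt) (simp add: power2_eq_square)
      also have "\<dots> = 1 / \<bar>w\<bar>" using w by (intro nonzero_divide_mult_cancel_left) auto
      finally show ?thesis .
    qed
    ultimately have "ennreal ((cmod (\<integral>t. f t * cnj (gabor_atom w window (k, l) t) \<partial>lborel))\<^sup>2) =
        ennreal (1 / \<bar>w\<bar>) * ennreal ((cmod (\<integral>s. h s * e2pi (- (of_int l * s)) \<partial>lborel))\<^sup>2)" for l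
      by (simp only: norm_mult norm_of_real power_mult_distrib power2_abs) (simp flip: ennreal_mult)
    then show ?thesis
      unfolding norm_h using parseval_disjoint_translates[OF _ p1 p2 h_fin]
      by (simp add: nn_integral_cmult)
  qed
  show ?thesis
    unfolding nn_integral_fst_count_space[symmetric] inner
    by (subst nn_integral_count_space_nn_integral[symmetric])
      (simp_all add: nn_integral_cmult window_shift_sum)
qed

section \<open>The measure on the frequency-time plane\<close>

lemma measurable_fst_borel [measurable]: "fst \<in> borel_measurable (borel :: (real \<times> real) measure)"
  and measurable_snd_borel [measurable]: "snd \<in> borel_measurable (borel :: (real \<times> real) measure)"
  by (intro borel_measurable_continuous_onI continuous_intros)+

abbreviation heis_dom :: "(real \<times> real) set" where
  "heis_dom \<equiv> Lam \<times> UNIV"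

lemma heis_dom_borel [measurable]: "heis_dom \<in> sets borel"
  unfolding Lam_def by (intro borel_open open_Times) auto

lemma heis_dom_lebesgue: "heis_dom \<inter> space lebesgue \<in> sets lebesgue"
  by simp

lemma measurable_heis_restrict:
  "f \<in> borel_measurable borel \<Longrightarrow> f \<in> borel_measurable (lebesgue_on heis_dom)"
  by (intro measurable_restrict_space1 measurable_completion) simp

lemma measurable_heis: "f \<in> borel_measurable borel \<Longrightarrow> f \<in> borel_measurable heis_measure"
  unfolding heis_measure_def using measurable_heis_restrict by simp

lemma measurable_abs_fst: "(\<lambda>(w, t). ennreal \<bar>w\<bar>) \<in> borel_measurable (lebesgue_on heis_dom)"
  unfolding case_prod_beta' by (rule measurable_heis_restrict) measurable

lemma AE_lborel_prodI:
  fixes P :: "real \<times> real \<Rightarrow> bool"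
  assumes "Measurable.pred borel P" "AE w in lborel. AE t in lborel. P (w, t)"
  shows "AE x in lborel. P x"
proof -
  have "{x \<in> space (lborel \<Otimes>\<^sub>M lborel). P x} \<in> sets (lborel \<Otimes>\<^sub>M (lborel :: real measure))"
    using assms(1) unfolding lborel_prod by simp
  then show ?thesis
    using lborel_pair.AE_pair_measure[of P, OF _ assms(2)] unfolding lborel_prod by blast
qed

lemma AE_lborel_prodD:
  fixes P :: "real \<times> real \<Rightarrow> bool"
  assumes "AE x in lborel. P x"
  shows "AE w in lborel. AE t in lborel. P (w, t)"
  using lborel_pair.AE_pair[of P] assms unfolding lborel_prod .

lemma AE_fst_nonzero: "AE x in (lborel :: (real \<times> real) measure). fst x \<noteq> 0"
proof (rule AE_lborel_prodI)
  show "AE w in (lborel :: real measure). AE t in (lborel :: real measure). fst (w, t) \<noteq> 0"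
    using AE_lborel_singleton[of "0::real"] by eventually_elim auto
qed measurable

text \<open>
  The density \<open>\<bar>w\<bar>\<close> vanishes only on the null set \<open>w = 0\<close>, the set removed in \<^const>\<open>Lam\<close>.
\<close>

lemma AE_heis_iff: "(AE x in heis_measure. P x) \<longleftrightarrow> (AE x in lborel. P x)"
proof -
  have "(AE x in heis_measure. P x) \<longleftrightarrow>
      (AE x in lborel. x \<in> heis_dom \<longrightarrow> 0 < ennreal \<bar>fst x\<bar> \<longrightarrow> P x)"
    unfolding heis_measure_def AE_density[OF measurable_abs_fst]
      AE_restrict_space_iff[OF heis_dom_lebesgue] AE_completion_iff by (simp add: case_prod_beta)
  also have "\<dots> \<longleftrightarrow> (AE x in lborel. P x)"
  proof
    assume "AE x in lborel. x \<in> heis_dom \<longrightarrow> 0 < ennreal \<bar>fst x\<bar> \<longrightarrow> P x"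
    with AE_fst_nonzero show "AE x in lborel. P x"
      by eventually_elim (auto simp: Lam_def mem_Times_iff)
  next
    assume "AE x in lborel. P x"
    then show "AE x in lborel. x \<in> heis_dom \<longrightarrow> 0 < ennreal \<bar>fst x\<bar> \<longrightarrow> P x"
      by eventually_elim simp
  qed
  finally show ?thesis .
qed

lemma nn_integral_heis:
  assumes [measurable]: "u \<in> borel_measurable borel"
  shows "(\<integral>\<^sup>+x. u x \<partial>heis_measure) = (\<integral>\<^sup>+w. \<integral>\<^sup>+t. ennreal \<bar>w\<bar> * u (w, t) \<partial>lborel \<partial>lborel)"
proof -
  have "(\<integral>\<^sup>+x. u x \<partial>heis_measure) = (\<integral>\<^sup>+x. ennreal \<bar>fst x\<bar> * u x * indicator heis_dom x \<partial>lborel)"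
    unfolding heis_measure_def
    by (subst nn_integral_density[OF measurable_abs_fst measurable_heis_restrict])
      (simp_all add: nn_integral_restrict_space nn_integral_completion case_prod_beta)
  also have "\<dots> = (\<integral>\<^sup>+x. ennreal \<bar>fst x\<bar> * u x \<partial>lborel)"
    by (rule nn_integral_cong) (auto simp: Lam_def indicator_def mem_Times_iff)
  also have "\<dots> = (\<integral>\<^sup>+w. \<integral>\<^sup>+t. ennreal \<bar>w\<bar> * u (w, t) \<partial>lborel \<partial>lborel)"
    using lborel.nn_integral_fst[of "\<lambda>x. ennreal \<bar>fst x\<bar> * u x" lborel] by (simp add: lborel_prod)
  finally show ?thesis .
qed

lemma heis_density_lborel:
  fixes f :: "real \<times> real \<Rightarrow> complex"
  assumes [measurable]: "f \<in> borel_measurable borel"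
  shows integrable_heis: "integrable heis_measure f \<longleftrightarrow> integrable lborel (\<lambda>x. \<bar>fst x\<bar> *\<^sub>R f x)"
    and integral_heis: "(\<integral>x. f x \<partial>heis_measure) = (\<integral>x. \<bar>fst x\<bar> *\<^sub>R f x \<partial>lborel)"
proof -
  have h: "heis_measure = density (lebesgue_on heis_dom) (\<lambda>x. ennreal \<bar>fst x\<bar>)"
    by (simp add: heis_measure_def case_prod_beta')
  have m: "f \<in> borel_measurable (lebesgue_on heis_dom)"
    "(\<lambda>x. \<bar>fst x\<bar>) \<in> borel_measurable (lebesgue_on heis_dom)"
    by (rule measurable_heis_restrict, measurable)+
  have e: "indicator heis_dom x * \<bar>fst x\<bar> = \<bar>fst x\<bar>" for x
    by (auto simp: Lam_def indicator_def mem_Times_iff)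
  have b: "(\<lambda>x. \<bar>fst x\<bar> *\<^sub>R f x) \<in> borel_measurable lborel" by measurable
  show "integrable heis_measure f \<longleftrightarrow> integrable lborel (\<lambda>x. \<bar>fst x\<bar> *\<^sub>R f x)"
    unfolding h using b
    by (simp add: integrable_density[OF m] integrable_restrict_space e integrable_completion)
  show "(\<integral>x. f x \<partial>heis_measure) = (\<integral>x. \<bar>fst x\<bar> *\<^sub>R f x \<partial>lborel)"
    unfolding h using b
    by (simp add: integral_density[OF m] integral_restrict_space e integral_completion)
qed

lemma L2_inner_heis_Fubini:
  assumes [measurable]: "f \<in> borel_measurable borel" "g \<in> borel_measurable borel"
    and L2: "f \<in> L2 heis_measure" "g \<in> L2 heis_measure"
  shows L2_inner_heis: "L2_inner heis_measure f g =
      (\<integral>w. \<bar>w\<bar> *\<^sub>R (\<integral>t. f (w, t) * cnj (g (w, t)) \<partial>lborel) \<partial>lborel)" (is ?eq)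
    and integrable_heis_slice:
      "integrable lborel (\<lambda>w. \<bar>w\<bar> *\<^sub>R (\<integral>t. f (w, t) * cnj (g (w, t)) \<partial>lborel))" (is ?int)
proof -
  let ?k = "\<lambda>x. \<bar>fst x\<bar> *\<^sub>R (f x * cnj (g x))"
  have "integrable heis_measure (\<lambda>x. f x * cnj (g x))"
    by (rule integrable_L2_mult) fact+
  then have i: "integrable (lborel \<Otimes>\<^sub>M lborel) ?k"
    unfolding lborel_prod by (subst (asm) integrable_heis) measurable
  have "L2_inner heis_measure f g = (\<integral>x. ?k x \<partial>lborel)"
    unfolding L2_inner_def by (rule integral_heis) measurable
  also have "\<dots> = (\<integral>w. \<integral>t. ?k (w, t) \<partial>lborel \<partial>lborel)"
    using lborel_pair.integral_fst'[OF i] by (simp add: lborel_prod)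
  finally show ?eq by simp
  show ?int using lborel_pair.integrable_fst'[OF i] by simp
qed

lemma measurable_heis_AE:
  fixes f :: "real \<times> real \<Rightarrow> complex"
  assumes [measurable]: "f' \<in> borel_measurable borel" and ae: "AE x in lborel. f x = f' x"
  shows "f \<in> borel_measurable heis_measure"
proof -
  have "f \<in> borel_measurable lebesgue"
    by (rule borel_measurable_AE[of f'])
      (use ae in \<open>auto intro: measurable_completion simp: AE_completion_iff elim: eventually_mono\<close>)
  then have "f \<in> borel_measurable (lebesgue_on heis_dom)" by (rule measurable_restrict_space1)
  then show ?thesis by (simp add: heis_measure_def)
qed

lemma borel_representative_lebesgue:
  fixes f :: "'a::euclidean_space \<Rightarrow> complex"
  assumes "f \<in> borel_measurable lebesgue"
  obtains f' where "f' \<in> borel_measurable borel" "AE x in lborel. f x = f' x"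
proof -
  have "(\<lambda>x. Re (f x)) \<in> borel_measurable lebesgue" "(\<lambda>x. Im (f x)) \<in> borel_measurable lebesgue"
    using assms by measurable
  then obtain a b where ab [measurable]: "a \<in> borel_measurable borel" "b \<in> borel_measurable borel"
      and ae: "AE x in lborel. Re (f x) = a x" "AE x in lborel. Im (f x) = b x"
    by (metis completion_ex_borel_measurable_real measurable_lborel2)
  have "(\<lambda>x. Complex (a x) (b x)) \<in> borel_measurable borel"
    unfolding Complex_eq by measurable
  moreover have "AE x in lborel. f x = Complex (a x) (b x)"
    using ae by eventually_elim (simp add: complex_eq_iff)
  ultimately show ?thesis using that by blast
qed

lemma borel_representative_heis:
  fixes f :: "real \<times> real \<Rightarrow> complex"
  assumes "f \<in> borel_measurable heis_measure"
  obtains f' where "f' \<in> borel_measurable borel" "AE x in lborel. f x = f' x"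
proof -
  have "(\<lambda>x. indicator heis_dom x *\<^sub>R f x) \<in> borel_measurable lebesgue"
    using assms borel_measurable_restrict_space_iff[OF heis_dom_lebesgue, of f]
    by (simp add: heis_measure_def)
  then obtain f' where f': "f' \<in> borel_measurable borel"
      and ae: "AE x in lborel. indicator heis_dom x *\<^sub>R f x = f' x"
    by (rule borel_representative_lebesgue)
  have "AE x in lborel. f x = f' x"
    using ae AE_fst_nonzero by eventually_elim (auto simp: Lam_def indicator_def mem_Times_iff)
  with f' show ?thesis by (rule that)
qed

lemma L2_AE_cong:
  assumes "f \<in> L2 M" "g \<in> borel_measurable M" "AE x in M. f x = g x"
  shows "g \<in> L2 M"
proof -
  have "(\<integral>\<^sup>+x. ennreal ((cmod (g x))\<^sup>2) \<partial>M) = (\<integral>\<^sup>+x. ennreal ((cmod (f x))\<^sup>2) \<partial>M)"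
    by (rule nn_integral_cong_AE) (use assms(3) in \<open>auto elim: eventually_mono\<close>)
  then show ?thesis
    using assms L2_iff_nn_integral[of f M] L2_iff_nn_integral[of g M] L2_measurable[OF assms(1)] by simp
qed

lemma L2_inner_AE_cong:
  assumes [measurable]: "f \<in> borel_measurable M" "f' \<in> borel_measurable M"
    "g \<in> borel_measurable M" "g' \<in> borel_measurable M"
    and "AE x in M. f x = f' x" "AE x in M. g x = g' x"
  shows "L2_inner M f g = L2_inner M f' g'"
  unfolding L2_inner_def
proof (rule integral_cong_AE)
  show "AE x in M. f x * cnj (g x) = f' x * cnj (g' x)"
    using assms(5,6) by eventually_elim simp
qed measurable

text \<open>
  The predicate need not be measurable, hence the detour through a Borel null set that covers the
  exceptional points.
\<close>

lemma AE_lborel_affine2: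
  fixes P :: "real \<times> real \<Rightarrow> bool"
  assumes P: "AE x in lborel. P x" and ab: "a \<noteq> 0" "b \<noteq> 0"
  shows "AE x in lborel. P (a * fst x, b * snd x + c)"
proof -
  obtain N where N: "{x. \<not> P x} \<subseteq> N" "N \<in> sets borel" "emeasure lborel N = 0"
    using AE_E[OF P] by auto
  note [measurable] = N(2)
  define G where "G w = (\<integral>\<^sup>+t. indicator N (w, t) \<partial>lborel)" for w
  have [measurable]: "G \<in> borel_measurable borel" unfolding G_def by measurable
  have "(\<integral>\<^sup>+w. G w \<partial>lborel) = emeasure lborel N"
    unfolding G_def
    using lborel.nn_integral_fst[of "indicator N :: real \<times> real \<Rightarrow> ennreal" lborel]
    by (simp add: lborel_prod)
  then have "(\<integral>\<^sup>+w. G w \<partial>lborel) = 0" using N(3) by simp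
  then have "(\<integral>\<^sup>+w. G (a * w) \<partial>lborel) = 0"
    using ab by (subst (asm) nn_integral_real_affine[where c = a and t = 0]) auto
  moreover have "G w = \<bar>b\<bar> * (\<integral>\<^sup>+t. indicator N (w, b * t + c) \<partial>lborel)" for w
    unfolding G_def using ab
    by (subst nn_integral_real_affine[where c = b and t = c]) (auto simp: add.commute)
  ultimately have "(\<integral>\<^sup>+w. \<integral>\<^sup>+t. indicator N (a * w, b * t + c) \<partial>lborel \<partial>lborel) = 0"
    using ab by (simp add: nn_integral_cmult)
  then have "(\<integral>\<^sup>+x. indicator N (a * fst x, b * snd x + c) \<partial>(lborel \<Otimes>\<^sub>M lborel)) = 0"
    by (subst lborel.nn_integral_fst[symmetric]) (simp_all add: lborel_prod)
  then have "AE x in lborel. indicator N (a * fst x, b * snd x + c) = (0::ennreal)"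
    unfolding lborel_prod by (subst (asm) nn_integral_0_iff_AE) auto
  then show ?thesis
    by eventually_elim (use N(1) in \<open>auto simp: indicator_def split: if_splits\<close>)
qed

section \<open>Sums over translations and modulations\<close>

text \<open>
  The Parseval property of a Gabor system at one frequency, tested on Borel functions only and stated
  as an identity between extended nonnegative numbers, so that it can be integrated over \<open>w\<close>.
\<close>

definition parseval_gabor :: "real \<Rightarrow> (real \<Rightarrow> complex) \<Rightarrow> bool" where
  "parseval_gabor w u \<longleftrightarrow> (\<forall>f \<in> borel_measurable borel.
     (\<integral>\<^sup>+t. ennreal ((cmod (f t))\<^sup>2) \<partial>lborel) < \<infinity> \<longrightarrow>
     (\<integral>\<^sup>+i. ennreal ((cmod (\<integral>t. f t * cnj (gabor_atom w u i t) \<partial>lborel))\<^sup>2) \<partial>count_space UNIV) =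
     (\<integral>\<^sup>+t. ennreal ((cmod (f t))\<^sup>2) \<partial>lborel))"

lemma hatT_apply:
  "hatT k l m g x = e2pi (fst x * of_int m) * e2pi (- (fst x * of_int l * snd x)) * g (fst x, snd x - of_int k)"
  by (simp add: hatT_def e2pi_def cis_conv_exp case_prod_beta mult_ac)

lemma hatD_apply:
  "hatD j g x = of_real (2 powr (3 * of_int j / 4)) *
     g (2 powr of_int j * fst x, 2 powr (- of_int j / 2) * snd x)"
  by (simp add: hatD_def case_prod_beta)

lemma measurable_hatT [measurable]:
  assumes [measurable]: "g \<in> borel_measurable borel"
  shows "hatT k l m g \<in> borel_measurable borel"
  unfolding hatT_apply[abs_def] by measurable

lemma measurable_hatD [measurable]:
  assumes [measurable]: "g \<in> borel_measurable borel"
  shows "hatD j g \<in> borel_measurable borel"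
  unfolding hatD_apply[abs_def] by measurable

lemma nn_integral_hatT:
  assumes [measurable]: "g \<in> borel_measurable borel"
  shows "(\<integral>\<^sup>+x. ennreal ((cmod (hatT k l m g x))\<^sup>2) \<partial>heis_measure) =
    (\<integral>\<^sup>+x. ennreal ((cmod (g x))\<^sup>2) \<partial>heis_measure)"
proof -
  have "(\<integral>\<^sup>+t. ennreal \<bar>w\<bar> * ennreal ((cmod (hatT k l m g (w, t)))\<^sup>2) \<partial>lborel) =
      (\<integral>\<^sup>+t. ennreal \<bar>w\<bar> * ennreal ((cmod (g (w, t)))\<^sup>2) \<partial>lborel)" for w
    by (subst nn_integral_real_affine[where c = 1 and t = "of_int k"])
      (simp_all add: hatT_apply norm_mult)
  then show ?thesis by (simp add: nn_integral_heis)
qed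

lemma hatT_L2: "g \<in> borel_measurable borel \<Longrightarrow> g \<in> L2 heis_measure \<Longrightarrow> hatT k l m g \<in> L2 heis_measure"
  by (simp add: L2_iff_nn_integral measurable_heis nn_integral_hatT)

lemma nn_integral_heis_slice:
  fixes f :: "real \<times> real \<Rightarrow> complex"
  assumes [measurable]: "f \<in> borel_measurable borel" and f: "f \<in> L2 heis_measure"
  shows "AE w in lborel. (\<integral>\<^sup>+t. ennreal ((cmod (f (w, t)))\<^sup>2) \<partial>lborel) < \<infinity>"
proof -
  have "(\<integral>\<^sup>+w. ennreal \<bar>w\<bar> * (\<integral>\<^sup>+t. ennreal ((cmod (f (w, t)))\<^sup>2) \<partial>lborel) \<partial>lborel) =
      (\<integral>\<^sup>+x. ennreal ((cmod (f x))\<^sup>2) \<partial>heis_measure)"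
    by (simp add: nn_integral_heis nn_integral_cmult)
  also have "\<dots> < \<infinity>" using f L2_iff_nn_integral[OF measurable_heis[OF assms(1)]] by simp
  finally have "AE w in lborel. ennreal \<bar>w\<bar> * (\<integral>\<^sup>+t. ennreal ((cmod (f (w, t)))\<^sup>2) \<partial>lborel) \<noteq> \<infinity>"
    by (intro nn_integral_noteq_infinite) auto
  then show ?thesis
    using AE_lborel_singleton[of 0]
    by eventually_elim (auto simp: ennreal_mult_eq_top_iff less_top)
qed

lemma nn_integral_count_space_triple:
  "(\<integral>\<^sup>+x. f x \<partial>count_space UNIV) =
    (\<integral>\<^sup>+kl. (\<integral>\<^sup>+m. f (fst kl, snd kl, m) \<partial>count_space UNIV) \<partial>count_space UNIV)"
proof -
  have "(\<integral>\<^sup>+x. f x \<partial>count_space UNIV) =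
      (\<integral>\<^sup>+k. (\<integral>\<^sup>+l. (\<integral>\<^sup>+m. f (k, l, m) \<partial>count_space UNIV) \<partial>count_space UNIV) \<partial>count_space UNIV)"
    by (subst nn_integral_fst_count_space[symmetric]) (subst nn_integral_fst_count_space[symmetric], rule refl)
  also have "\<dots> = (\<integral>\<^sup>+kl. (\<integral>\<^sup>+m. f (fst kl, snd kl, m) \<partial>count_space UNIV) \<partial>count_space UNIV)"
    by (subst nn_integral_fst_count_space[symmetric]) simp
  finally show ?thesis .
qed

text \<open>
  For fixed \<open>k\<close> and \<open>l\<close> the inner products with \<open>hatT k l m g\<close> are the Fourier coefficients in \<open>w\<close> of
  the function \<open>c k l\<close> below, which vanishes outside \<open>E\<close>.  The sum over \<open>m\<close> is therefore the squared norm of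
  \<open>c k l\<close>, and the sum over \<open>k\<close> and \<open>l\<close> is evaluated for each \<open>w\<close> by the frame property.
\<close>

lemma parseval_time_frequency:
  fixes F g :: "real \<times> real \<Rightarrow> complex"
  assumes F [measurable]: "F \<in> borel_measurable borel" and F_L2: "F \<in> L2 heis_measure"
    and g [measurable]: "g \<in> borel_measurable borel" and g_L2: "g \<in> L2 heis_measure"
    and E [measurable]: "E \<in> sets borel" and E_sub: "E \<subseteq> {-1..<1}"
    and E_disj: "AE w in lborel. \<not> (w \<in> E \<and> w + 1 \<in> E)"
    and supp: "\<And>w t. w \<notin> E \<Longrightarrow> g (w, t) = 0"
    and frame: "AE w in lborel. w \<in> E \<longrightarrow> parseval_gabor w (\<lambda>t. g (w, t))"
  shows "(\<integral>\<^sup>+(k, l, m). ennreal ((cmod (L2_inner heis_measure F (hatT k l m g)))\<^sup>2) \<partial>count_space UNIV) =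
    (\<integral>\<^sup>+w. indicator E w * (ennreal \<bar>w\<bar> * (\<integral>\<^sup>+t. ennreal ((cmod (F (w, t)))\<^sup>2) \<partial>lborel)) \<partial>lborel)"
proof -
  define c where "c k l w = \<bar>w\<bar> *\<^sub>R
    (\<integral>t. F (w, t) * cnj (e2pi (- (w * of_int l * t)) * g (w, t - of_int k)) \<partial>lborel)" for k l :: int and w
  define G where "G w = (\<integral>\<^sup>+t. ennreal ((cmod (F (w, t)))\<^sup>2) \<partial>lborel)" for w
  have [measurable]: "G \<in> borel_measurable borel" unfolding G_def by measurable
  have [measurable]: "c k l \<in> borel_measurable borel" for k l unfolding c_def by measurable
  have inner: "L2_inner heis_measure F (hatT k l m g) = (\<integral>w. c k l w * e2pi (- (of_int m * w)) \<partial>lborel)" for k l m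
  proof -
    have "\<bar>w\<bar> *\<^sub>R (\<integral>t. F (w, t) * cnj (hatT k l m g (w, t)) \<partial>lborel) = c k l w * e2pi (- (of_int m * w))" for w
    proof -
      have "F (w, t) * cnj (hatT k l m g (w, t)) =
        (F (w, t) * cnj (e2pi (- (w * of_int l * t)) * g (w, t - of_int k))) * e2pi (- (of_int m * w))" for t
        by (simp add: hatT_apply cnj_e2pi mult_ac)
      then show ?thesis by (simp only: c_def integral_mult_left_zero mult_scaleR_left)
    qed
    then show ?thesis
      by (subst L2_inner_heis[OF F _ F_L2 hatT_L2[OF g g_L2]]) simp_all
  qed
  have c_atom: "ennreal ((cmod (c k l w))\<^sup>2) = ennreal \<bar>w\<bar> *
      ennreal ((cmod (\<integral>t. F (w, t) * cnj (gabor_atom w (\<lambda>t. g (w, t)) (k, l) t) \<partial>lborel))\<^sup>2)" for k l w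
  proof -
    define J where "J = (\<integral>t. F (w, t) * cnj (e2pi (- (w * of_int l * t)) * g (w, t - of_int k)) \<partial>lborel)"
    have ptw: "F (w, t) * cnj (gabor_atom w (\<lambda>t. g (w, t)) (k, l) t) = of_real (\<bar>w\<bar> powr (1/2)) *
        (F (w, t) * cnj (e2pi (- (w * of_int l * t)) * g (w, t - of_int k)))" for t
      by (simp add: gabor_atom_def mult_ac)
    have "(cmod (\<integral>t. F (w, t) * cnj (gabor_atom w (\<lambda>t. g (w, t)) (k, l) t) \<partial>lborel))\<^sup>2 = \<bar>w\<bar> * (cmod J)\<^sup>2"
      unfolding ptw integral_mult_right_zero J_def[symmetric]
      by (simp add: norm_mult power_mult_distrib powr_half_sqrt)
    moreover have "(cmod (c k l w))\<^sup>2 = \<bar>w\<bar> * (\<bar>w\<bar> * (cmod J)\<^sup>2)"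
      by (simp add: c_def J_def power_mult_distrib power2_eq_square)
    ultimately show ?thesis by (simp flip: ennreal_mult)
  qed
  (* Almost every slice of F is square-integrable, so the frame property applies to it. *)
  have c_sum: "AE w in lborel. (\<integral>\<^sup>+kl. ennreal ((cmod (c (fst kl) (snd kl) w))\<^sup>2) \<partial>count_space UNIV) =
      indicator E w * (ennreal \<bar>w\<bar> * G w)"
    using frame nn_integral_heis_slice[OF F F_L2]
  proof eventually_elim
    case (elim w)
    show ?case
    proof (cases "w \<in> E")
      case False
      then have "c k l w = 0" for k l by (simp add: c_def supp)
      with False show ?thesis by simp
    next
      case True
      then have "(\<integral>\<^sup>+i. ennreal ((cmod (\<integral>t. F (w, t) * cnj (gabor_atom w (\<lambda>t. g (w, t)) i t) \<partial>lborel))\<^sup>2) \<partial>count_space UNIV) = G w"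
        using elim by (simp add: parseval_gabor_def G_def)
      then show ?thesis
        using True by (simp add: c_atom nn_integral_cmult)
    qed
  qed
  have fin: "(\<integral>\<^sup>+w. indicator E w * (ennreal \<bar>w\<bar> * G w) \<partial>lborel) < \<infinity>"
  proof -
    have "(\<integral>\<^sup>+w. indicator E w * (ennreal \<bar>w\<bar> * G w) \<partial>lborel) \<le> (\<integral>\<^sup>+w. ennreal \<bar>w\<bar> * G w \<partial>lborel)"
      by (rule nn_integral_mono) (auto simp: indicator_def)
    also have "\<dots> = (\<integral>\<^sup>+x. ennreal ((cmod (F x))\<^sup>2) \<partial>heis_measure)"
      by (simp add: nn_integral_heis nn_integral_cmult G_def)
    also have "\<dots> < \<infinity>" using F_L2 L2_iff_nn_integral[OF measurable_heis[OF F]] by simp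
    finally show ?thesis .
  qed
  have parseval: "(\<integral>\<^sup>+m. ennreal ((cmod (\<integral>w. c k l w * e2pi (- (of_int m * w)) \<partial>lborel))\<^sup>2) \<partial>count_space UNIV) =
      (\<integral>\<^sup>+w. ennreal ((cmod (c k l w))\<^sup>2) \<partial>lborel)" for k l
  proof (rule parseval_disjoint_translates[where a = "-1"])
    show "c k l w = 0" if "w \<notin> {-1..<-1 + 2}" for w
    proof -
      have "w \<notin> E" using that E_sub by auto
      then show ?thesis by (simp add: c_def supp)
    qed
    show "AE w in lborel. c k l w = 0 \<or> c k l (w + 1) = 0"
      using E_disj by eventually_elim (auto simp: c_def supp)
    have "(\<integral>\<^sup>+w. ennreal ((cmod (c k l w))\<^sup>2) \<partial>lborel) \<le> (\<integral>\<^sup>+w. indicator E w * (ennreal \<bar>w\<bar> * G w) \<partial>lborel)"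
    proof (rule nn_integral_mono_AE)
      show "AE w in lborel. ennreal ((cmod (c k l w))\<^sup>2) \<le> indicator E w * (ennreal \<bar>w\<bar> * G w)"
        using c_sum
      proof eventually_elim
        case (elim w)
        show ?case unfolding elim[symmetric]
          using nn_integral_ge_point[of "(k, l)" UNIV "\<lambda>kl. ennreal ((cmod (c (fst kl) (snd kl) w))\<^sup>2)"] by simp
      qed
    qed
    then show "(\<integral>\<^sup>+w. ennreal ((cmod (c k l w))\<^sup>2) \<partial>lborel) < \<infinity>" using fin by (rule le_less_trans)
  qed measurable
  have "(\<integral>\<^sup>+(k, l, m). ennreal ((cmod (L2_inner heis_measure F (hatT k l m g)))\<^sup>2) \<partial>count_space UNIV) =
      (\<integral>\<^sup>+kl. (\<integral>\<^sup>+w. ennreal ((cmod (c (fst kl) (snd kl) w))\<^sup>2) \<partial>lborel) \<partial>count_space UNIV)"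
    unfolding nn_integral_count_space_triple inner prod.case parseval ..
  also have "\<dots> = (\<integral>\<^sup>+w. (\<integral>\<^sup>+kl. ennreal ((cmod (c (fst kl) (snd kl) w))\<^sup>2) \<partial>count_space UNIV) \<partial>lborel)"
    by (rule nn_integral_count_space_nn_integral[symmetric]) auto
  also have "\<dots> = (\<integral>\<^sup>+w. indicator E w * (ennreal \<bar>w\<bar> * G w) \<partial>lborel)"
    by (rule nn_integral_cong_AE) (rule c_sum)
  finally show ?thesis by (simp add: G_def)
qed

section \<open>Sums over dilations\<close>

text \<open>
  The constant \<open>2 powr (3 * j / 4)\<close> is the one that makes \<open>hatD j\<close> preserve the norm: its square is
  \<open>a * (a * b)\<close>, where \<open>b\<close> is the Jacobian in \<open>t\<close> and one factor \<open>a\<close> each comes from the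
  Jacobian in \<open>w\<close> and from the density \<open>\<bar>w\<bar>\<close>.
\<close>

lemma nn_integral_hatD:
  fixes f :: "real \<times> real \<Rightarrow> complex"
  assumes [measurable]: "f \<in> borel_measurable borel" "E \<in> sets borel"
  shows "(\<integral>\<^sup>+w. indicator E w * (ennreal \<bar>w\<bar> * (\<integral>\<^sup>+t. ennreal ((cmod (hatD j f (w, t)))\<^sup>2) \<partial>lborel)) \<partial>lborel) =
    (\<integral>\<^sup>+w. indicator E (2 powr (- of_int j) * w) *
      (ennreal \<bar>w\<bar> * (\<integral>\<^sup>+t. ennreal ((cmod (f (w, t)))\<^sup>2) \<partial>lborel)) \<partial>lborel)"
proof -
  define a b c where "a = 2 powr real_of_int j" and "b = 2 powr (- real_of_int j / 2)"
    and "c = 2 powr (3 * real_of_int j / 4)"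
  have pos: "0 < a" "0 < b" "0 < c" by (simp_all add: a_def b_def c_def)
  (* In exponents: 2 * (3 j / 4) = j + j - j / 2. *)
  have abc: "c\<^sup>2 = a * (a * b)"
    by (simp add: a_def b_def c_def power2_eq_square flip: powr_add)
  have inv: "2 powr (- real_of_int j) * (a * w) = w" for w
    by (simp add: a_def powr_minus)
  define G where "G w = (\<integral>\<^sup>+t. ennreal ((cmod (f (w, t)))\<^sup>2) \<partial>lborel)" for w
  have [measurable]: "G \<in> borel_measurable borel" unfolding G_def by measurable
  have inner: "(\<integral>\<^sup>+t. ennreal ((cmod (hatD j f (w, t)))\<^sup>2) \<partial>lborel) = ennreal a * (ennreal a * G (a * w))" for w
  proof -
    have "(\<integral>\<^sup>+t. ennreal ((cmod (hatD j f (w, t)))\<^sup>2) \<partial>lborel) =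
        ennreal (c\<^sup>2) * (\<integral>\<^sup>+t. ennreal ((cmod (f (a * w, b * t)))\<^sup>2) \<partial>lborel)"
      by (simp add: hatD_apply a_def b_def c_def norm_mult power_mult_distrib ennreal_mult nn_integral_cmult)
    also have "\<dots> = ennreal a * (ennreal a * (ennreal b * (\<integral>\<^sup>+t. ennreal ((cmod (f (a * w, b * t)))\<^sup>2) \<partial>lborel)))"
      using pos by (simp add: abc ennreal_mult mult.assoc)
    also have "ennreal b * (\<integral>\<^sup>+t. ennreal ((cmod (f (a * w, b * t)))\<^sup>2) \<partial>lborel) = G (a * w)"
      unfolding G_def using pos by (subst nn_integral_real_affine[where c = b and t = 0]) auto
    finally show ?thesis .
  qed
  have "(\<integral>\<^sup>+w. indicator E (2 powr (- of_int j) * w) * (ennreal \<bar>w\<bar> * G w) \<partial>lborel) =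
      ennreal a * (\<integral>\<^sup>+w. indicator E w * (ennreal \<bar>a * w\<bar> * G (a * w)) \<partial>lborel)"
    using pos by (subst nn_integral_real_affine[where c = a and t = 0]) (auto simp: inv)
  also have "\<dots> = (\<integral>\<^sup>+w. ennreal a * (indicator E w * (ennreal \<bar>a * w\<bar> * G (a * w))) \<partial>lborel)"
    by (rule nn_integral_cmult[symmetric]) measurable
  also have "\<dots> = (\<integral>\<^sup>+w. indicator E w * (ennreal \<bar>w\<bar> * (ennreal a * (ennreal a * G (a * w)))) \<partial>lborel)"
    using pos by (intro nn_integral_cong) (simp add: abs_mult ennreal_mult mult_ac)
  finally show ?thesis unfolding inner G_def by simp
qed

lemma nn_integral_heis_cmod:
  fixes f :: "real \<times> real \<Rightarrow> complex"
  assumes [measurable]: "f \<in> borel_measurable borel"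
  shows "(\<integral>\<^sup>+x. ennreal ((cmod (f x))\<^sup>2) \<partial>heis_measure) =
    (\<integral>\<^sup>+w. ennreal \<bar>w\<bar> * (\<integral>\<^sup>+t. ennreal ((cmod (f (w, t)))\<^sup>2) \<partial>lborel) \<partial>lborel)"
  by (simp add: nn_integral_heis nn_integral_cmult)

lemma hatD_L2:
  assumes [measurable]: "f \<in> borel_measurable borel" and "f \<in> L2 heis_measure"
  shows "hatD j f \<in> L2 heis_measure"
  using assms nn_integral_hatD[of f UNIV j]
  by (simp add: L2_iff_nn_integral measurable_heis nn_integral_heis_cmod)

lemma L2_inner_hatD:
  assumes [measurable]: "f \<in> borel_measurable borel" "h \<in> borel_measurable borel"
    and L2: "f \<in> L2 heis_measure" "h \<in> L2 heis_measure"
  shows "L2_inner heis_measure f (hatD j h) = L2_inner heis_measure (hatD (- j) f) h"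
proof -
  define a b c where "a = 2 powr real_of_int j" and "b = 2 powr (- real_of_int j / 2)"
    and "c = 2 powr (3 * real_of_int j / 4)"
  have pos: "0 < a" "0 < b" "0 < c" by (simp_all add: a_def b_def c_def)
  have abc: "a * (a * b) = c * c"
    by (simp add: a_def b_def c_def flip: powr_add)
  have hD: "hatD j h (w, t) = of_real c * h (a * w, b * t)" for w t
    by (simp add: hatD_apply a_def b_def c_def)
  have fD: "hatD (- j) f (a * w, b * t) = of_real (1 / c) * f (w, t)" for w t
    by (simp add: hatD_apply a_def b_def c_def powr_minus field_simps)
  have "L2_inner heis_measure (hatD (- j) f) h =
      (\<integral>w. \<bar>w\<bar> *\<^sub>R (\<integral>t. hatD (- j) f (w, t) * cnj (h (w, t)) \<partial>lborel) \<partial>lborel)"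
    by (rule L2_inner_heis) (use L2 in \<open>auto intro: hatD_L2\<close>)
  also have "\<dots> = a *\<^sub>R (\<integral>w. \<bar>a * w\<bar> *\<^sub>R (b *\<^sub>R
      (\<integral>t. hatD (- j) f (a * w, b * t) * cnj (h (a * w, b * t)) \<partial>lborel)) \<partial>lborel)"
    using pos
    by (subst lborel_integral_real_affine[where c = a and t = 0], simp,
        subst lborel_integral_real_affine[where c = b and t = 0]) simp_all
  also have "\<dots> = (\<integral>w. \<bar>w\<bar> *\<^sub>R (\<integral>t. f (w, t) * cnj (hatD j h (w, t)) \<partial>lborel) \<partial>lborel)"
  proof -
    have "a *\<^sub>R (\<bar>a * w\<bar> *\<^sub>R (b *\<^sub>R (\<integral>t. hatD (- j) f (a * w, b * t) * cnj (h (a * w, b * t)) \<partial>lborel)))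
        = \<bar>w\<bar> *\<^sub>R (\<integral>t. f (w, t) * cnj (hatD j h (w, t)) \<partial>lborel)" for w
    proof -
      define J where "J = (\<integral>t. f (w, t) * cnj (h (a * w, b * t)) \<partial>lborel)"
      have 1: "(\<integral>t. hatD (- j) f (a * w, b * t) * cnj (h (a * w, b * t)) \<partial>lborel) = of_real (1 / c) * J"
        by (simp only: fD J_def mult.assoc integral_mult_right_zero)
      have ptw: "f (w, t) * cnj (hatD j h (w, t)) = of_real c * (f (w, t) * cnj (h (a * w, b * t)))" for t
        by (simp add: hD)
      have 2: "(\<integral>t. f (w, t) * cnj (hatD j h (w, t)) \<partial>lborel) = of_real c * J"
        by (simp only: ptw J_def integral_mult_right_zero)
      have "a * \<bar>a * w\<bar> * b * (1 / c) = \<bar>w\<bar> * (a * (a * b)) / c"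
        using pos by (simp add: abs_mult mult_ac)
      also have "\<dots> = \<bar>w\<bar> * c" using pos by (simp add: abc)
      finally have 3: "a * \<bar>a * w\<bar> * b * (1 / c) = \<bar>w\<bar> * c" .
      show ?thesis
        unfolding 1 2 scaleR_conv_of_real mult.assoc[symmetric] of_real_mult[symmetric] 3 ..
    qed
    then show ?thesis by (simp only: flip: integral_scaleR_right)
  qed
  also have "\<dots> = L2_inner heis_measure f (hatD j h)"
    by (rule L2_inner_heis[symmetric]) (use L2 in \<open>auto intro: hatD_L2\<close>)
  finally show ?thesis ..
qed

text \<open>
  The multiplicity with which the sets \<open>2\<^sup>j E\<close> cover \<open>w\<close>.
\<close>

definition dilate_count :: "real set \<Rightarrow> real \<Rightarrow> ennreal" where
  "dilate_count E w = (\<integral>\<^sup>+j. indicator E (2 powr real_of_int j * w) \<partial>count_space UNIV)"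

lemma measurable_dilate_count [measurable]:
  assumes [measurable]: "E \<in> sets borel"
  shows "dilate_count E \<in> borel_measurable borel"
proof -
  have "dilate_count E = (\<lambda>w. \<Sum>n. indicator E (2 powr real_of_int (int_decode n) * w))"
    unfolding dilate_count_def fun_eq_iff
    by (subst nn_integral_bij_count_space[OF bij_int_decode, symmetric])
      (simp add: nn_integral_count_space_nat)
  also have "\<dots> \<in> borel_measurable borel" by measurable
  finally show ?thesis .
qed

lemma dilate_count_eq_1: "dilate_count E w = 1 \<longleftrightarrow> (\<exists>!j::int. 2 powr j * w \<in> E)"
proof -
  define S where "S = {j::int. 2 powr j * w \<in> E}"
  have "dilate_count E w = (\<integral>\<^sup>+j. indicator S j \<partial>count_space UNIV)"
    unfolding dilate_count_def S_def by (simp add: indicator_def)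
  also have "\<dots> = emeasure (count_space UNIV) S" by simp
  finally have "dilate_count E w = 1 \<longleftrightarrow> card S = 1"
    by (cases "finite S") (auto simp: emeasure_count_space)
  also have "\<dots> \<longleftrightarrow> (\<exists>!j. j \<in> S)"
    by (simp add: card_1_singleton_iff) (metis singletonD singletonI subsetI subset_singletonD ex_in_conv subset_antisym insert_subset empty_subsetI)
  finally show ?thesis by (simp add: S_def)
qed

text \<open>
  Moving the unitary dilation to the other side of the inner product reduces each \<open>j\<close> to
  \<open>parseval_time_frequency\<close>, applied to a dilate of \<open>f\<close>; undoing the dilation replaces \<open>E\<close> by
  \<open>2 powr (- j)\<close> times \<open>E\<close>.
\<close>

lemma wavelet_sum:
  fixes f g :: "real \<times> real \<Rightarrow> complex"
  assumes f [measurable]: "f \<in> borel_measurable borel" and f_L2: "f \<in> L2 heis_measure"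
    and g [measurable]: "g \<in> borel_measurable borel" and g_L2: "g \<in> L2 heis_measure"
    and E [measurable]: "E \<in> sets borel" and E_sub: "E \<subseteq> {-1..<1}"
    and E_disj: "AE w in lborel. \<not> (w \<in> E \<and> w + 1 \<in> E)"
    and supp: "\<And>w t. w \<notin> E \<Longrightarrow> g (w, t) = 0"
    and frame: "AE w in lborel. w \<in> E \<longrightarrow> parseval_gabor w (\<lambda>t. g (w, t))"
  shows "(\<integral>\<^sup>+(j, k, l, m). ennreal ((cmod (L2_inner heis_measure f (hatD j (hatT k l m g))))\<^sup>2) \<partial>count_space UNIV) =
    (\<integral>\<^sup>+w. dilate_count E w * (ennreal \<bar>w\<bar> * (\<integral>\<^sup>+t. ennreal ((cmod (f (w, t)))\<^sup>2) \<partial>lborel)) \<partial>lborel)"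
proof -
  have step: "(\<integral>\<^sup>+(k, l, m). ennreal ((cmod (L2_inner heis_measure f (hatD j (hatT k l m g))))\<^sup>2) \<partial>count_space UNIV) =
      (\<integral>\<^sup>+w. indicator E (2 powr real_of_int j * w) *
        (ennreal \<bar>w\<bar> * (\<integral>\<^sup>+t. ennreal ((cmod (f (w, t)))\<^sup>2) \<partial>lborel)) \<partial>lborel)" for j
  proof -
    have "L2_inner heis_measure f (hatD j (hatT k l m g)) = L2_inner heis_measure (hatD (- j) f) (hatT k l m g)" for k l m
      by (rule L2_inner_hatD) (use f_L2 g_L2 in \<open>auto intro: hatT_L2\<close>)
    moreover note parseval_time_frequency[of "hatD (- j) f" g E,
        OF measurable_hatD[OF f] hatD_L2[OF f f_L2] g g_L2 E E_sub E_disj supp frame]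
    ultimately show ?thesis using nn_integral_hatD[OF f E, of "- j"] by simp
  qed
  have "(\<integral>\<^sup>+(j, k, l, m). ennreal ((cmod (L2_inner heis_measure f (hatD j (hatT k l m g))))\<^sup>2) \<partial>count_space UNIV) =
      (\<integral>\<^sup>+j. (\<integral>\<^sup>+(k, l, m). ennreal ((cmod (L2_inner heis_measure f (hatD j (hatT k l m g))))\<^sup>2) \<partial>count_space UNIV) \<partial>count_space UNIV)"
    by (subst nn_integral_fst_count_space[symmetric]) simp
  also have "\<dots> = (\<integral>\<^sup>+w. (\<integral>\<^sup>+j. indicator E (2 powr real_of_int j * w) *
        (ennreal \<bar>w\<bar> * (\<integral>\<^sup>+t. ennreal ((cmod (f (w, t)))\<^sup>2) \<partial>lborel)) \<partial>count_space UNIV) \<partial>lborel)"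
    unfolding step by (rule nn_integral_count_space_nn_integral[symmetric]) auto
  finally show ?thesis by (simp add: dilate_count_def nn_integral_multc)
qed

section \<open>Passage between Lebesgue and Borel functions\<close>

lemma has_sum_L2_iff:
  assumes "f \<in> L2 M"
  shows "((\<lambda>j. (cmod (a j))\<^sup>2) has_sum (L2_norm M f)\<^sup>2) UNIV \<longleftrightarrow>
    (\<integral>\<^sup>+j. ennreal ((cmod (a j))\<^sup>2) \<partial>count_space UNIV) = (\<integral>\<^sup>+x. ennreal ((cmod (f x))\<^sup>2) \<partial>M)"
  by (subst has_sum_iff_nn_integral_count_space) (simp_all add: L2_nn_integral[OF assms])

lemma heis_wavelet_sum:
  assumes "heis_wavelet I g" and "f \<in> L2 heis_measure"
  shows "(\<integral>\<^sup>+(j, k, l, m). ennreal ((cmod (L2_inner heis_measure f (hatD j (hatT k l m g))))\<^sup>2) \<partial>count_space UNIV) =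
    (\<integral>\<^sup>+x. ennreal ((cmod (f x))\<^sup>2) \<partial>heis_measure)"
  using assms has_sum_L2_iff[OF assms(2), of "\<lambda>(j, k, l, m). L2_inner heis_measure f (hatD j (hatT k l m g))"]
  by (simp add: heis_wavelet_def L2_parseval_frame_def case_prod_beta')

text \<open>
  All systems involved are formed from \<open>g\<close> by affine changes of variables, which preserve null sets,
  so a Borel representative may be used to verify the frame property.
\<close>

lemma heis_waveletI:
  assumes g0: "g0 \<in> L2_over I" and g [measurable]: "g \<in> borel_measurable borel"
    and ae: "AE x in lborel. g0 x = g x"
    and sum: "\<And>f. f \<in> borel_measurable borel \<Longrightarrow> f \<in> L2 heis_measure \<Longrightarrow>
      (\<integral>\<^sup>+(j, k, l, m). ennreal ((cmod (L2_inner heis_measure f (hatD j (hatT k l m g))))\<^sup>2) \<partial>count_space UNIV) =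
      (\<integral>\<^sup>+x. ennreal ((cmod (f x))\<^sup>2) \<partial>heis_measure)"
  shows "heis_wavelet I g0"
proof -
  have g0_L2: "g0 \<in> L2 heis_measure" using g0 by (simp add: L2_over_def)
  then have g_L2: "g \<in> L2 heis_measure"
    by (rule L2_AE_cong) (use ae in \<open>auto intro: measurable_heis simp: AE_heis_iff\<close>)
  have atom_ae: "AE x in lborel. hatD j (hatT k l m g0) x = hatD j (hatT k l m g) x" for j k l m
  proof -
    have "AE x in lborel. g0 (2 powr of_int j * fst x, 2 powr (- of_int j / 2) * snd x + - of_int k) =
        g (2 powr of_int j * fst x, 2 powr (- of_int j / 2) * snd x + - of_int k)"
      by (rule AE_lborel_affine2[OF ae]) simp_all
    then show ?thesis by eventually_elim (simp add: hatD_apply hatT_apply)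
  qed
  have atom_meas: "hatD j (hatT k l m g0) \<in> borel_measurable heis_measure" for j k l m
    by (rule measurable_heis_AE[OF _ atom_ae]) measurable
  have atom_L2: "hatD j (hatT k l m g0) \<in> L2 heis_measure" for j k l m
  proof (rule L2_AE_cong[OF _ atom_meas])
    show "hatD j (hatT k l m g) \<in> L2 heis_measure"
      by (intro hatD_L2 hatT_L2 g_L2) measurable
    show "AE x in heis_measure. hatD j (hatT k l m g) x = hatD j (hatT k l m g0) x"
      using atom_ae[of j k l m] by (simp add: AE_heis_iff eq_commute)
  qed
  have "((\<lambda>i. (cmod (L2_inner heis_measure f ((\<lambda>(j, k, l, m). hatD j (hatT k l m g0)) i)))\<^sup>2)
      has_sum (L2_norm heis_measure f)\<^sup>2) UNIV" if f: "f \<in> L2 heis_measure" for f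
  proof -
    obtain f' where f' [measurable]: "f' \<in> borel_measurable borel" and f_ae: "AE x in lborel. f x = f' x"
      using borel_representative_heis[OF L2_measurable[OF f]] .
    have f'_L2: "f' \<in> L2 heis_measure"
      by (rule L2_AE_cong[OF f]) (use f_ae in \<open>auto intro: measurable_heis simp: AE_heis_iff\<close>)
    have inner: "L2_inner heis_measure f (hatD j (hatT k l m g0)) =
        L2_inner heis_measure f' (hatD j (hatT k l m g))" for j k l m
      by (rule L2_inner_AE_cong)
        (use f_ae atom_ae in \<open>auto intro: measurable_heis L2_measurable[OF f] atom_meas simp: AE_heis_iff\<close>)
    have "(\<integral>\<^sup>+x. ennreal ((cmod (f x))\<^sup>2) \<partial>heis_measure) = (\<integral>\<^sup>+x. ennreal ((cmod (f' x))\<^sup>2) \<partial>heis_measure)"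
      by (rule nn_integral_cong_AE) (use f_ae in \<open>auto simp: AE_heis_iff elim: eventually_mono\<close>)
    then show ?thesis
      unfolding has_sum_L2_iff[OF f] using sum[OF f' f'_L2] by (simp add: case_prod_beta' inner)
  qed
  then show ?thesis
    using g0 atom_L2 by (auto simp: heis_wavelet_def L2_parseval_frame_def)
qed

lemma gabor_system_eq:
  "(\<lambda>(k, l) t. of_real (\<bar>w\<bar> powr (1 / 2)) *
     exp (- 2 * of_real pi * \<i> * of_real w * of_int l * of_real t) *
     g (w, t - of_int k)) = gabor_atom w (\<lambda>t. g (w, t))"
  by (auto simp: gabor_atom_def e2pi_def cis_conv_exp fun_eq_iff mult_ac)

lemma AE_lborel_affine:
  fixes P :: "real \<Rightarrow> bool"
  assumes "AE x in lborel. P x" and "c \<noteq> 0"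
  shows "AE x in lborel. P (t + c * x)"
proof -
  obtain N where N: "{x. \<not> P x} \<subseteq> N" "N \<in> null_sets lborel"
    using assms by (auto simp: eventually_ae_filter)
  then have [measurable]: "N \<in> sets borel" by auto
  have "AE x in lborel. t + c * x \<notin> N"
    by (rule AE_borel_affine) (use assms AE_not_in[OF N(2)] in auto)
  then show ?thesis by eventually_elim (use N(1) in auto)
qed

lemma L2_lebesgue_iff:
  fixes f :: "real \<Rightarrow> complex"
  assumes "f \<in> borel_measurable borel"
  shows "f \<in> L2 lebesgue \<longleftrightarrow> (\<integral>\<^sup>+t. ennreal ((cmod (f t))\<^sup>2) \<partial>lborel) < \<infinity>"
  using assms by (subst L2_iff_nn_integral) (auto intro: measurable_completion simp: nn_integral_completion)

lemma measurable_gabor_atom [measurable]: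
  assumes [measurable]: "u \<in> borel_measurable borel"
  shows "gabor_atom w u i \<in> borel_measurable borel"
  unfolding gabor_atom_def by (cases i) simp

lemma gabor_atom_AE_cong:
  assumes "AE t in lborel. u t = v t"
  shows "AE t in lborel. gabor_atom w u i t = gabor_atom w v i t"
proof (cases i)
  case (Pair k l)
  show ?thesis
    using AE_lborel_affine[OF assms one_neq_zero, of "- of_int k"] unfolding Pair
    by eventually_elim (simp add: gabor_atom_def)
qed

lemma parseval_gabor_of_frame:
  assumes frame: "L2_parseval_frame (lebesgue :: real measure) UNIV (gabor_atom w u)"
    and [measurable]: "v \<in> borel_measurable borel" and ae: "AE t in lborel. u t = v t"
  shows "parseval_gabor w v"
  unfolding parseval_gabor_def
proof (intro ballI impI)
  fix f :: "real \<Rightarrow> complex"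
  assume f [measurable]: "f \<in> borel_measurable borel" and "(\<integral>\<^sup>+t. ennreal ((cmod (f t))\<^sup>2) \<partial>lborel) < \<infinity>"
  then have f_L2: "f \<in> L2 lebesgue" by (simp add: L2_lebesgue_iff)
  have inner: "L2_inner lebesgue f (gabor_atom w u i) = (\<integral>t. f t * cnj (gabor_atom w v i t) \<partial>lborel)" for i
  proof -
    have "gabor_atom w u i \<in> borel_measurable lebesgue"
      using frame unfolding L2_parseval_frame_def by (blast intro: L2_measurable)
    moreover have "gabor_atom w v i \<in> borel_measurable lebesgue"
      by (rule measurable_completion) simp
    ultimately have "L2_inner lebesgue f (gabor_atom w u i) = L2_inner lebesgue f (gabor_atom w v i)"
      by (intro L2_inner_AE_cong)
        (use L2_measurable[OF f_L2] AE_completion[OF gabor_atom_AE_cong[OF ae]] in auto)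
    also have "\<dots> = (\<integral>t. f t * cnj (gabor_atom w v i t) \<partial>lborel)"
      unfolding L2_inner_def by (rule integral_completion) measurable
    finally show ?thesis .
  qed
  have "((\<lambda>i. (cmod (L2_inner lebesgue f (gabor_atom w u i)))\<^sup>2) has_sum (L2_norm lebesgue f)\<^sup>2) UNIV"
    using frame f_L2 by (auto simp: L2_parseval_frame_def)
  then show "(\<integral>\<^sup>+i. ennreal ((cmod (\<integral>t. f t * cnj (gabor_atom w v i t) \<partial>lborel))\<^sup>2) \<partial>count_space UNIV) =
      (\<integral>\<^sup>+t. ennreal ((cmod (f t))\<^sup>2) \<partial>lborel)"
    unfolding has_sum_L2_iff[OF f_L2] inner by (simp add: nn_integral_completion)
qed

lemma frame_of_parseval_gabor:
  assumes u [measurable]: "u \<in> borel_measurable borel"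
    and fin: "(\<integral>\<^sup>+t. ennreal ((cmod (u t))\<^sup>2) \<partial>lborel) < \<infinity>"
    and pg: "parseval_gabor w u"
  shows "L2_parseval_frame (lebesgue :: real measure) UNIV (gabor_atom w u)"
  unfolding L2_parseval_frame_def
proof (intro conjI ballI)
  fix i :: "int \<times> int"
  obtain k l where i: "i = (k, l)" by force
  have "(\<integral>\<^sup>+t. ennreal ((cmod (gabor_atom w u i t))\<^sup>2) \<partial>lborel) =
      (\<integral>\<^sup>+t. ennreal \<bar>w\<bar> * ennreal ((cmod (u t))\<^sup>2) \<partial>lborel)"
    by (subst nn_integral_real_affine[where c = 1 and t = "of_int k"])
      (simp_all add: i gabor_atom_def norm_mult power_mult_distrib powr_half_sqrt ennreal_mult)
  also have "\<dots> < \<infinity>" using fin by (simp add: nn_integral_cmult ennreal_mult_less_top)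
  finally show "gabor_atom w u i \<in> L2 lebesgue" by (simp add: L2_lebesgue_iff)
next
  fix f :: "real \<Rightarrow> complex" assume f: "f \<in> L2 lebesgue"
  obtain f' where f' [measurable]: "f' \<in> borel_measurable borel" and ae: "AE t in lborel. f t = f' t"
    using borel_representative_lebesgue[OF L2_measurable[OF f]] .
  have norm: "(\<integral>\<^sup>+t. ennreal ((cmod (f t))\<^sup>2) \<partial>lebesgue) = (\<integral>\<^sup>+t. ennreal ((cmod (f' t))\<^sup>2) \<partial>lborel)"
    unfolding nn_integral_completion
    by (rule nn_integral_cong_AE) (use ae in \<open>auto elim: eventually_mono\<close>)
  have inner: "L2_inner lebesgue f (gabor_atom w u i) = (\<integral>t. f' t * cnj (gabor_atom w u i t) \<partial>lborel)" for i
  proof -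
    have "gabor_atom w u i \<in> borel_measurable lebesgue" "f' \<in> borel_measurable lebesgue"
      by (rule measurable_completion, simp)+
    then have "L2_inner lebesgue f (gabor_atom w u i) = L2_inner lebesgue f' (gabor_atom w u i)"
      by (intro L2_inner_AE_cong) (use L2_measurable[OF f] AE_completion[OF ae] in auto)
    also have "\<dots> = (\<integral>t. f' t * cnj (gabor_atom w u i t) \<partial>lborel)"
      unfolding L2_inner_def by (rule integral_completion) measurable
    finally show ?thesis .
  qed
  have "(\<integral>\<^sup>+t. ennreal ((cmod (f' t))\<^sup>2) \<partial>lborel) < \<infinity>"
    using f L2_iff_nn_integral[OF L2_measurable[OF f]] norm by simp
  then show "((\<lambda>i. (cmod (L2_inner lebesgue f (gabor_atom w u i)))\<^sup>2) has_sum (L2_norm lebesgue f)\<^sup>2) UNIV"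
    unfolding has_sum_L2_iff[OF f] inner norm using pg f' by (simp add: parseval_gabor_def)
qed

lemma gabor_fieldI:
  assumes g [measurable]: "g \<in> borel_measurable borel" and L2: "g \<in> L2 heis_measure"
    and supp: "\<And>w t. w \<notin> I \<Longrightarrow> g (w, t) = 0"
    and pg: "AE w in lborel. w \<in> I \<longrightarrow> parseval_gabor w (\<lambda>t. g (w, t))"
  shows "gabor_field I g"
proof -
  have "AE w in lborel. w \<in> I \<longrightarrow> L2_parseval_frame (lebesgue :: real measure) UNIV (gabor_atom w (\<lambda>t. g (w, t)))"
    using pg nn_integral_heis_slice[OF g L2]
    by eventually_elim (auto intro!: frame_of_parseval_gabor)
  moreover have "g \<in> L2_over I" using L2 supp by (auto simp: L2_over_def)
  ultimately show ?thesis
    unfolding gabor_field_def gabor_system_eq by (simp add: AE_completion)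
qed

lemma gabor_field_borel:
  assumes g0: "gabor_field I g0" and I [measurable]: "I \<in> sets borel"
  obtains g where "g \<in> borel_measurable borel" "g \<in> L2 heis_measure" "AE x in lborel. g0 x = g x"
    "\<And>w t. w \<notin> I \<Longrightarrow> g (w, t) = 0" "AE w in lborel. w \<in> I \<longrightarrow> parseval_gabor w (\<lambda>t. g (w, t))"
proof -
  have L2: "g0 \<in> L2 heis_measure" and supp0: "AE x in lborel. fst x \<notin> I \<longrightarrow> g0 x = 0"
    using g0 by (auto simp: gabor_field_def L2_over_def AE_heis_iff case_prod_beta)
  obtain h where h [measurable]: "h \<in> borel_measurable borel" and h_ae: "AE x in lborel. g0 x = h x"
    using borel_representative_heis[OF L2_measurable[OF L2]] .
  define g where "g x = (if fst x \<in> I then h x else 0)" for x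
  have [measurable]: "g \<in> borel_measurable borel" unfolding g_def by measurable
  have ae: "AE x in lborel. g0 x = g x"
    using supp0 h_ae by eventually_elim (auto simp: g_def)
  have g_L2: "g \<in> L2 heis_measure"
    by (rule L2_AE_cong[OF L2]) (use ae in \<open>auto intro: measurable_heis simp: AE_heis_iff\<close>)
  have "AE w in lborel. w \<in> I \<longrightarrow> L2_parseval_frame (lebesgue :: real measure) UNIV (gabor_atom w (\<lambda>t. g0 (w, t)))"
    using g0 unfolding gabor_field_def gabor_system_eq by (simp add: AE_completion_iff)
  then have "AE w in lborel. w \<in> I \<longrightarrow> parseval_gabor w (\<lambda>t. g (w, t))"
    using AE_lborel_prodD[OF ae]
    by eventually_elim (auto intro!: parseval_gabor_of_frame)
  then show ?thesis using that[of g] g_L2 ae by (simp add: g_def)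
qed

section \<open>Gabor fields over tiling sets are wavelets\<close>

lemma gabor_field_wavelet_of_tiling:
  assumes I [measurable]: "I \<in> sets borel" and I_sub: "I \<subseteq> {-1..<1}"
    and disj: "AE w in lborel. \<not> (w \<in> I \<and> w + 1 \<in> I)"
    and tile: "AE w in lborel. dilate_count I w = 1"
    and g0: "gabor_field I g0"
  shows "heis_wavelet I g0"
proof -
  obtain g where g: "g \<in> borel_measurable borel" "g \<in> L2 heis_measure" "AE x in lborel. g0 x = g x"
    "\<And>w t. w \<notin> I \<Longrightarrow> g (w, t) = 0" "AE w in lborel. w \<in> I \<longrightarrow> parseval_gabor w (\<lambda>t. g (w, t))"
    using gabor_field_borel[OF g0 I] by blast
  show ?thesis
  proof (rule heis_waveletI[OF _ g(1) g(3)])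
    show "g0 \<in> L2_over I" using g0 by (simp add: gabor_field_def)
    fix f :: "real \<times> real \<Rightarrow> complex"
    assume f: "f \<in> borel_measurable borel" "f \<in> L2 heis_measure"
    show "(\<integral>\<^sup>+(j, k, l, m). ennreal ((cmod (L2_inner heis_measure f (hatD j (hatT k l m g))))\<^sup>2) \<partial>count_space UNIV) =
        (\<integral>\<^sup>+x. ennreal ((cmod (f x))\<^sup>2) \<partial>heis_measure)"
      unfolding nn_integral_heis_cmod[OF f(1)]
    proof (rule trans[OF wavelet_sum[OF f g(1,2) I I_sub disj]])
      show "(\<integral>\<^sup>+w. dilate_count I w * (ennreal \<bar>w\<bar> * (\<integral>\<^sup>+t. ennreal ((cmod (f (w, t)))\<^sup>2) \<partial>lborel)) \<partial>lborel) =
          (\<integral>\<^sup>+w. ennreal \<bar>w\<bar> * (\<integral>\<^sup>+t. ennreal ((cmod (f (w, t)))\<^sup>2) \<partial>lborel) \<partial>lborel)"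
        by (rule nn_integral_cong_AE) (use tile in \<open>auto elim: eventually_mono\<close>)
    qed (use g in auto)
  qed
qed

section \<open>Wavelet sets: the dilates tile the line\<close>

definition window_field :: "(real \<Rightarrow> complex) \<Rightarrow> real \<times> real \<Rightarrow> complex" where
  "window_field \<sigma> x = \<sigma> (fst x) * window (snd x)"

lemma measurable_window_field [measurable]:
  assumes [measurable]: "\<sigma> \<in> borel_measurable borel"
  shows "window_field \<sigma> \<in> borel_measurable borel"
  unfolding window_field_def[abs_def] by measurable

lemma nn_integral_window: "(\<integral>\<^sup>+t. ennreal ((cmod (window t))\<^sup>2) \<partial>lborel) = 1"
proof -
  have "(\<integral>\<^sup>+t. ennreal ((cmod (window t))\<^sup>2) \<partial>lborel) = (\<integral>\<^sup>+t. indicator {-1/2..<1/2::real} t \<partial>lborel)"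
    by (rule nn_integral_cong) (simp add: window_def indicator_def)
  then show ?thesis by simp
qed

lemma window_field_L2:
  assumes [measurable]: "\<sigma> \<in> borel_measurable borel"
    and bd: "\<And>w. cmod (\<sigma> w) \<le> indicator {-1..1} w"
  shows "window_field \<sigma> \<in> L2 heis_measure"
proof -
  have "(\<integral>\<^sup>+t. ennreal ((cmod (window_field \<sigma> (w, t)))\<^sup>2) \<partial>lborel) = ennreal ((cmod (\<sigma> w))\<^sup>2)" for w
    by (simp add: window_field_def norm_mult power_mult_distrib ennreal_mult
        nn_integral_cmult nn_integral_window)
  then have "(\<integral>\<^sup>+x. ennreal ((cmod (window_field \<sigma> x))\<^sup>2) \<partial>heis_measure) =
      (\<integral>\<^sup>+w. ennreal (\<bar>w\<bar> * (cmod (\<sigma> w))\<^sup>2) \<partial>lborel)"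
    by (simp add: nn_integral_heis_cmod ennreal_mult)
  also have "\<dots> \<le> (\<integral>\<^sup>+w. indicator {-1..1::real} w \<partial>lborel)"
  proof (rule nn_integral_mono)
    fix w :: real
    have "\<bar>w\<bar> * (cmod (\<sigma> w))\<^sup>2 \<le> indicator {-1..1} w"
    proof (cases "w \<in> {-1..1}")
      case True
      then show ?thesis
        using mult_mono[of "\<bar>w\<bar>" 1 "(cmod (\<sigma> w))\<^sup>2" 1] bd[of w] by (auto simp: power_le_one)
    qed (use bd[of w] in auto)
    then show "ennreal (\<bar>w\<bar> * (cmod (\<sigma> w))\<^sup>2) \<le> indicator {-1..1} w"
      by (metis ennreal_indicator ennreal_leI)
  qed
  also have "\<dots> < \<infinity>" by simp
  finally show ?thesis by (subst L2_iff_nn_integral) (auto intro: measurable_heis)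
qed

lemma parseval_gabor_window:
  assumes w: "w \<noteq> 0" "\<bar>w\<bar> \<le> 1" and c: "cmod c = 1"
  shows "parseval_gabor w (\<lambda>t. c * window t)"
  unfolding parseval_gabor_def
proof (intro ballI impI)
  fix f :: "real \<Rightarrow> complex"
  assume f: "f \<in> borel_measurable borel" "(\<integral>\<^sup>+t. ennreal ((cmod (f t))\<^sup>2) \<partial>lborel) < \<infinity>"
  have ptw: "f t * cnj (gabor_atom w (\<lambda>t. c * window t) i t) = cnj c * (f t * cnj (gabor_atom w window i t))" for i t
    by (cases i) (simp add: gabor_atom_def mult_ac)
  show "(\<integral>\<^sup>+i. ennreal ((cmod (\<integral>t. f t * cnj (gabor_atom w (\<lambda>t. c * window t) i t) \<partial>lborel))\<^sup>2) \<partial>count_space UNIV) =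
      (\<integral>\<^sup>+t. ennreal ((cmod (f t))\<^sup>2) \<partial>lborel)"
    unfolding ptw integral_mult_right_zero using window_frame[OF w f] c by (simp add: norm_mult)
qed

lemma parseval_gabor_window_field:
  assumes "E \<subseteq> {-1..1}" and "\<And>w. cmod (\<sigma> w) = indicator E w"
  shows "AE w in lborel. w \<in> E \<longrightarrow> parseval_gabor w (\<lambda>t. window_field \<sigma> (w, t))"
  using AE_lborel_singleton[of 0]
proof eventually_elim
  case (elim w)
  show ?case
    using assms elim by (auto simp: window_field_def indicator_def subset_iff abs_le_iff intro!: parseval_gabor_window)
qed

lemma window_field_gabor_field:
  assumes [measurable]: "\<sigma> \<in> borel_measurable borel"
    and E: "E \<subseteq> {-1..1}" and \<sigma>: "\<And>w. cmod (\<sigma> w) = indicator E w"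
  shows "gabor_field E (window_field \<sigma>)"
proof (rule gabor_fieldI)
  show "window_field \<sigma> \<in> L2 heis_measure"
    by (rule window_field_L2) (use E \<sigma> in \<open>auto simp: indicator_def\<close>)
  show "window_field \<sigma> (w, t) = 0" if "w \<notin> E" for w t
    using \<sigma>[of w] that by (simp add: window_field_def)
qed (use parseval_gabor_window_field[OF E \<sigma>] in auto)

lemma window_field_wavelet_sum:
  assumes \<sigma> [measurable]: "\<sigma> \<in> borel_measurable borel" and E [measurable]: "E \<in> sets borel"
    and E_sub: "E \<subseteq> {-1..<1}" and E_disj: "\<And>w. w \<in> E \<Longrightarrow> w + 1 \<notin> E"
    and E\<sigma>: "\<And>w. cmod (\<sigma> w) = indicator E w"
    and f: "f \<in> borel_measurable borel" "f \<in> L2 heis_measure"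
  shows "(\<integral>\<^sup>+(j, k, l, m). ennreal ((cmod (L2_inner heis_measure f (hatD j (hatT k l m (window_field \<sigma>)))))\<^sup>2) \<partial>count_space UNIV) =
    (\<integral>\<^sup>+w. dilate_count E w * (ennreal \<bar>w\<bar> * (\<integral>\<^sup>+t. ennreal ((cmod (f (w, t)))\<^sup>2) \<partial>lborel)) \<partial>lborel)"
proof (rule wavelet_sum[OF f _ _ E E_sub])
  have E': "E \<subseteq> {-1..1}" using E_sub by auto
  show "window_field \<sigma> \<in> L2 heis_measure"
    by (rule window_field_L2) (use E' E\<sigma> in \<open>auto simp: indicator_def\<close>)
  show "window_field \<sigma> (w, t) = 0" if "w \<notin> E" for w t
    using E\<sigma>[of w] that by (simp add: window_field_def)
  show "AE w in lborel. w \<in> E \<longrightarrow> parseval_gabor w (\<lambda>t. window_field \<sigma> (w, t))"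
    by (rule parseval_gabor_window_field[OF E' E\<sigma>])
qed (use E_disj in auto)

lemma dilate_count_disjoint_Un:
  assumes "A \<inter> B = {}"
  shows "dilate_count (A \<union> B) w = dilate_count A w + dilate_count B w"
  unfolding dilate_count_def
  by (subst nn_integral_add[symmetric]) (use assms in \<open>auto simp: indicator_def intro!: nn_integral_cong\<close>)

lemma parallelogram_law:
  "(cmod (a + b))\<^sup>2 + (cmod (a + - 1 * b))\<^sup>2 = 2 * (cmod a)\<^sup>2 + 2 * (cmod b)\<^sup>2"
  unfolding cmod_power2 by (simp add: power2_eq_square algebra_simps)

text \<open>
  The windows with signs \<open>1\<close> and \<open>-1\<close> for \<open>w < 0\<close> both give Gabor fields.  In the sum of the two frame
  identities the parallelogram law cancels the mixed terms between the parts of \<open>I\<close> on either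
  side of \<open>0\<close>.  Each part lies in an interval of length one, so its translates are disjoint and
  its contribution is known from \<open>wavelet_sum\<close>.
\<close>

lemma wavelet_set_dilation_identity:
  assumes I [measurable]: "I \<in> sets borel" and I_sub: "I \<subseteq> {-1..<1}"
    and all: "\<And>g. gabor_field I g \<Longrightarrow> heis_wavelet I g"
    and f: "f \<in> borel_measurable borel" "f \<in> L2 heis_measure"
  shows "(\<integral>\<^sup>+w. dilate_count I w * (ennreal \<bar>w\<bar> * (\<integral>\<^sup>+t. ennreal ((cmod (f (w, t)))\<^sup>2) \<partial>lborel)) \<partial>lborel) =
    (\<integral>\<^sup>+x. ennreal ((cmod (f x))\<^sup>2) \<partial>heis_measure)"
proof -
  (* Each of these sets lies in a half-open interval of length one. *)
  let ?Ip = "I \<inter> {0..}" and ?Im = "I \<inter> {..<0}"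
  let ?p = "indicator ?Ip :: real \<Rightarrow> complex" and ?m = "indicator ?Im :: real \<Rightarrow> complex"
  define \<alpha> where "\<alpha> = (\<lambda>\<sigma> (j, k, l, m). L2_inner heis_measure f (hatD j (hatT k l m (window_field \<sigma>))))"
  define N where "N = (\<integral>\<^sup>+x. ennreal ((cmod (f x))\<^sup>2) \<partial>heis_measure)"
  define S where "S \<sigma> = (\<integral>\<^sup>+i. ennreal ((cmod (\<alpha> \<sigma> i))\<^sup>2) \<partial>count_space UNIV)" for \<sigma>
  have L2: "window_field ?p \<in> L2 heis_measure" "window_field (\<lambda>w. c * ?m w) \<in> L2 heis_measure" if "cmod c = 1" for c
    by (rule window_field_L2; use I_sub that in \<open>auto simp: indicator_def norm_mult\<close>)+
  have L2m: "window_field ?m \<in> L2 heis_measure" using L2(2)[of 1] by simp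
  have lin: "\<alpha> (\<lambda>w. ?p w + c * ?m w) i = \<alpha> ?p i + cnj c * \<alpha> ?m i" if c: "cmod c = 1" for c i
  proof -
    obtain j k l m where i: "i = (j, k, l, m)" by (cases i) auto
    let ?T = "\<lambda>g. hatD j (hatT k l m g)"
    have split: "?T (window_field (\<lambda>w. ?p w + c * ?m w)) = (\<lambda>x. ?T (window_field ?p) x + c * ?T (window_field ?m) x)"
      by (rule ext) (simp add: hatD_apply hatT_apply window_field_def algebra_simps)
    have T_L2: "?T (window_field ?p) \<in> L2 heis_measure" "?T (window_field ?m) \<in> L2 heis_measure"
      using L2(1)[of 1] L2m by (auto intro!: hatD_L2 hatT_L2)
    show ?thesis
      unfolding \<alpha>_def i prod.case split
      by (subst L2_inner_add_right[OF f(2) T_L2(1) L2_scale[OF T_L2(2)]]) (simp add: L2_inner_scale_right)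
  qed
  have full: "S (\<lambda>w. ?p w + c * ?m w) = N" if c: "cmod c = 1" for c
  proof -
    have "gabor_field I (window_field (\<lambda>w. ?p w + c * ?m w))"
    proof (rule window_field_gabor_field)
      show "cmod (?p w + c * ?m w) = indicator I w" for w
        using c by (auto simp: indicator_def)
    qed (use I_sub in auto)
    from heis_wavelet_sum[OF all[OF this] f(2)] show ?thesis
      by (simp add: S_def \<alpha>_def N_def case_prod_beta')
  qed
  have part: "S ?p = (\<integral>\<^sup>+w. dilate_count ?Ip w * (ennreal \<bar>w\<bar> * (\<integral>\<^sup>+t. ennreal ((cmod (f (w, t)))\<^sup>2) \<partial>lborel)) \<partial>lborel)"
    "S ?m = (\<integral>\<^sup>+w. dilate_count ?Im w * (ennreal \<bar>w\<bar> * (\<integral>\<^sup>+t. ennreal ((cmod (f (w, t)))\<^sup>2) \<partial>lborel)) \<partial>lborel)"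
    unfolding S_def \<alpha>_def
    by (subst window_field_wavelet_sum[symmetric, OF _ _ _ _ _ f],
        use I_sub in \<open>auto simp: indicator_def case_prod_beta'\<close>)+
  have "2 * N = S (\<lambda>w. ?p w + 1 * ?m w) + S (\<lambda>w. ?p w + - 1 * ?m w)"
    using full[of 1] full[of "- 1"] by (simp add: mult_2)
  also have "\<dots> = (\<integral>\<^sup>+i. ennreal ((cmod (\<alpha> (\<lambda>w. ?p w + 1 * ?m w) i))\<^sup>2) +
      ennreal ((cmod (\<alpha> (\<lambda>w. ?p w + - 1 * ?m w) i))\<^sup>2) \<partial>count_space UNIV)"
    unfolding S_def by (rule nn_integral_add[symmetric]) auto
  also have "\<dots> = (\<integral>\<^sup>+i. 2 * ennreal ((cmod (\<alpha> ?p i))\<^sup>2) + 2 * ennreal ((cmod (\<alpha> ?m i))\<^sup>2) \<partial>count_space UNIV)"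
  proof (rule nn_integral_cong)
    fix i
    have "\<alpha> (\<lambda>w. ?p w + 1 * ?m w) i = \<alpha> ?p i + \<alpha> ?m i"
      "\<alpha> (\<lambda>w. ?p w + - 1 * ?m w) i = \<alpha> ?p i + - 1 * \<alpha> ?m i"
      using lin[of 1 i] lin[of "- 1" i] by simp_all
    then have "ennreal ((cmod (\<alpha> (\<lambda>w. ?p w + 1 * ?m w) i))\<^sup>2) + ennreal ((cmod (\<alpha> (\<lambda>w. ?p w + - 1 * ?m w) i))\<^sup>2) =
       ennreal (2 * (cmod (\<alpha> ?p i))\<^sup>2 + 2 * (cmod (\<alpha> ?m i))\<^sup>2)"
      using parallelogram_law[of "\<alpha> ?p i" "\<alpha> ?m i"]
      by (simp only: ennreal_plus[symmetric] zero_le_power2)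
    then show "ennreal ((cmod (\<alpha> (\<lambda>w. ?p w + 1 * ?m w) i))\<^sup>2) + ennreal ((cmod (\<alpha> (\<lambda>w. ?p w + - 1 * ?m w) i))\<^sup>2) =
       2 * ennreal ((cmod (\<alpha> ?p i))\<^sup>2) + 2 * ennreal ((cmod (\<alpha> ?m i))\<^sup>2)"
      by (simp add: ennreal_mult)
  qed
  also have "\<dots> = 2 * (S ?p + S ?m)"
    by (simp add: S_def nn_integral_add nn_integral_cmult distrib_left)
  finally have "N = S ?p + S ?m" by (simp only: ennreal_mult_cancel_left) simp
  also have "\<dots> = (\<integral>\<^sup>+w. dilate_count I w * (ennreal \<bar>w\<bar> * (\<integral>\<^sup>+t. ennreal ((cmod (f (w, t)))\<^sup>2) \<partial>lborel)) \<partial>lborel)"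
  proof -
    note [measurable] = f(1)
    have "dilate_count I w = dilate_count ?Ip w + dilate_count ?Im w" for w
      by (subst dilate_count_disjoint_Un[symmetric]) (auto intro!: arg_cong[where f = "\<lambda>A. dilate_count A w"])
    then show ?thesis
      unfolding part by (subst nn_integral_add[symmetric]) (simp_all add: distrib_right)
  qed
  finally show ?thesis by (simp add: N_def)
qed

text \<open>
  Testing the preceding identity on indicators of rectangles over arbitrary bounded sets shows that
  \<open>dilate_count I w * \<bar>w\<bar>\<close> and \<open>\<bar>w\<bar>\<close> are densities of the same measure.
\<close>

lemma wavelet_set_dilates_tile:
  assumes I [measurable]: "I \<in> sets borel" and I_sub: "I \<subseteq> {-1..<1}"
    and all: "\<And>g. gabor_field I g \<Longrightarrow> heis_wavelet I g"
  shows "AE w in lborel. dilate_count I w = 1"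
proof -
  have "AE w in lborel. dilate_count I w * (ennreal \<bar>w\<bar> * indicator {-real n..real n} w) =
      ennreal \<bar>w\<bar> * indicator {-real n..real n} w" for n :: nat
  proof (rule sigma_finite_measure.density_unique[OF sigma_finite_lborel])
    let ?B = "{-real n..real n}"
    show "density lborel (\<lambda>w. dilate_count I w * (ennreal \<bar>w\<bar> * indicator ?B w)) =
        density lborel (\<lambda>w. ennreal \<bar>w\<bar> * indicator ?B w)"
    proof (rule measure_eqI)
      fix A :: "real set" assume "A \<in> sets (density lborel (\<lambda>w. dilate_count I w * (ennreal \<bar>w\<bar> * indicator ?B w)))"
      then have [measurable]: "A \<in> sets borel" by simp
      define f :: "real \<times> real \<Rightarrow> complex" where "f x = indicator ((A \<inter> ?B) \<times> {0..1}) x" for x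
      have [measurable]: "f \<in> borel_measurable borel"
        unfolding f_def borel_prod[symmetric] by measurable
      have slice: "(\<integral>\<^sup>+t. ennreal ((cmod (f (w, t)))\<^sup>2) \<partial>lborel) = indicator (A \<inter> ?B) w" for w
      proof -
        have "ennreal ((cmod (f (w, t)))\<^sup>2) = indicator (A \<inter> ?B) w * indicator {0..1} t" for t
          by (auto simp: f_def indicator_def)
        then show ?thesis by (simp add: nn_integral_cmult)
      qed
      have nf: "(\<integral>\<^sup>+x. ennreal ((cmod (f x))\<^sup>2) \<partial>heis_measure) = (\<integral>\<^sup>+w. ennreal \<bar>w\<bar> * indicator (A \<inter> ?B) w \<partial>lborel)"
        by (simp add: nn_integral_heis_cmod slice)
      also have "\<dots> \<le> (\<integral>\<^sup>+w. ennreal n * indicator ?B w \<partial>lborel)"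
        by (rule nn_integral_mono) (auto simp: indicator_def intro!: ennreal_leI)
      also have "\<dots> < \<infinity>" by (simp add: nn_integral_cmult ennreal_mult_less_top)
      finally have "f \<in> L2 heis_measure"
        by (subst L2_iff_nn_integral) (auto intro: measurable_heis)
      from wavelet_set_dilation_identity[OF I I_sub all _ this]
      have "(\<integral>\<^sup>+w. dilate_count I w * (ennreal \<bar>w\<bar> * indicator (A \<inter> ?B) w) \<partial>lborel) =
          (\<integral>\<^sup>+w. ennreal \<bar>w\<bar> * indicator (A \<inter> ?B) w \<partial>lborel)"
        by (simp add: slice nf)
      then show "emeasure (density lborel (\<lambda>w. dilate_count I w * (ennreal \<bar>w\<bar> * indicator ?B w))) A =
          emeasure (density lborel (\<lambda>w. ennreal \<bar>w\<bar> * indicator ?B w)) A"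
        by (simp add: emeasure_density indicator_inter_arith mult_ac)
    qed simp
  qed measurable
  then have "AE w in lborel. \<forall>n::nat. dilate_count I w * (ennreal \<bar>w\<bar> * indicator {-real n..real n} w) =
      ennreal \<bar>w\<bar> * indicator {-real n..real n} w"
    unfolding AE_all_countable by blast
  then show ?thesis
    using AE_lborel_singleton[of 0]
  proof eventually_elim
    case (elim w)
    (* Every w lies in one of the bounded intervals on which the densities were compared. *)
    obtain n :: nat where "\<bar>w\<bar> \<le> real n" using real_arch_simple by blast
    then have "w \<in> {-real n..real n}" by auto
    then have "dilate_count I w * ennreal \<bar>w\<bar> = ennreal \<bar>w\<bar>"
      using spec[OF elim(1), of n] by simp
    then have "ennreal \<bar>w\<bar> * dilate_count I w = ennreal \<bar>w\<bar> * 1" by (simp add: mult.commute)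
    then show ?case using elim(2) by (simp only: ennreal_mult_cancel_left) simp
  qed
qed

section \<open>Wavelet sets: the translates are disjoint\<close>

text \<open>
  In the variable \<open>s = w * t\<close> both the test function and the modulations become independent of \<open>w\<close>,
  and the Jacobian cancels the density.  What remains depends on \<open>w\<close> only through the factor \<open>\<sigma> w\<close>,
  the character with frequency \<open>m\<close> and the width \<open>h\<close>.
\<close>

lemma rescaled_slice_integral:
  fixes c :: complex
  assumes w: "w \<noteq> 0" and h: "2 * h \<le> \<bar>w\<bar>"
  shows "\<bar>w\<bar> *\<^sub>R (\<integral>t. (if \<bar>w * t\<bar> < h then 1 else 0) * cnj (hatT k l m (window_field \<sigma>) (w, t)) \<partial>lborel) =
    (if k = 0 then cnj (\<sigma> w) * e2pi (- (w * of_int m)) *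
      (\<integral>s. (if \<bar>s\<bar> < h then 1 else 0) * e2pi (of_int l * s) \<partial>lborel) else 0)"
proof -
  have win: "window (t - of_int k) = (if k = 0 then 1 else 0)" if "\<bar>w * t\<bar> < h" for t
  proof -
    have "\<bar>w\<bar> * \<bar>t\<bar> < \<bar>w\<bar> * (1/2)" using that h by (simp add: abs_mult)
    then have t: "\<bar>t\<bar> < 1/2" using w by (simp add: mult_less_cancel_left_pos)
    show ?thesis
    proof (cases "k = 0")
      case True
      then show ?thesis using t by (auto simp: window_def indicator_def abs_less_iff)
    next
      case False
      then have "1 \<le> \<bar>real_of_int k\<bar>" by (metis int_one_le_iff_zero_less of_int_abs of_int_1_le_iff zero_less_abs_iff)
      then have "t - of_int k \<notin> {-1/2..<1/2}" using t by (auto simp: abs_if split: if_splits)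
      then show ?thesis using False by (simp add: window_def)
    qed
  qed
  have ptw: "(if \<bar>w * t\<bar> < h then 1 else 0) * cnj (hatT k l m (window_field \<sigma>) (w, t)) =
      (if k = 0 then cnj (\<sigma> w) * e2pi (- (w * of_int m)) else 0) *
        ((if \<bar>w * t\<bar> < h then 1 else 0) * e2pi (of_int l * (w * t)))" for t
    by (cases "\<bar>w * t\<bar> < h") (simp_all add: win hatT_apply window_field_def cnj_e2pi mult_ac)
  have "(\<integral>s. (if \<bar>s\<bar> < h then 1 else 0) * e2pi (of_int l * s) \<partial>lborel) =
      \<bar>w\<bar> *\<^sub>R (\<integral>t. (if \<bar>w * t\<bar> < h then 1 else 0) * e2pi (of_int l * (w * t)) \<partial>lborel)"
    using w by (subst lborel_integral_real_affine[where c = w and t = 0]) simp_all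
  then show ?thesis
    unfolding ptw integral_mult_right_zero by simp
qed

lemma integral_antiperiodic_pair:
  fixes \<Omega> :: "real \<Rightarrow> complex"
  assumes \<Omega>: "integrable lborel \<Omega>" and K [measurable]: "K \<in> sets borel" and K_sub: "K \<subseteq> {..<0}" "\<And>w. w \<in> K \<Longrightarrow> 0 \<le> w + 1"
    and supp: "\<And>w. w \<notin> K \<Longrightarrow> w - 1 \<notin> K \<Longrightarrow> \<Omega> w = 0"
    and anti: "\<And>w. w \<in> K \<Longrightarrow> \<Omega> (w + 1) = - \<Omega> w"
  shows "(\<integral>w. \<Omega> w \<partial>lborel) = 0"
proof -
  have [measurable]: "\<Omega> \<in> borel_measurable borel" using \<Omega> by auto
  have i: "integrable lborel (\<lambda>w. indicator K w *\<^sub>R \<Omega> w)" "integrable lborel (\<lambda>w. indicator K (w - 1) *\<^sub>R \<Omega> w)"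
    by (rule Bochner_Integration.integrable_bound[OF \<Omega>]; auto simp: indicator_def)+
  have "\<Omega> w = indicator K w *\<^sub>R \<Omega> w + indicator K (w - 1) *\<^sub>R \<Omega> w" for w
    using supp[of w] K_sub(1) K_sub(2)[of "w - 1"] by (force simp: indicator_def)
  then have "(\<integral>w. \<Omega> w \<partial>lborel) = (\<integral>w. indicator K w *\<^sub>R \<Omega> w + indicator K (w - 1) *\<^sub>R \<Omega> w \<partial>lborel)"
    by simp
  also have "\<dots> = (\<integral>w. indicator K w *\<^sub>R \<Omega> w \<partial>lborel) + (\<integral>w. indicator K (w - 1) *\<^sub>R \<Omega> w \<partial>lborel)"
    using i by simp
  also have "(\<integral>w. indicator K (w - 1) *\<^sub>R \<Omega> w \<partial>lborel) = (\<integral>w. indicator K w *\<^sub>R \<Omega> (w + 1) \<partial>lborel)"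
    by (subst lborel_integral_real_affine[where c = 1 and t = 1]) (simp_all add: add.commute)
  also have "\<dots> = (\<integral>w. - (indicator K w *\<^sub>R \<Omega> w) \<partial>lborel)"
    by (rule Bochner_Integration.integral_cong) (auto simp: indicator_def anti)
  finally show ?thesis by simp
qed

text \<open>
  Let \<open>K\<close> be the set of \<open>w \<in> I\<close> with \<open>w + 1 \<in> I\<close>.  The test function is the indicator of
  \<open>\<bar>w * t\<bar> < h w\<close> over \<open>K\<close> and \<open>K + 1\<close>, with a width \<open>h\<close> that is invariant under the shift
  \<open>w \<mapsto> w + 1\<close> on \<open>K\<close> and so small that only the translate \<open>k = 0\<close> of the window is met.  Against the field with
  a sign change at \<open>w = 0\<close> the contributions of \<open>K\<close> and \<open>K + 1\<close> to each inner product with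
  \<open>j = 0\<close> are opposite, and for \<open>j \<noteq> 0\<close> the supports are disjoint since the dilates of \<open>I\<close> tile.
  Hence the frame identity forces the test function to vanish.
\<close>

lemma wavelet_set_translates_disjoint:
  assumes I [measurable]: "I \<in> sets borel" and I_sub: "I \<subseteq> {-1..<1}"
    and all: "\<And>g. gabor_field I g \<Longrightarrow> heis_wavelet I g"
  shows "AE w in lborel. \<not> (w \<in> I \<and> w + 1 \<in> I)"
proof -
  have tile: "AE w in lborel. dilate_count I w = 1"
    by (rule wavelet_set_dilates_tile[OF I I_sub all])
  define K where "K = {w \<in> I. w + 1 \<in> I}"
  have K_borel [measurable]: "K \<in> sets borel" unfolding K_def by measurable
  have K_neg: "w < 0" "-1 \<le> w" if "w \<in> K" for w using that I_sub by (auto simp: K_def)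
  (* For -1 \<le> w < 0 the shift by 1 exchanges \<bar>w\<bar> and 1 - \<bar>w\<bar>. *)
  define h where "h w = min \<bar>w\<bar> (1 - \<bar>w\<bar>) / 2" for w :: real
  have h_shift: "h (w + 1) = h w" if "w \<in> K" for w
    using K_neg[OF that] by (simp add: h_def min_def)
  have h_le: "2 * h w \<le> \<bar>w\<bar>" for w by (simp add: h_def)
  have [measurable]: "h \<in> borel_measurable borel" unfolding h_def by measurable
  define f :: "real \<times> real \<Rightarrow> complex"
    where "f x = (if (fst x \<in> K \<or> fst x - 1 \<in> K) \<and> \<bar>fst x * snd x\<bar> < h (fst x) then 1 else 0)" for x
  have f [measurable]: "f \<in> borel_measurable borel" unfolding f_def by measurable
  have f_supp: "fst x \<in> I \<and> fst x \<noteq> 0 \<and> \<bar>fst x\<bar> < 1 \<and> \<bar>snd x\<bar> < 1/2" if "f x \<noteq> 0" for x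
  proof -
    have K: "fst x \<in> K \<or> fst x - 1 \<in> K" and lt: "\<bar>fst x * snd x\<bar> < h (fst x)"
      using that by (auto simp: f_def split: if_splits)
    have "0 < h (fst x)" using lt by (rule order.strict_trans1[rotated]) simp
    then have w: "fst x \<noteq> 0" "\<bar>fst x\<bar> < 1" by (auto simp: h_def)
    have "\<bar>fst x\<bar> * \<bar>snd x\<bar> < \<bar>fst x\<bar> * (1/2)" using lt h_le[of "fst x"] by (simp add: abs_mult)
    then have "\<bar>snd x\<bar> < 1/2" using w by (simp add: mult_less_cancel_left_pos)
    with w K show ?thesis by (auto simp: K_def)
  qed
  have f_L2: "f \<in> L2 heis_measure"
  proof -
    have "(\<integral>\<^sup>+x. ennreal ((cmod (f x))\<^sup>2) \<partial>heis_measure) \<le>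
        (\<integral>\<^sup>+w. indicator {-1..1::real} w * (\<integral>\<^sup>+t. indicator {-1/2..1/2::real} t \<partial>lborel) \<partial>lborel)"
    proof (subst nn_integral_heis_cmod[OF f], rule nn_integral_mono)
      fix w :: real
      show "ennreal \<bar>w\<bar> * (\<integral>\<^sup>+t. ennreal ((cmod (f (w, t)))\<^sup>2) \<partial>lborel) \<le>
          indicator {-1..1} w * (\<integral>\<^sup>+t. indicator {-1/2..1/2::real} t \<partial>lborel)"
      proof (cases "\<bar>w\<bar> < 1")
        case False
        then have "f (w, t) = 0" for t using f_supp[of "(w, t)"] by auto
        then show ?thesis by simp
      next
        case True
        have "ennreal ((cmod (f (w, t)))\<^sup>2) \<le> indicator {-1/2..1/2::real} t" for t
          using f_supp[of "(w, t)"] by (auto simp: f_def indicator_def split: if_splits)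
        then have "(\<integral>\<^sup>+t. ennreal ((cmod (f (w, t)))\<^sup>2) \<partial>lborel) \<le> (\<integral>\<^sup>+t. indicator {-1/2..1/2::real} t \<partial>lborel)"
          by (rule nn_integral_mono)
        moreover have "ennreal \<bar>w\<bar> \<le> indicator {-1..1} w" using True by (auto simp: indicator_def)
        ultimately show ?thesis by (intro mult_mono) auto
      qed
    qed
    also have "\<dots> < \<infinity>" by (simp add: nn_integral_multc ennreal_mult_less_top)
    finally show ?thesis by (subst L2_iff_nn_integral) (auto intro: measurable_heis)
  qed
  define \<sigma> :: "real \<Rightarrow> complex" where "\<sigma> w = (if w < 0 then - 1 else 1) * indicator I w" for w
  have [measurable]: "\<sigma> \<in> borel_measurable borel" unfolding \<sigma>_def by measurable
  let ?g = "window_field \<sigma>"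
  have \<sigma>_norm: "cmod (\<sigma> w) = indicator I w" for w by (auto simp: \<sigma>_def indicator_def)
  have g_L2: "?g \<in> L2 heis_measure"
    by (rule window_field_L2) (use I_sub in \<open>auto simp: \<sigma>_norm indicator_def\<close>)
  have field: "gabor_field I ?g"
    by (rule window_field_gabor_field) (use I_sub \<sigma>_norm in auto)
  have base: "L2_inner heis_measure f (hatT k l m ?g) = 0" for k l m
  proof -
    define \<Omega> where "\<Omega> w = \<bar>w\<bar> *\<^sub>R (\<integral>t. f (w, t) * cnj (hatT k l m ?g (w, t)) \<partial>lborel)" for w
    define R where "R a = (if k = 0 then \<integral>s. (if \<bar>s\<bar> < a then 1 else 0) * e2pi (of_int l * s) \<partial>lborel else 0)" for a
    have \<Omega>_eq: "\<Omega> w = cnj (\<sigma> w) * e2pi (- (w * of_int m)) * R (h w)" if "w \<in> K \<or> w - 1 \<in> K" for w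
    proof (cases "w = 0")
      case True
      then show ?thesis by (simp add: \<Omega>_def R_def h_def)
    next
      case False
      show ?thesis
        using rescaled_slice_integral[OF False h_le, of k l m \<sigma>] that
        by (simp add: \<Omega>_def f_def R_def)
    qed
    have "(\<integral>w. \<Omega> w \<partial>lborel) = 0"
    proof (rule integral_antiperiodic_pair[OF _ K_borel])
      show "integrable lborel \<Omega>"
        unfolding \<Omega>_def by (rule integrable_heis_slice) (use f_L2 hatT_L2 g_L2 in auto)
      show "\<Omega> w = 0" if "w \<notin> K" "w - 1 \<notin> K" for w
        using that by (simp add: \<Omega>_def f_def)
      show "\<Omega> (w + 1) = - \<Omega> w" if w: "w \<in> K" for w
      proof -
        have "\<sigma> w = - 1" "\<sigma> (w + 1) = 1"
          using w K_neg[OF w] by (auto simp: \<sigma>_def K_def)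
        moreover have "e2pi (- ((w + 1) * of_int m)) = e2pi (- (w * of_int m))"
          using e2pi_add_of_int[of "- (w * of_int m)" "- m"] by (simp add: distrib_right)
        ultimately show ?thesis
          using w by (simp add: \<Omega>_eq h_shift)
      qed
    qed (use K_neg in force)+
    then show ?thesis
      by (subst L2_inner_heis) (use f_L2 hatT_L2 g_L2 in \<open>auto simp: \<Omega>_def\<close>)
  qed
  have inner0: "L2_inner heis_measure f (hatD j (hatT k l m ?g)) = 0" for j k l m
  proof (cases "j = 0")
    case True
    then show ?thesis using base by (simp add: hatD_def)
  next
    case False
    have m: "hatD j (hatT k l m ?g) \<in> borel_measurable borel" by measurable
    have "AE w in lborel. AE t in (lborel :: real measure). f (w, t) * cnj (hatD j (hatT k l m ?g) (w, t)) = 0"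
      using tile
    proof eventually_elim
      case (elim w)
      (* A nonzero product would put w in both I and a nontrivial dilate of I. *)
      then have uni: "\<exists>!i::int. 2 powr i * w \<in> I" by (simp add: dilate_count_eq_1)
      show ?case
      proof (intro AE_I2)
        fix t :: real
        show "f (w, t) * cnj (hatD j (hatT k l m ?g) (w, t)) = 0"
        proof (rule ccontr)
          assume nz: "f (w, t) * cnj (hatD j (hatT k l m ?g) (w, t)) \<noteq> 0"
          then have "2 powr real_of_int 0 * w \<in> I" using f_supp[of "(w, t)"] by simp
          moreover have "2 powr real_of_int j * w \<in> I"
            using nz by (auto simp: hatD_apply hatT_apply window_field_def \<sigma>_def indicator_def split: if_splits)
          ultimately show False using uni False by blast
        qed
      qed
    qed
    then have "AE x in lborel. f x * cnj (hatD j (hatT k l m ?g) x) = 0"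
      by (intro AE_lborel_prodI) (use m in measurable)
    then have "AE x in heis_measure. f x * cnj (hatD j (hatT k l m ?g) x) = 0"
      by (simp add: AE_heis_iff)
    then show ?thesis unfolding L2_inner_def by (rule integral_eq_zero_AE)
  qed
  have "(\<integral>\<^sup>+x. ennreal ((cmod (f x))\<^sup>2) \<partial>heis_measure) = 0"
    using heis_wavelet_sum[OF all[OF field] f_L2] by (simp add: inner0 case_prod_beta')
  then have "AE x in heis_measure. f x = 0"
    by (subst (asm) nn_integral_0_iff_AE) (auto intro: measurable_heis)
  then have "AE w in lborel. AE t in lborel. f (w, t) = 0"
    unfolding AE_heis_iff by (rule AE_lborel_prodD)
  then have "AE w in lborel. w \<notin> K"
    using AE_lborel_singleton[of "-1"]
  proof eventually_elim
    case (elim w)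
    show ?case
    proof
      assume w: "w \<in> K"
      then have w1: "w \<noteq> 0" "\<bar>w\<bar> < 1" using K_neg[OF w] elim(2) by auto
      define b where "b = h w / \<bar>w\<bar>"
      have b: "0 < b" using w1 by (simp add: b_def h_def)
      have "AE t in lborel. t \<notin> {-b<..<b}"
        using elim(1)
      proof eventually_elim
        case (elim t)
        have "\<bar>w * t\<bar> < h w \<longleftrightarrow> \<bar>t\<bar> < b"
          using w1 by (simp add: b_def abs_mult less_divide_eq mult.commute)
        then show ?case using elim w by (auto simp: f_def)
      qed
      then have "emeasure lborel {-b<..<b} = 0"
        by (subst (asm) AE_iff_measurable[where N = "{-b<..<b}"]) auto
      then show False using b by simp
    qed
  qed
  then show ?thesis by (simp add: K_def)
qed

section \<open>The two congruences\<close>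

text \<open>
  A Borel null set replaces the exceptional set of \<open>P\<close>, which need not be measurable.
\<close>

lemma AE_lborel_fst:
  fixes P :: "real \<Rightarrow> bool"
  assumes "AE w in lborel. P w"
  shows "AE x in (lborel :: (real \<times> real) measure). P (fst x)"
proof -
  obtain N where N: "{x. \<not> P x} \<subseteq> N" "N \<in> null_sets lborel"
    using assms by (auto simp: eventually_ae_filter)
  then have [measurable]: "N \<in> sets borel" by auto
  have "AE x in (lborel :: (real \<times> real) measure). fst x \<notin> N"
    by (rule AE_lborel_prodI) (use AE_not_in[OF N(2)] in \<open>auto elim: eventually_mono\<close>)
  then show ?thesis by eventually_elim (use N(1) in auto)
qed

lemma null_equal_iff:
  "null_equal A B \<longleftrightarrow> A \<in> sets lebesgue \<and> B \<in> sets lebesgue \<and> (AE x in lborel. x \<in> A \<longleftrightarrow> x \<in> B)"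
proof -
  have "(A - B) \<union> (B - A) = {x \<in> space lebesgue. \<not> (x \<in> A \<longleftrightarrow> x \<in> B)}" by auto
  then have "(A - B) \<union> (B - A) \<in> null_sets lebesgue \<longleftrightarrow> (AE x in lebesgue. x \<in> A \<longleftrightarrow> x \<in> B)"
    by (simp only: completion.AE_iff_null_sets)
  then show ?thesis by (auto simp: null_equal_def AE_completion_iff)
qed

text \<open>
  Given a congruence, \<open>\<tau> w\<close> and \<open>\<tau> (w + 1)\<close> differ by an integer and both lie in \<open>[0, 1]\<close>, so they agree
  unless \<open>w\<close> is an integer.  Conversely, adding \<open>1\<close> to the negative points of \<open>I\<close> is injective after
  removal of the null set of overlapping points.
\<close>

lemma translation_congruent_iff_disjoint:
  assumes I [measurable]: "I \<in> sets borel" and I_sub: "I \<subseteq> {-1..<1}"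
  shows "(\<exists>J. J \<in> sets lebesgue \<and> J \<subseteq> {0..1} \<and> translation_congruent I J) \<longleftrightarrow>
    (AE w in lborel. \<not> (w \<in> I \<and> w + 1 \<in> I))"
proof
  assume "\<exists>J. J \<in> sets lebesgue \<and> J \<subseteq> {0..1} \<and> translation_congruent I J"
  then obtain J I' J' \<tau> and k :: "real \<Rightarrow> int" where J: "J \<subseteq> {0..1}"
    and II: "AE x in lborel. x \<in> I \<longleftrightarrow> x \<in> I'" and JJ: "AE x in lborel. x \<in> J \<longleftrightarrow> x \<in> J'"
    and bij: "bij_betw \<tau> I' J'" and \<tau>: "\<And>x. x \<in> I' \<Longrightarrow> \<tau> x = x + of_int (k x)"
    unfolding translation_congruent_def null_equal_iff by blast
  have "AE x in lborel. \<forall>n::int. of_int n + 1 * x \<in> J \<longleftrightarrow> of_int n + 1 * x \<in> J'"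
    unfolding AE_all_countable by (intro allI AE_lborel_affine[OF JJ]) simp
  moreover have "AE x in lborel. 1 + 1 * x \<in> I \<longleftrightarrow> 1 + 1 * x \<in> I'"
    by (intro AE_lborel_affine[OF II]) simp
  moreover have "AE x in lborel. \<forall>n::int. x \<noteq> real_of_int n"
    unfolding AE_all_countable by (intro allI AE_lborel_singleton)
  ultimately show "AE w in lborel. \<not> (w \<in> I \<and> w + 1 \<in> I)"
    using II
  proof eventually_elim
    case (elim w)
    show ?case
    proof
      assume "w \<in> I \<and> w + 1 \<in> I"
      then have w: "w \<in> I'" "w + 1 \<in> I'" using elim(2,4) by (auto simp: add.commute)
      define a b where "a = k w" and "b = 1 + k (w + 1)"
      have ab: "\<tau> w = of_int a + w" "\<tau> (w + 1) = of_int b + w"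
        using w \<tau> by (auto simp: a_def b_def)
      have "\<tau> w \<in> J'" "\<tau> (w + 1) \<in> J'" using bij w by (auto simp: bij_betw_def)
      then have "of_int a + w \<in> J" "of_int b + w \<in> J" using elim(1) by (auto simp: ab)
      then have "0 \<le> of_int a + w" "of_int a + w \<le> 1" "0 \<le> of_int b + w" "of_int b + w \<le> 1"
        using J by auto
      moreover have "of_int a + w \<noteq> 0" "of_int b + w \<noteq> 0"
        using elim(3)[rule_format, of "- a"] elim(3)[rule_format, of "- b"] by auto
      ultimately have "\<bar>real_of_int a - real_of_int b\<bar> < 1" by linarith
      then have "a = b" by linarith
      then have "\<tau> w = \<tau> (w + 1)" by (simp add: ab)
      then have "w = w + 1" using bij w by (auto simp: bij_betw_def dest: inj_onD)
      then show False by simp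
    qed
  qed
next
  assume disj: "AE w in lborel. \<not> (w \<in> I \<and> w + 1 \<in> I)"
  define I' where "I' = {x \<in> I. \<not> (x < 0 \<and> x + 1 \<in> I)}"
  define k :: "real \<Rightarrow> int" where "k x = (if x < 0 then 1 else 0)" for x
  define \<tau> where "\<tau> x = x + of_int (k x)" for x
  have [measurable]: "I' \<in> sets borel" unfolding I'_def by measurable
  have lebesgue: "A \<in> sets lebesgue" if "A \<in> sets borel" for A :: "real set"
    using that by (simp add: sets_completionI_sets)
  have image: "\<tau> ` I' = {y. (y \<in> I \<and> 0 \<le> y) \<or> (y - 1 \<in> I \<and> y - 1 < 0 \<and> y \<notin> I)}"
  proof (intro set_eqI iffI)
    fix y assume "y \<in> \<tau> ` I'"
    then show "y \<in> {y. (y \<in> I \<and> 0 \<le> y) \<or> (y - 1 \<in> I \<and> y - 1 < 0 \<and> y \<notin> I)}"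
      by (auto simp: \<tau>_def k_def I'_def split: if_splits)
  next
    fix y assume "y \<in> {y. (y \<in> I \<and> 0 \<le> y) \<or> (y - 1 \<in> I \<and> y - 1 < 0 \<and> y \<notin> I)}"
    then have "y \<in> I' \<and> y = \<tau> y \<or> y - 1 \<in> I' \<and> y = \<tau> (y - 1)"
      by (auto simp: \<tau>_def k_def I'_def)
    then show "y \<in> \<tau> ` I'" by blast
  qed
  have J: "\<tau> ` I' \<in> sets lebesgue" unfolding image by (rule lebesgue) measurable
  have "\<tau> ` I' \<subseteq> {0..1}" using I_sub by (auto simp: \<tau>_def k_def I'_def)
  moreover have "translation_congruent I (\<tau> ` I')"
    unfolding translation_congruent_def
  proof (intro exI conjI)
    have "AE x in lborel. x \<in> I \<longleftrightarrow> x \<in> I'"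
      using disj by eventually_elim (auto simp: I'_def)
    then show "null_equal I I'" by (simp add: null_equal_iff lebesgue)
    show "null_equal (\<tau> ` I') (\<tau> ` I')" using J by (simp add: null_equal_iff)
    show "bij_betw \<tau> I' (\<tau> ` I')"
    proof (rule inj_on_imp_bij_betw, rule inj_onI)
      fix x y assume xy: "x \<in> I'" "y \<in> I'" "\<tau> x = \<tau> y"
      have "\<not> (u < 0 \<and> 0 \<le> v \<and> u + 1 = v)" if "u \<in> I'" "v \<in> I'" for u v
        using that by (auto simp: I'_def)
      from this[OF xy(1,2)] this[OF xy(2,1)] xy(3) show "x = y"
        by (auto simp: \<tau>_def k_def split: if_splits)
    qed
    have "k \<in> measurable borel (count_space UNIV)" unfolding k_def by measurable
    then have "k \<in> measurable lebesgue (count_space UNIV)" by (intro measurable_completion) simp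
    then show "k \<in> measurable (lebesgue_on I') (count_space UNIV)" by (rule measurable_restrict_space1)
    show "\<forall>x\<in>I'. \<tau> x = x + of_int (k x)" by (simp add: \<tau>_def)
  qed
  ultimately show "\<exists>J. J \<in> sets lebesgue \<and> J \<subseteq> {0..1} \<and> translation_congruent I J" using J by blast
qed

text \<open>
  The exponent that moves \<open>w\<close> into the Shannon set.  The two cases differ because the set
  contains \<open>1/2\<close> and not \<open>1\<close>, but contains \<open>-1\<close> and not \<open>-1/2\<close>.
\<close>

definition shannon_exponent :: "real \<Rightarrow> int" where
  "shannon_exponent w = (if 0 < w then - 1 - \<lfloor>log 2 w\<rfloor> else \<lfloor>- log 2 (- w)\<rfloor>)"

lemma shannon_exponent_iff:
  assumes "w \<noteq> 0"
  shows "2 powr real_of_int j * w \<in> shannon_set \<longleftrightarrow> j = shannon_exponent w"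
proof (cases "0 < w")
  case True
  have two: "1 < (2::real)" by simp
  define L where "L = log 2 w"
  have w: "w = 2 powr L" using True by (simp add: L_def)
  have "2 powr real_of_int j * w \<in> shannon_set \<longleftrightarrow>
      2 powr (- 1) \<le> 2 powr (real_of_int j + L) \<and> 2 powr (real_of_int j + L) < 2 powr 0"
  proof -
    define p where "p = 2 powr (real_of_int j + L)"
    have "0 < p" by (simp add: p_def)
    moreover have "2 powr real_of_int j * w = p" by (simp add: p_def w powr_add)
    ultimately show ?thesis unfolding p_def[symmetric] by (auto simp: shannon_set_def powr_minus)
  qed
  also have "\<dots> \<longleftrightarrow> \<lfloor>L\<rfloor> = - 1 - j"
    unfolding powr_le_cancel_iff[OF two] powr_less_cancel_iff[OF two] floor_eq_iff by auto
  finally show ?thesis using True by (auto simp: shannon_exponent_def L_def)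
next
  case False
  have two: "1 < (2::real)" by simp
  define L where "L = log 2 (- w)"
  have w: "w = - (2 powr L)" using False assms by (simp add: L_def)
  have "2 powr real_of_int j * w \<in> shannon_set \<longleftrightarrow>
      2 powr (- 1) < 2 powr (real_of_int j + L) \<and> 2 powr (real_of_int j + L) \<le> 2 powr 0"
  proof -
    define p where "p = 2 powr (real_of_int j + L)"
    have "0 < p" by (simp add: p_def)
    moreover have "2 powr real_of_int j * w = - p" by (simp add: p_def w powr_add)
    ultimately show ?thesis unfolding p_def[symmetric] by (auto simp: shannon_set_def powr_minus)
  qed
  also have "\<dots> \<longleftrightarrow> \<lfloor>- L\<rfloor> = j"
    unfolding powr_le_cancel_iff[OF two] powr_less_cancel_iff[OF two] floor_eq_iff by auto
  finally show ?thesis using False by (auto simp: shannon_exponent_def L_def)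
qed

lemma powr_int_add: "2 powr real_of_int i * (2 powr real_of_int j * w) = 2 powr real_of_int (i + j) * w"
  by (simp add: powr_add)

lemma powr_int_cancel:
  assumes "2 powr real_of_int i * w = 2 powr real_of_int j * w" "w \<noteq> 0"
  shows "i = j"
  using assms powr_inj[of 2 "real_of_int i" "real_of_int j"] by simp

lemma shannon_set_borel [measurable]: "shannon_set \<in> sets borel"
  by (simp add: shannon_set_def)

text \<open>
  Almost every dyadic orbit avoids, as a whole, the countably many dilates of the exceptional null
  sets.  Along such an orbit \<open>\<delta>\<close> is a bijection from the points in \<open>I\<close> to the points in the Shannon
  set, and there is exactly one of the latter.
\<close>

lemma dilation_congruent_imp_tile:
  assumes "dilation_congruent I shannon_set"
  shows "AE w in lborel. \<exists>!j::int. 2 powr j * w \<in> I"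
proof -
  obtain I' S' \<delta> and j :: "real \<Rightarrow> int" where II: "AE x in lborel. x \<in> I \<longleftrightarrow> x \<in> I'"
    and SS: "AE x in lborel. x \<in> shannon_set \<longleftrightarrow> x \<in> S'"
    and bij: "bij_betw \<delta> I' S'" and \<delta>: "\<And>x. x \<in> I' \<Longrightarrow> \<delta> x = 2 powr of_int (j x) * x"
    using assms unfolding dilation_congruent_def null_equal_iff by blast
  have "AE w in lborel. \<forall>n::int. 0 + 2 powr n * w \<in> I \<longleftrightarrow> 0 + 2 powr n * w \<in> I'"
    unfolding AE_all_countable by (intro allI AE_lborel_affine[OF II]) simp
  moreover have "AE w in lborel. \<forall>n::int. 0 + 2 powr n * w \<in> shannon_set \<longleftrightarrow> 0 + 2 powr n * w \<in> S'"
    unfolding AE_all_countable by (intro allI AE_lborel_affine[OF SS]) simp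
  ultimately show ?thesis
    using AE_lborel_singleton[of 0]
  proof eventually_elim
    case (elim w)
    have I: "2 powr of_int n * w \<in> I \<longleftrightarrow> 2 powr of_int n * w \<in> I'" for n :: int using elim(1) by simp
    have S: "2 powr of_int n * w \<in> S' \<longleftrightarrow> n = shannon_exponent w" for n :: int
      using elim(2) shannon_exponent_iff[OF elim(3)] by simp
    have \<delta>w: "\<delta> (2 powr of_int a * w) = 2 powr of_int (shannon_exponent w) * w" if "2 powr of_int a * w \<in> I'" for a :: int
    proof -
      have "\<delta> (2 powr of_int a * w) = 2 powr of_int (j (2 powr of_int a * w) + a) * w"
        using \<delta>[OF that] by (simp add: powr_int_add)
      moreover have "\<delta> (2 powr of_int a * w) \<in> S'" using bij that by (auto simp: bij_betw_def)
      ultimately show ?thesis using S by metis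
    qed
    show ?case
    proof (rule ex_ex1I)
      have "2 powr of_int (shannon_exponent w) * w \<in> \<delta> ` I'" using bij S by (simp add: bij_betw_def)
      then obtain x where x: "x \<in> I'" "\<delta> x = 2 powr of_int (shannon_exponent w) * w" by auto
      have "x = 2 powr of_int (- j x) * (2 powr of_int (j x) * x)" by (simp only: powr_int_add) simp
      also have "2 powr of_int (j x) * x = 2 powr of_int (shannon_exponent w) * w"
        using \<delta>[OF x(1)] x(2) by simp
      also have "2 powr of_int (- j x) * \<dots> = 2 powr of_int (- j x + shannon_exponent w) * w"
        by (rule powr_int_add)
      finally show "\<exists>n::int. 2 powr n * w \<in> I" using x(1) I by metis
    next
      fix a b :: int assume "2 powr a * w \<in> I" "2 powr b * w \<in> I"
      then have ab: "2 powr a * w \<in> I'" "2 powr b * w \<in> I'" using I by auto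
      then have "\<delta> (2 powr a * w) = \<delta> (2 powr b * w)" by (simp only: \<delta>w)
      then have "2 powr a * w = 2 powr b * w" using bij ab by (auto simp: bij_betw_def dest: inj_onD)
      then show "a = b" using elim(3) by (rule powr_int_cancel)
    qed
  qed
qed

text \<open>
  The set \<open>T\<close> of points whose orbit meets \<open>I\<close> exactly once is invariant under dilation and has
  null complement.  On \<open>T\<close> the map sending a point to the element of the Shannon set in its orbit is a bijection
  from \<open>I\<close>, because every orbit meets both sets once.
\<close>

lemma tile_imp_dilation_congruent:
  assumes I [measurable]: "I \<in> sets borel"
    and tile: "AE w in lborel. \<exists>!j::int. 2 powr j * w \<in> I"
  shows "dilation_congruent I shannon_set"
proof -
  define T where "T = {w. w \<noteq> 0 \<and> dilate_count I w = 1}"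
  have [measurable]: "T \<in> sets borel" unfolding T_def by measurable
  have T_iff: "w \<in> T \<longleftrightarrow> w \<noteq> 0 \<and> (\<exists>!j::int. 2 powr j * w \<in> I)" for w
    by (simp add: T_def dilate_count_eq_1)
  have T_dil: "2 powr of_int n * w \<in> T" if w: "w \<in> T" for n :: int and w
  proof -
    obtain i :: int where i: "2 powr i * w \<in> I" and uni: "\<And>a::int. 2 powr a * w \<in> I \<Longrightarrow> a = i"
      using w unfolding T_iff by blast
    have "\<exists>!a::int. 2 powr a * (2 powr n * w) \<in> I"
    proof (rule ex1I[of _ "i - n"])
      show "2 powr (i - n) * (2 powr n * w) \<in> I" unfolding powr_int_add using i by simp
      show "a = i - n" if "2 powr a * (2 powr n * w) \<in> I" for a
        using uni[of "a + n"] that unfolding powr_int_add by simp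
    qed
    then show ?thesis using w unfolding T_iff by simp
  qed
  have AE_T: "AE w in lborel. w \<in> T"
    using tile AE_lborel_singleton[of 0] by eventually_elim (simp add: T_iff)
  define \<delta> where "\<delta> x = 2 powr of_int (shannon_exponent x) * x" for x
  have \<delta>_S: "\<delta> x \<in> shannon_set" if "x \<in> T" for x
    using shannon_exponent_iff[of x "shannon_exponent x"] that by (simp add: \<delta>_def T_iff)
  have lebesgue: "A \<in> sets lebesgue" if "A \<in> sets borel" for A :: "real set"
    using that by (simp add: sets_completionI_sets)
  show ?thesis
    unfolding dilation_congruent_def
  proof (intro exI conjI)
    show "null_equal I (I \<inter> T)" "null_equal shannon_set (shannon_set \<inter> T)"
      using AE_T by (auto simp: null_equal_iff lebesgue elim: eventually_mono)
    show "bij_betw \<delta> (I \<inter> T) (shannon_set \<inter> T)"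
      unfolding bij_betw_def
    proof (intro conjI equalityI subsetI)
      show "inj_on \<delta> (I \<inter> T)"
      proof (rule inj_onI)
        fix x y assume x: "x \<in> I \<inter> T" and y: "y \<in> I \<inter> T" and eq: "\<delta> x = \<delta> y"
        define c where "c = - shannon_exponent x + shannon_exponent y"
        have "x = 2 powr of_int (- shannon_exponent x) * \<delta> x"
          unfolding \<delta>_def powr_int_add by simp
        also have "\<dots> = 2 powr of_int c * y" unfolding eq unfolding \<delta>_def powr_int_add c_def ..
        finally have xc: "x = 2 powr of_int c * y" .
        have "2 powr real_of_int 0 * y \<in> I" "2 powr real_of_int c * y \<in> I" using x y xc by auto
        moreover have "\<exists>!j::int. 2 powr j * y \<in> I" using y by (simp add: T_iff)
        ultimately have "c = 0" by blast
        then show "x = y" using xc by (metis mult_1 of_int_0 powr_zero_eq_one zero_neq_numeral)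
      qed
    next
      fix y assume "y \<in> \<delta> ` (I \<inter> T)"
      then show "y \<in> shannon_set \<inter> T" using \<delta>_S T_dil by (auto simp: \<delta>_def)
    next
      fix y assume y: "y \<in> shannon_set \<inter> T"
      then obtain i :: int where i: "2 powr i * y \<in> I" unfolding Int_iff T_iff by blast
      have y0: "y \<noteq> 0" using y by (simp add: T_iff)
      have xT: "2 powr i * y \<in> T" using T_dil y by simp
      have "2 powr of_int (shannon_exponent (2 powr i * y) + i) * y \<in> shannon_set"
        using \<delta>_S[OF xT] unfolding \<delta>_def powr_int_add .
      then have "shannon_exponent (2 powr i * y) + i = shannon_exponent y"
        using shannon_exponent_iff[OF y0] by blast
      also have "\<dots> = 0" using shannon_exponent_iff[OF y0, of 0] y by simp
      finally have "\<delta> (2 powr i * y) = y" unfolding \<delta>_def powr_int_add using y0 by simp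
      then show "y \<in> \<delta> ` (I \<inter> T)" using i xT by (metis IntI imageI)
    qed
    have "shannon_exponent \<in> measurable borel (count_space UNIV)"
      unfolding shannon_exponent_def by measurable
    then have "shannon_exponent \<in> measurable lebesgue (count_space UNIV)" by (intro measurable_completion) simp
    then show "shannon_exponent \<in> measurable (lebesgue_on (I \<inter> T)) (count_space UNIV)" by (rule measurable_restrict_space1)
    show "\<forall>x\<in>I \<inter> T. \<delta> x = 2 powr of_int (shannon_exponent x) * x" by (simp add: \<delta>_def)
  qed
qed

section \<open>Characterisation of Heisenberg wavelet sets\<close>

text \<open>
  The right end point is dropped as well, so that the support fits into a half-open interval of
  length two, as \<open>parseval_disjoint_translates\<close> requires.
\<close>

lemma borel_representative_set:
  assumes I: "I \<in> sets lebesgue" and I_sub: "I \<subseteq> {-1..1::real}"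
  obtains I' where "I' \<in> sets borel" "I' \<subseteq> {-1..<1}" "AE w in lborel. w \<in> I \<longleftrightarrow> w \<in> I'"
proof -
  have "(indicator I :: real \<Rightarrow> ennreal) \<in> borel_measurable lebesgue" using I by measurable
  then obtain u :: "real \<Rightarrow> ennreal" where [measurable]: "u \<in> borel_measurable borel"
      and ae: "AE w in lborel. indicator I w = u w"
    using completion_ex_borel_measurable[of "indicator I" lborel] by auto
  define I' where "I' = {w. u w = 1} \<inter> {-1..<1}"
  have "I' \<in> sets borel" unfolding I'_def by measurable
  moreover have "AE w in lborel. w \<in> I \<longleftrightarrow> w \<in> I'"
    using ae AE_lborel_singleton[of 1]
    by eventually_elim (use I_sub in \<open>force simp: I'_def indicator_def split: if_splits\<close>)
  ultimately show ?thesis using that[of I'] by (auto simp: I'_def)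
qed

lemma L2_over_cong:
  assumes "AE w in lborel. w \<in> I \<longleftrightarrow> w \<in> I'"
  shows "L2_over I = L2_over I'"
proof -
  have ae: "AE x in heis_measure. fst x \<in> I \<longleftrightarrow> fst x \<in> I'"
    unfolding AE_heis_iff by (rule AE_lborel_fst[OF assms])
  have "(AE x in heis_measure. fst x \<notin> I \<longrightarrow> g x = 0) \<longleftrightarrow>
      (AE x in heis_measure. fst x \<notin> I' \<longrightarrow> g x = 0)" for g :: "real \<times> real \<Rightarrow> complex"
  proof
    assume "AE x in heis_measure. fst x \<notin> I \<longrightarrow> g x = 0"
    with ae show "AE x in heis_measure. fst x \<notin> I' \<longrightarrow> g x = 0" by eventually_elim simp
  next
    assume "AE x in heis_measure. fst x \<notin> I' \<longrightarrow> g x = 0"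
    with ae show "AE x in heis_measure. fst x \<notin> I \<longrightarrow> g x = 0" by eventually_elim simp
  qed
  then show ?thesis by (simp add: L2_over_def case_prod_beta)
qed

lemma gabor_field_cong:
  assumes ae: "AE w in lborel. w \<in> I \<longleftrightarrow> w \<in> I'" and "gabor_field I g"
  shows "gabor_field I' g"
proof -
  have "AE w in lebesgue. w \<in> I \<longleftrightarrow> w \<in> I'" using ae by (rule AE_completion)
  with assms(2) show ?thesis
    unfolding gabor_field_def L2_over_cong[OF ae] by (auto elim: eventually_elim2)
qed

lemma heisenberg_wavelet_set_cong:
  assumes ae: "AE w in lborel. w \<in> I \<longleftrightarrow> w \<in> I'"
  shows "(\<forall>g. gabor_field I g \<longrightarrow> heis_wavelet I g) \<longleftrightarrow> (\<forall>g. gabor_field I' g \<longrightarrow> heis_wavelet I' g)"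
proof -
  have "AE w in lborel. w \<in> I' \<longleftrightarrow> w \<in> I" using ae by (simp add: eq_commute)
  then have "gabor_field I g \<longleftrightarrow> gabor_field I' g" for g
    using gabor_field_cong[OF ae] gabor_field_cong by blast
  then show ?thesis by (simp add: heis_wavelet_def L2_over_cong[OF ae])
qed

lemma null_equal_cong:
  assumes "A \<in> sets lebesgue" "A' \<in> sets lebesgue" and ae: "AE w in lborel. w \<in> A \<longleftrightarrow> w \<in> A'"
  shows "null_equal A B \<longleftrightarrow> null_equal A' B"
proof -
  have "(AE w in lborel. w \<in> A \<longleftrightarrow> w \<in> B) \<longleftrightarrow> (AE w in lborel. w \<in> A' \<longleftrightarrow> w \<in> B)"
  proof
    assume "AE w in lborel. w \<in> A \<longleftrightarrow> w \<in> B"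
    with ae show "AE w in lborel. w \<in> A' \<longleftrightarrow> w \<in> B" by eventually_elim simp
  next
    assume "AE w in lborel. w \<in> A' \<longleftrightarrow> w \<in> B"
    with ae show "AE w in lborel. w \<in> A \<longleftrightarrow> w \<in> B" by eventually_elim simp
  qed
  then show ?thesis using assms by (simp add: null_equal_iff)
qed

theorem theorem4p6:
  fixes I :: "real set"
  assumes "I \<in> sets lebesgue" and "I \<subseteq> {-1..1}"
  shows "heisenberg_wavelet_set I \<longleftrightarrow>
    (\<exists>J. J \<in> sets lebesgue \<and> J \<subseteq> {0..1} \<and> translation_congruent I J) \<and>
    dilation_congruent I shannon_set"
proof -
  obtain I' where I' [measurable]: "I' \<in> sets borel" and I'_sub: "I' \<subseteq> {-1..<1}"
      and ae: "AE w in lborel. w \<in> I \<longleftrightarrow> w \<in> I'"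
    using borel_representative_set[OF assms] .
  have "null_equal I B \<longleftrightarrow> null_equal I' B" for B
    by (rule null_equal_cong[OF assms(1) _ ae]) (simp add: sets_completionI_sets)
  then have congruent: "translation_congruent I J \<longleftrightarrow> translation_congruent I' J"
    "dilation_congruent I J \<longleftrightarrow> dilation_congruent I' J" for J
    by (simp_all add: translation_congruent_def dilation_congruent_def)
  have dilation: "dilation_congruent I' shannon_set \<longleftrightarrow> (AE w in lborel. dilate_count I' w = 1)"
    unfolding dilate_count_eq_1
    using dilation_congruent_imp_tile tile_imp_dilation_congruent[OF I'] by blast
  have "heisenberg_wavelet_set I \<longleftrightarrow> (\<forall>g. gabor_field I' g \<longrightarrow> heis_wavelet I' g)"
    unfolding heisenberg_wavelet_set_def heisenberg_wavelet_set_cong[OF ae] using assms by blast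
  also have "\<dots> \<longleftrightarrow> (AE w in lborel. \<not> (w \<in> I' \<and> w + 1 \<in> I')) \<and> (AE w in lborel. dilate_count I' w = 1)"
    using gabor_field_wavelet_of_tiling[OF I' I'_sub] wavelet_set_translates_disjoint[OF I' I'_sub]
      wavelet_set_dilates_tile[OF I' I'_sub] by blast
  finally show ?thesis
    unfolding congruent dilation translation_congruent_iff_disjoint[OF I' I'_sub] .
qed

end
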